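(* Let $N\ge0$ be an integer, $k,l\in\{0,\dots,N\}$, and let $\Lambda,M,\omega\in\mathbb{C}$, $z\in\mathbb{C}\setminus\{0\}$ be generic (no denominator below vanishes, apart from the removable cases described in the context). Then the following dual bi-orthogonality relation holds: $$\begin{aligned} \delta_{kl}=\sum_{j=0}^N\frac{w_1(l,j)\,w_2(k,j)}{h_j}\;&{}_{10}\omega_9\big(q^{2(\Lambda-2j-l+1)};\,q^{-2l},\,q^{-2j},\,q^{2(\Lambda-N-j+1)},\,q^{2(\Lambda-j-\omega+M+1)},\\ &\qquad q^{2(\Lambda+M-j+2)},\,q^{-2(M+j+l-2)+\omega+1}/z,\,zq^{-2(M+j-N+l+1)+\omega-1}\big)\\ \times\;&{}_{10}\omega_9\big(q^{2(\Lambda-2j-k+1)};\,q^{-2k},\,q^{-2j},\,q^{2(\Lambda-N-j+1)},\,q^{2(\Lambda-j-\omega+M+1)},\\ &\qquad q^{2(\Lambda+M-j+2)},\,q^{-2(M+j+k-1)+\omega+1}/z,\,zq^{-2(M+j-N+k)+\omega-1}\big), \end{aligned}$$ where, for $x,n\in\{0,\dots,N\}$, $$\begin{aligned} h_n=\;&\frac{(q^2,\,q^{-2(\Lambda+M+1)},\,q^{-2(\Lambda-\omega+M)},\,q^{-2(\Lambda-N)})_n}{(q^{2(M+1)},\,q^{-2N},\,q^{-2(\omega-M)},\,q^{-2\Lambda})_n}\;\frac{(q^{-2(\Lambda+1)})_{2n}}{(q^{-2\Lambda})_{2n}}\\ &\times\frac{(zq^{2M-\omega-1},\,q^{2(M-N)-\omega+5}/z)_n}{(q^{-2(\Lambda+M)+\omega+1}/z,\,zq^{2(N-\Lambda-M)+\omega-5})_n}\\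 &\times\frac{(q^{-2(\Lambda-\omega+2M+1)},\,q^{-2\Lambda})_N}{(q^{-2(\Lambda+M+1)},\,q^{-2(\Lambda-\omega+M)})_N}\;\frac{(zq^{\omega-1},\,zq^{-\omega-3})_N}{(zq^{2M-\omega-1},\,zq^{-2M+\omega-3})_N}, \end{aligned}$$ $$\begin{aligned} w_1(x,n)=\;&q^{2x-2n}\,\frac{\theta(q^{2(\Lambda-\omega+2M-N+1+2x)})}{\theta(q^{2(\Lambda-\omega+2M-N+1)})}\;\frac{(q^{2(\Lambda-\omega+2M-N+1)})_x}{(q^{2(\Lambda-\omega+2M+2)})_x}\;\frac{(zq^{2(\Lambda-n+M)-\omega-1})_x}{(q^{-2(N-2-M-n)-\omega+1}/z)_x}\\ &\times\frac{(q^{2(M+n+1)},\,q^{-2(N-n)},\,q^{-2(\Lambda-n+1)},\,q^{-2(\omega-M-n)})_x}{(q^2,\,q^{2(\Lambda-N+M+2)},\,q^{2(M+1)},\,q^{-2(\Lambda-2n+1)},\,q^{-2N},\,q^{-2(\omega-M)},\,q^{2(\Lambda-N-\omega+M+1)})_x},\\ w_2(x,n)=\;&\frac{(q^{2(M+n+1)},\,q^{-2(N-n)},\,q^{-2(\Lambda-n+1)},\,q^{-2(\omega-M-n)})_x}{(q^{-2(\Lambda-2n+1)})_x}\;\frac{(q^{-2(N-3-\Lambda+n-M)-\omega-1}/z)_x}{(zq^{2(M+n)-\omega-1})_x}. \end{aligned}$$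
   Context: $0<p,q<1$ are fixed and generic (it suffices that they are algebraically independent over $\mathbb{Q}$); $q^x=\exp(x\log q)$. $\theta(z)=\prod_{j\ge0}(1-zp^j)(1-p^{j+1}/z)$; $(a)_n=\prod_{i=0}^{n-1}\theta(aq^{2i})$; $(a_1,\dots,a_r)_n=(a_1)_n\cdots(a_r)_n$; $\delta_{kl}$ is the Kronecker delta. The balanced very-well-poised elliptic hypergeometric series (base $q^2,p$) is $${}_{r+1}\omega_r(a_1;a_4,\dots,a_{r+1})=\sum_{s\ge0}\frac{\theta(a_1q^{4s})}{\theta(a_1)}\frac{(a_1,a_4,\dots,a_{r+1})_s\,q^{2s}}{(q^2,a_1q^2/a_4,\dots,a_1q^2/a_{r+1})_s},\qquad (a_4\cdots a_{r+1})^2=a_1^{r-3}q^{2(r-5)}.$$ A series with parameters $q^{-2x},q^{-2n}$ terminates, and its sum is taken over $0\le s\le\min(x,n)$. Removable cases: a series with parameters $q^{-2x},q^{-2j}$ and $q^{2(\Lambda-N-j+1)}$ (with $x=l$ or $x=k$) has the denominator factor $(q^{2(N-j-x+1)})_s$, which may vanish if $x+j>N$. It is compensated by the factor $(q^{-2(N-j)})_x=(-1)^xq^{-2x(N-j)+x(x-1)}(q^{2(N-j-x+1)})_x$ of $w_1(l,j)$ (for $x=l$, first series) respectively $w_2(k,j)$ (for $x=k$, second series), with $(q^{2(N-j-x+1)})_x/(q^{2(N-j-x+1)})_s$ understood as $(q^{2(N-j-x+1+s)})_{x-s}$.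
   Formalization: Two misprints are corrected: in the first denominator of h_n, (q^{-2Λ})_n is replaced by (q^{-2(Λ+1)})_n, and in w_1(x,n) the prefactor q^{2x-2n} is replaced by q^{2x+2n}; as printed the relation fails for N=1, k=l=0. *)

theory Defs
  imports "HOL-Analysis.Analysis"
begin

definition alg_independent2 :: "real \<Rightarrow> real \<Rightarrow> bool" where
  "alg_independent2 x y \<longleftrightarrow>
     (\<forall>(c :: nat \<Rightarrow> nat \<Rightarrow> rat) d.
        (\<Sum>i\<le>d. \<Sum>j\<le>d. of_rat (c i j) * x ^ i * y ^ j) = 0 \<longrightarrow> (\<forall>i\<le>d. \<forall>j\<le>d. c i j = 0))"

text \<open>For \<open>q > 0\<close>, \<open>qpow q e\<close> unfolds to \<open>exp (e * log q)\<close> with the real logarithm of \<open>q\<close>.\<close>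

abbreviation qpow :: "real \<Rightarrow> complex \<Rightarrow> complex" where
  "qpow q e \<equiv> complex_of_real q powr e"

definition etheta :: "real \<Rightarrow> complex \<Rightarrow> complex" where
  "etheta p z = (\<Prod>j. (1 - z * of_real p ^ j) * (1 - of_real p ^ (j + 1) / z))"

text \<open>Elliptic shifted factorials in base \<open>q\<^sup>2\<close>: \<open>efact p q a n\<close> is \<open>(a)\<^sub>n\<close>, and
  \<open>efacts p q [a\<^sub>1, \<dots>, a\<^sub>r] n\<close> is \<open>(a\<^sub>1, \<dots>, a\<^sub>r)\<^sub>n\<close>.\<close>

definition efact :: "real \<Rightarrow> real \<Rightarrow> complex \<Rightarrow> nat \<Rightarrow> complex" where
  "efact p q a n = (\<Prod>i<n. etheta p (a * of_real q ^ (2 * i)))"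

definition efacts :: "real \<Rightarrow> real \<Rightarrow> complex list \<Rightarrow> nat \<Rightarrow> complex" where
  "efacts p q as n = (\<Prod>a\<leftarrow>as. efact p q a n)"

definition ew_den :: "real \<Rightarrow> real \<Rightarrow> complex \<Rightarrow> complex list \<Rightarrow> nat \<Rightarrow> complex" where
  "ew_den p q a1 as s =
     etheta p a1 * efacts p q (of_real q ^ 2 # map (\<lambda>a. a1 * of_real q ^ 2 / a) as) s"

text \<open>The very-well-poised series with parameters \<open>a1; as\<close>, summed over \<open>0 \<le> s \<le> m\<close>. All
  instances below are terminating, with \<open>m\<close> the termination index, and their parameters satisfy
  the balancing condition.\<close>

definition ew_series :: "real \<Rightarrow> real \<Rightarrow> complex \<Rightarrow> complex list \<Rightarrow> nat \<Rightarrow> complex" where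
  "ew_series p q a1 as m =
     (\<Sum>s\<le>m. etheta p (a1 * of_real q ^ (4 * s)) * efacts p q (a1 # as) s * of_real q ^ (2 * s)
              / ew_den p q a1 as s)"

text \<open>The same series with parameters \<open>a1; b, as\<close>, each term multiplied by \<open>(a1 q\<^sup>2 / b)\<^sub>x\<close>, where
  \<open>(c)\<^sub>x / (c)\<^sub>s\<close> is read as \<open>(c q\<^bsup>2s\<^esup>)\<^bsub>x - s\<^esub>\<close>. It is used only for \<open>m \<le> x\<close>.\<close>

definition ew_series_reg ::
  "real \<Rightarrow> real \<Rightarrow> complex \<Rightarrow> complex \<Rightarrow> complex list \<Rightarrow> nat \<Rightarrow> nat \<Rightarrow> complex" where
  "ew_series_reg p q a1 b as x m =
     (\<Sum>s\<le>m. etheta p (a1 * of_real q ^ (4 * s)) * efacts p q (a1 # b # as) s * of_real q ^ (2 * s)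
              * efact p q (a1 * of_real q ^ 2 / b * of_real q ^ (2 * s)) (x - s)
              / ew_den p q a1 as s)"

text \<open>Parameters of the two series: the first parameter \<open>ser_a1\<close>, the parameter \<open>ser_b\<close> whose
  denominator factor \<open>(q\<^bsup>2(N - j - x + 1)\<^esup>)\<^sub>s\<close> may vanish, and the six remaining ones.\<close>

definition ser_a1 :: "real \<Rightarrow> complex \<Rightarrow> nat \<Rightarrow> nat \<Rightarrow> complex" where
  "ser_a1 q \<Lambda> x j = qpow q (2 * (\<Lambda> - 2 * of_nat j - of_nat x + 1))"

definition ser_b :: "real \<Rightarrow> nat \<Rightarrow> complex \<Rightarrow> nat \<Rightarrow> complex" where
  "ser_b q N \<Lambda> j = qpow q (2 * (\<Lambda> - of_nat N - of_nat j + 1))"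

definition ser_pars1 ::
  "real \<Rightarrow> nat \<Rightarrow> complex \<Rightarrow> complex \<Rightarrow> complex \<Rightarrow> complex \<Rightarrow> nat \<Rightarrow> nat \<Rightarrow> complex list" where
  "ser_pars1 q N \<Lambda> M \<omega> z x j =
    [qpow q (- 2 * of_nat x),
     qpow q (- 2 * of_nat j),
     qpow q (2 * (\<Lambda> - of_nat j - \<omega> + M + 1)),
     qpow q (2 * (\<Lambda> + M - of_nat j + 2)),
     qpow q (- 2 * (M + of_nat j + of_nat x - 2) + \<omega> + 1) / z,
     z * qpow q (- 2 * (M + of_nat j - of_nat N + of_nat x + 1) + \<omega> - 1)]"

definition ser_pars2 ::
  "real \<Rightarrow> nat \<Rightarrow> complex \<Rightarrow> complex \<Rightarrow> complex \<Rightarrow> complex \<Rightarrow> nat \<Rightarrow> nat \<Rightarrow> complex list" where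
  "ser_pars2 q N \<Lambda> M \<omega> z x j =
    [qpow q (- 2 * of_nat x),
     qpow q (- 2 * of_nat j),
     qpow q (2 * (\<Lambda> - of_nat j - \<omega> + M + 1)),
     qpow q (2 * (\<Lambda> + M - of_nat j + 2)),
     qpow q (- 2 * (M + of_nat j + of_nat x - 1) + \<omega> + 1) / z,
     z * qpow q (- 2 * (M + of_nat j - of_nat N + of_nat x) + \<omega> - 1)]"

text \<open>Two misprints of the source are corrected: it has \<open>(q\<^bsup>-2\<Lambda>\<^esup>)\<^sub>n\<close> instead of \<open>(q\<^bsup>-2(\<Lambda> + 1)\<^esup>)\<^sub>n\<close> in
  the denominator of \<open>h\<^sub>n\<close> (\<open>h_den\<close>) and \<open>q\<^bsup>2x - 2n\<^esup>\<close> instead of \<open>q\<^bsup>2x + 2n\<^esup>\<close> in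
  \<open>w\<^sub>1(x, n)\<close> (\<open>w1_rest\<close>). As printed, the relation fails already for \<open>N = 1\<close>, \<open>k = l = 0\<close>:
  for \<open>k = l = 0\<close> both series equal 1 and the relation has to be the Frenkel-Turaev sum with first
  parameter \<open>q\<^bsup>-2(\<Lambda> + 1)\<^esup>\<close>, whose \<open>n\<close>-th term contains \<open>(q\<^bsup>-2(\<Lambda> + 1)\<^esup>)\<^sub>n q\<^bsup>2n\<^esup>\<close>.\<close>

definition h_num ::
  "real \<Rightarrow> real \<Rightarrow> nat \<Rightarrow> complex \<Rightarrow> complex \<Rightarrow> complex \<Rightarrow> complex \<Rightarrow> nat \<Rightarrow> complex" where
  "h_num p q N \<Lambda> M \<omega> z n =
     efacts p q [of_real q ^ 2, qpow q (- 2 * (\<Lambda> + M + 1)), qpow q (- 2 * (\<Lambda> - \<omega> + M)),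
                 qpow q (- 2 * (\<Lambda> - of_nat N))] n
   * efact p q (qpow q (- 2 * (\<Lambda> + 1))) (2 * n)
   * efacts p q [z * qpow q (2 * M - \<omega> - 1), qpow q (2 * (M - of_nat N) - \<omega> + 5) / z] n
   * efacts p q [qpow q (- 2 * (\<Lambda> - \<omega> + 2 * M + 1)), qpow q (- 2 * \<Lambda>)] N
   * efacts p q [z * qpow q (\<omega> - 1), z * qpow q (- \<omega> - 3)] N"

definition h_den ::
  "real \<Rightarrow> real \<Rightarrow> nat \<Rightarrow> complex \<Rightarrow> complex \<Rightarrow> complex \<Rightarrow> complex \<Rightarrow> nat \<Rightarrow> complex" where
  "h_den p q N \<Lambda> M \<omega> z n =
     efacts p q [qpow q (2 * (M + 1)), qpow q (- 2 * of_nat N), qpow q (- 2 * (\<omega> - M)),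
                 qpow q (- 2 * (\<Lambda> + 1))] n
   * efact p q (qpow q (- 2 * \<Lambda>)) (2 * n)
   * efacts p q [qpow q (- 2 * (\<Lambda> + M) + \<omega> + 1) / z,
                 z * qpow q (2 * (of_nat N - \<Lambda> - M) + \<omega> - 5)] n
   * efacts p q [qpow q (- 2 * (\<Lambda> + M + 1)), qpow q (- 2 * (\<Lambda> - \<omega> + M))] N
   * efacts p q [z * qpow q (2 * M - \<omega> - 1), z * qpow q (- 2 * M + \<omega> - 3)] N"

definition h_norm ::
  "real \<Rightarrow> real \<Rightarrow> nat \<Rightarrow> complex \<Rightarrow> complex \<Rightarrow> complex \<Rightarrow> complex \<Rightarrow> nat \<Rightarrow> complex" where
  "h_norm p q N \<Lambda> M \<omega> z n = h_num p q N \<Lambda> M \<omega> z n / h_den p q N \<Lambda> M \<omega> z n"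

definition w1_den ::
  "real \<Rightarrow> real \<Rightarrow> nat \<Rightarrow> complex \<Rightarrow> complex \<Rightarrow> complex \<Rightarrow> complex \<Rightarrow> nat \<Rightarrow> nat \<Rightarrow> complex" where
  "w1_den p q N \<Lambda> M \<omega> z x n =
     etheta p (qpow q (2 * (\<Lambda> - \<omega> + 2 * M - of_nat N + 1)))
   * efact p q (qpow q (2 * (\<Lambda> - \<omega> + 2 * M + 2))) x
   * efact p q (qpow q (- 2 * (of_nat N - 2 - M - of_nat n) - \<omega> + 1) / z) x
   * efacts p q [of_real q ^ 2, qpow q (2 * (\<Lambda> - of_nat N + M + 2)), qpow q (2 * (M + 1)),
                 qpow q (- 2 * (\<Lambda> - 2 * of_nat n + 1)), qpow q (- 2 * of_nat N),
                 qpow q (- 2 * (\<omega> - M)), qpow q (2 * (\<Lambda> - of_nat N - \<omega> + M + 1))] x"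

definition w2_den ::
  "real \<Rightarrow> real \<Rightarrow> complex \<Rightarrow> complex \<Rightarrow> complex \<Rightarrow> complex \<Rightarrow> nat \<Rightarrow> nat \<Rightarrow> complex" where
  "w2_den p q \<Lambda> M \<omega> z x n =
     efact p q (qpow q (- 2 * (\<Lambda> - 2 * of_nat n + 1))) x
   * efact p q (z * qpow q (2 * (M + of_nat n) - \<omega> - 1)) x"

text \<open>\<open>w1_rest\<close> and \<open>w2_rest\<close> are \<open>w1\<close> and \<open>w2\<close> without the factor \<open>(q\<^bsup>-2(N - n)\<^esup>)\<^sub>x\<close>.\<close>

definition w1_rest ::
  "real \<Rightarrow> real \<Rightarrow> nat \<Rightarrow> complex \<Rightarrow> complex \<Rightarrow> complex \<Rightarrow> complex \<Rightarrow> nat \<Rightarrow> nat \<Rightarrow> complex" where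
  "w1_rest p q N \<Lambda> M \<omega> z x n =
     qpow q (2 * of_nat x + 2 * of_nat n)
   * etheta p (qpow q (2 * (\<Lambda> - \<omega> + 2 * M - of_nat N + 1 + 2 * of_nat x)))
   * efact p q (qpow q (2 * (\<Lambda> - \<omega> + 2 * M - of_nat N + 1))) x
   * efact p q (z * qpow q (2 * (\<Lambda> - of_nat n + M) - \<omega> - 1)) x
   * efacts p q [qpow q (2 * (M + of_nat n + 1)), qpow q (- 2 * (\<Lambda> - of_nat n + 1)),
                 qpow q (- 2 * (\<omega> - M - of_nat n))] x
   / w1_den p q N \<Lambda> M \<omega> z x n"

definition w2_rest ::
  "real \<Rightarrow> real \<Rightarrow> nat \<Rightarrow> complex \<Rightarrow> complex \<Rightarrow> complex \<Rightarrow> complex \<Rightarrow> nat \<Rightarrow> nat \<Rightarrow> complex" where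
  "w2_rest p q N \<Lambda> M \<omega> z x n =
     efacts p q [qpow q (2 * (M + of_nat n + 1)), qpow q (- 2 * (\<Lambda> - of_nat n + 1)),
                 qpow q (- 2 * (\<omega> - M - of_nat n))] x
   * efact p q (qpow q (- 2 * (of_nat N - 3 - \<Lambda> + of_nat n - M) - \<omega> - 1) / z) x
   / w2_den p q \<Lambda> M \<omega> z x n"

definition w1 ::
  "real \<Rightarrow> real \<Rightarrow> nat \<Rightarrow> complex \<Rightarrow> complex \<Rightarrow> complex \<Rightarrow> complex \<Rightarrow> nat \<Rightarrow> nat \<Rightarrow> complex" where
  "w1 p q N \<Lambda> M \<omega> z x n =
     efact p q (qpow q (- 2 * (of_nat N - of_nat n))) x * w1_rest p q N \<Lambda> M \<omega> z x n"

definition w2 ::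
  "real \<Rightarrow> real \<Rightarrow> nat \<Rightarrow> complex \<Rightarrow> complex \<Rightarrow> complex \<Rightarrow> complex \<Rightarrow> nat \<Rightarrow> nat \<Rightarrow> complex" where
  "w2 p q N \<Lambda> M \<omega> z x n =
     efact p q (qpow q (- 2 * (of_nat N - of_nat n))) x * w2_rest p q N \<Lambda> M \<omega> z x n"

text \<open>The scalar in \<open>(q\<^bsup>-2(N - j)\<^esup>)\<^sub>x = comp_factor q N x j * (q\<^bsup>2(N - j - x + 1)\<^esup>)\<^sub>x\<close>.\<close>

definition comp_factor :: "real \<Rightarrow> nat \<Rightarrow> nat \<Rightarrow> nat \<Rightarrow> complex" where
  "comp_factor q N x j =
     (- 1) ^ x * qpow q (- 2 * of_nat x * (of_nat N - of_nat j) + of_nat x * (of_nat x - 1))"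

text \<open>\<open>w1R1 \<dots> x j\<close> is \<open>w\<^sub>1(x, j)\<close> times the first series with \<open>l = x\<close>, and \<open>w2R2 \<dots> x j\<close> is
  \<open>w\<^sub>2(x, j)\<close> times the second series with \<open>k = x\<close>. If \<open>x + j > N\<close>, a vanishing
  denominator factor of the series cancels against the vanishing factor of the weight.\<close>

definition w1R1 ::
  "real \<Rightarrow> real \<Rightarrow> nat \<Rightarrow> complex \<Rightarrow> complex \<Rightarrow> complex \<Rightarrow> complex \<Rightarrow> nat \<Rightarrow> nat \<Rightarrow> complex" where
  "w1R1 p q N \<Lambda> M \<omega> z x j =
     (if x + j \<le> N
      then w1 p q N \<Lambda> M \<omega> z x j
           * ew_series p q (ser_a1 q \<Lambda> x j) (ser_b q N \<Lambda> j # ser_pars1 q N \<Lambda> M \<omega> z x j) (min x j)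
      else w1_rest p q N \<Lambda> M \<omega> z x j * comp_factor q N x j
           * ew_series_reg p q (ser_a1 q \<Lambda> x j) (ser_b q N \<Lambda> j) (ser_pars1 q N \<Lambda> M \<omega> z x j) x (min x j))"

definition w2R2 ::
  "real \<Rightarrow> real \<Rightarrow> nat \<Rightarrow> complex \<Rightarrow> complex \<Rightarrow> complex \<Rightarrow> complex \<Rightarrow> nat \<Rightarrow> nat \<Rightarrow> complex" where
  "w2R2 p q N \<Lambda> M \<omega> z x j =
     (if x + j \<le> N
      then w2 p q N \<Lambda> M \<omega> z x j
           * ew_series p q (ser_a1 q \<Lambda> x j) (ser_b q N \<Lambda> j # ser_pars2 q N \<Lambda> M \<omega> z x j) (min x j)
      else w2_rest p q N \<Lambda> M \<omega> z x j * comp_factor q N x j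
           * ew_series_reg p q (ser_a1 q \<Lambda> x j) (ser_b q N \<Lambda> j) (ser_pars2 q N \<Lambda> M \<omega> z x j) x (min x j))"

text \<open>No denominator vanishes; \<open>h_num\<close> is included because \<open>h\<^sub>n\<close> is itself a denominator. The
  denominator factor coming from \<open>ser_b\<close> is left out: for \<open>x + n > N\<close> it is the removable one, and
  for \<open>x + n \<le> N\<close> it involves only \<open>\<theta>(q\<^bsup>2m\<^esup>)\<close> with integers \<open>m > 0\<close>, which are nonzero for
  algebraically independent \<open>p, q\<close>.\<close>

definition nonvanishing_denominators ::
  "real \<Rightarrow> real \<Rightarrow> nat \<Rightarrow> complex \<Rightarrow> complex \<Rightarrow> complex \<Rightarrow> complex \<Rightarrow> bool" where
  "nonvanishing_denominators p q N \<Lambda> M \<omega> z \<longleftrightarrow>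
     (\<forall>n\<le>N. h_num p q N \<Lambda> M \<omega> z n \<noteq> 0 \<and> h_den p q N \<Lambda> M \<omega> z n \<noteq> 0) \<and>
     (\<forall>x\<le>N. \<forall>n\<le>N. w1_den p q N \<Lambda> M \<omega> z x n \<noteq> 0 \<and> w2_den p q \<Lambda> M \<omega> z x n \<noteq> 0 \<and>
        (\<forall>s\<le>min x n. ew_den p q (ser_a1 q \<Lambda> x n) (ser_pars1 q N \<Lambda> M \<omega> z x n) s \<noteq> 0 \<and>
                      ew_den p q (ser_a1 q \<Lambda> x n) (ser_pars2 q N \<Lambda> M \<omega> z x n) s \<noteq> 0))"

end

theory Submission
  imports Defs
begin

text \<open>
  The relation says that the matrix with entries \<open>w\<^sub>1(l, j)\<close> times the first series and the matrix with
  entries \<open>w\<^sub>2(k, j) / h\<^sub>j\<close> times the second series are inverse to each other. The reason is that both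
  matrices factor in such a way that all sums over products of the factors are Frenkel-Turaev sums.

  The series are given in a form in which the first parameter depends on both indices. Two Bailey
  transformations (\<open>bailey_twice\<close>) turn each of them into a sum over \<open>s\<close> of a function of \<open>(l, s)\<close> times a
  function of \<open>(s, j)\<close>: the first matrix is \<open>\<Sum>\<^sub>s \<alpha>(l, s) \<phi>\<^sub>s(j)\<close> (\<open>entry1_expand\<close>) and the second is
  \<open>\<Sum>\<^sub>r \<beta>(k, r) \<chi>\<^sub>r(j)\<close> (\<open>entry2_expand\<close>). There is a choice of which parameters the transformations
  keep. For the first matrix it is made so that \<open>\<phi>\<^sub>s\<close> cuts off the terms with \<open>j < s\<close> of a series with
  the very-well-poised weight \<open>1 / h\<^sub>j\<close>; for the second so that \<open>\<chi>\<^sub>r\<close> shifts two parameters of that weight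
  in opposite directions. Then \<open>\<Sum>\<^sub>j \<phi>\<^sub>s(j) \<chi>\<^sub>r(j) / h\<^sub>j\<close> is a Frenkel-Turaev sum (\<open>sum_jweight_phi_chi\<close>),
  its product with \<open>\<beta>(k, r)\<close> can again be summed over \<open>r\<close> (\<open>sum_beta_gram\<close>), and the remaining sum over \<open>s\<close>
  runs from \<open>k\<close> to \<open>l\<close> and is an orthogonality relation, the case of the Frenkel-Turaev sum with
  vanishing right-hand side (\<open>sum_alpha_gram2\<close>).

  All of this is done for \<open>\<sigma>(x) = q\<^bsup>-x\<^esup> \<theta>(q\<^bsup>2x\<^esup>)\<close>, which is odd and satisfies the three-term relation without
  any powers of \<open>q\<close>. When a balanced series is rewritten in terms of \<open>\<sigma>\<close>, all its terms acquire the same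
  power of \<open>q\<close>. The identities for \<open>\<sigma>\<close> are therefore free of powers, and their arguments are linear in
  the exponents; the powers are collected once, at the end, where they cancel. The three-term relation
  itself is a Pluecker relation: by the triple product, \<open>\<theta>(xy) \<theta>(x/y)\<close> is a double series over pairs of integers, and splitting it
  by the parity of the sum of the two indices exhibits it as a \<open>2 \<times> 2\<close> determinant
  (\<open>etheta_determinant\<close>).

  The Frenkel-Turaev sum is proved with denominators cleared. This also covers the removable
  singularities of the series, because in cleared form the parameter responsible for them contributes
  exactly the regularized factor. The factors have denominators that may vanish although
  those of the original series do not. The relation is therefore first proved for parameters outside
  a countable set on a line through the given ones, and then carried over by continuity of the original
  expressions (\<open>biorthogonality\<close>).
\<close>


section \<open>The Jacobi triple product\<close>

definition tri :: "nat \<Rightarrow> nat" where "tri n = (\<Sum>i<n. i)"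

lemma tri_0 [simp]: "tri 0 = 0" and tri_Suc [simp]: "tri (Suc n) = tri n + n"
  by (simp_all add: tri_def)

lemma tri_add: "tri (m + n) = tri m + tri n + m * n"
  by (induction n) simp_all

lemma tri_square: "tri (Suc n) + tri n = n * n"
  by (induction n) simp_all

definition qfact :: "'a::field \<Rightarrow> nat \<Rightarrow> 'a" where
  "qfact p n = (\<Prod>i<n. 1 - p ^ Suc i)"

definition qbin :: "'a::field \<Rightarrow> nat \<Rightarrow> nat \<Rightarrow> 'a" where
  "qbin p m k = qfact p m / (qfact p k * qfact p (m - k))"

lemma qfact_0 [simp]: "qfact p 0 = 1" and qfact_Suc: "qfact p (Suc n) = qfact p n * (1 - p ^ Suc n)"
  by (simp_all add: qfact_def)

lemma qfact_nz: "(\<And>i. p ^ Suc i \<noteq> 1) \<Longrightarrow> qfact p n \<noteq> 0"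
  by (simp add: qfact_def del: power_Suc)

lemma qbin_pascal:
  assumes "\<And>i. p ^ Suc i \<noteq> (1::'a::field)" "Suc k \<le> m"
  shows "qbin p (Suc m) (Suc k) = p ^ Suc k * qbin p m (Suc k) + qbin p m k"
proof -
  note nz = qfact_nz[OF assms(1)]
  define d where "d = m - Suc k"
  have m: "m = Suc k + d" using assms(2) by (simp add: d_def)
  have nz1: "1 - p ^ Suc k \<noteq> 0" "1 - p ^ Suc d \<noteq> 0" using assms(1) by (metis eq_iff_diff_eq_0)+
  have 1: "Suc m - Suc k = Suc d" "m - Suc k = d" "m - k = Suc d" by (simp_all add: m)
  have "qfact p (Suc m) = qfact p m * ((1 - p ^ Suc k) + p ^ Suc k * (1 - p ^ Suc d))"
    unfolding qfact_Suc by (simp add: m power_add algebra_simps)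
  moreover have "a * (u + t * v) / ((b * u) * (c * v)) = t * (a / ((b * u) * c)) + a / (b * (c * v))"
    if "b \<noteq> 0" "c \<noteq> 0" "u \<noteq> 0" "v \<noteq> 0" for a b c t u v :: 'a
    using that by (simp add: field_simps)
  ultimately show ?thesis
    unfolding qbin_def 1 qfact_Suc[of p k] qfact_Suc[of p d] using nz[of k] nz[of d] nz1 by metis
qed

text \<open>The step splits off the factor \<open>1 + x\<close> and applies the induction hypothesis to \<open>x p\<close>.\<close>
lemma qbinomial_theorem:
  assumes "\<And>i. p ^ Suc i \<noteq> (1::'a::field)"
  shows "(\<Prod>i<m. 1 + x * p ^ i) = (\<Sum>k\<le>m. p ^ tri k * qbin p m k * x ^ k)"
proof (induction m arbitrary: x)
  case 0
  show ?case by (simp add: qbin_def)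
next
  case (Suc m)
  note nz = qfact_nz[OF assms]
  define c where "c = (\<lambda>k. p ^ tri k * x ^ k)"
  have "(\<Prod>i<Suc m. 1 + x * p ^ i) = (1 + x) * (\<Prod>i<m. 1 + (x * p) * p ^ i)"
    by (subst prod.lessThan_Suc_shift) (simp add: mult_ac)
  also have "(\<Prod>i<m. 1 + (x * p) * p ^ i) = (\<Sum>k\<le>m. c k * (p ^ k * qbin p m k))"
    unfolding Suc.IH c_def by (rule sum.cong) (simp_all add: power_mult_distrib mult_ac)
  also have "(1 + x) * (\<Sum>k\<le>m. c k * (p ^ k * qbin p m k)) =
     (\<Sum>k\<le>m. c k * (p ^ k * qbin p m k)) + (\<Sum>k\<le>m. c (Suc k) * qbin p m k)"
    unfolding distrib_right sum_distrib_left
    by (simp add: c_def power_add mult_ac sum.distrib)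
  also have "\<dots> = (\<Sum>k\<le>Suc m. c k * qbin p (Suc m) k)"
  proof -
    have "(\<Sum>k\<le>Suc m. c k * qbin p (Suc m) k)
       = c 0 * qbin p (Suc m) 0 + (\<Sum>k\<le>m. c (Suc k) * qbin p (Suc m) (Suc k))"
      by (rule sum.atMost_Suc_shift)
    also have "(\<Sum>k\<le>m. c (Suc k) * qbin p (Suc m) (Suc k)) =
       (\<Sum>k\<le>m. c (Suc k) * qbin p m k + (if k < m then c (Suc k) * (p ^ Suc k * qbin p m (Suc k)) else 0))"
    proof (rule sum.cong[OF refl])
      fix k assume "k \<in> {..m}"
      then consider "k < m" | "k = m" by force
      then show "c (Suc k) * qbin p (Suc m) (Suc k)
         = c (Suc k) * qbin p m k + (if k < m then c (Suc k) * (p ^ Suc k * qbin p m (Suc k)) else 0)"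
      proof cases
        case 1
        then show ?thesis using qbin_pascal[OF assms, of k m] by (simp add: algebra_simps)
      next
        case 2
        then show ?thesis using nz[of m] nz[of "Suc m"] by (simp add: qbin_def)
      qed
    qed
    also have "\<dots> = (\<Sum>k\<le>m. c (Suc k) * qbin p m k) + (\<Sum>k<m. c (Suc k) * (p ^ Suc k * qbin p m (Suc k)))"
    proof -
      have "(\<Sum>k\<le>m. if k < m then c (Suc k) * (p ^ Suc k * qbin p m (Suc k)) else 0)
         = (\<Sum>k<m. c (Suc k) * (p ^ Suc k * qbin p m (Suc k)))"
        by (rule sum.mono_neutral_cong_right) auto
      then show ?thesis by (simp add: sum.distrib)
    qed
    also have "c 0 * qbin p (Suc m) 0 + ((\<Sum>k\<le>m. c (Suc k) * qbin p m k)
         + (\<Sum>k<m. c (Suc k) * (p ^ Suc k * qbin p m (Suc k))))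
       = (\<Sum>k\<le>m. c k * (p ^ k * qbin p m k)) + (\<Sum>k\<le>m. c (Suc k) * qbin p m k)"
      using nz[of m] nz[of "Suc m"]
      unfolding sum.atMost_shift[of "\<lambda>k. c k * (p ^ k * qbin p m k)"] by (simp add: qbin_def)
    finally show ?thesis by simp
  qed
  finally show ?case by (simp add: c_def mult_ac)
qed

definition tprod :: "real \<Rightarrow> nat \<Rightarrow> complex \<Rightarrow> complex" where
  "tprod p n z = (\<Prod>j<n. (1 - z * of_real p ^ j) * (1 - of_real p ^ (j + 1) / z))"

text \<open>The \<open>q\<close>-binomial theorem with \<open>2n\<close> factors and \<open>x = - z p\<^bsup>-n\<^esup>\<close>, expanded about its middle
  term: the upper half of the sum gives the powers of \<open>z\<close>, the lower half those of \<open>p / z\<close>.\<close>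
lemma finite_triple_product:
  assumes p: "0 < p" "p < 1" and z: "z \<noteq> 0"
  defines "P \<equiv> complex_of_real p"
  shows "tprod p n z = (\<Sum>k\<le>n. P ^ tri k * qbin P (2 * n) (n + k) * (- z) ^ k)
     + (\<Sum>k<n. P ^ tri (Suc k) * qbin P (2 * n) (n + Suc k) * (- (P / z)) ^ Suc k)"
proof -
  have P0: "P \<noteq> 0" using p by (simp add: P_def)
  have P1: "P ^ Suc i \<noteq> 1" for i
    using power_Suc_less_one[of p i] p unfolding P_def
    by (metis less_irrefl of_real_1 of_real_eq_iff of_real_power less_le_trans)
  define x where "x = - z / P ^ n"
  have "(\<Prod>i<2 * n. 1 + x * P ^ i) = (\<Prod>i<n. 1 + x * P ^ i) * (\<Prod>i<n. 1 + x * P ^ (n + i))"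
  proof -
    have "(\<Prod>i<m + n. f i) = (\<Prod>i<m. f i) * (\<Prod>i<n. f (m + i))" for m n and f :: "nat \<Rightarrow> complex"
      by (induction n) (simp_all add: mult.assoc)
    then show ?thesis by (simp only: mult_2)
  qed
  also have "(\<Prod>i<n. 1 + x * P ^ (n + i)) = (\<Prod>i<n. 1 - z * P ^ i)"
    using P0 by (simp add: x_def power_add)
  also have "(\<Prod>i<n. 1 + x * P ^ i) = (\<Prod>i<n. 1 + x * P ^ (n - Suc i))"
    by (rule prod.nat_diff_reindex[symmetric])
  also have "\<dots> = (\<Prod>i<n. - z / P ^ Suc i * (1 - P ^ Suc i / z))"
  proof (rule prod.cong[OF refl])
    fix i assume "i \<in> {..<n}"
    then have "P ^ n = P ^ (n - Suc i) * P ^ Suc i" by (simp flip: power_add del: power_Suc)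
    then show "1 + x * P ^ (n - Suc i) = - z / P ^ Suc i * (1 - P ^ Suc i / z)"
      using P0 z by (simp add: x_def field_simps del: power_Suc)
  qed
  also have "\<dots> = (- z) ^ n / P ^ tri (Suc n) * (\<Prod>i<n. 1 - P ^ Suc i / z)"
  proof -
    have "(\<Prod>i<n. - z / P ^ Suc i) = (- z) ^ n / P ^ tri (Suc n)"
      by (induction n) (simp_all add: power_add mult_ac)
    then show ?thesis by (simp only: prod.distrib)
  qed
  finally have "(\<Prod>i<2 * n. 1 + x * P ^ i) = (- z) ^ n / P ^ tri (Suc n) * tprod p n z"
    by (simp add: tprod_def P_def prod.distrib mult_ac)
  then have "tprod p n z = P ^ tri (Suc n) / (- z) ^ n * (\<Prod>i<2 * n. 1 + x * P ^ i)"
    using P0 z by (simp add: field_simps)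
  also have "\<dots> = (\<Sum>k\<le>2 * n. P ^ tri (Suc n) / (- z) ^ n * (P ^ tri k * qbin P (2 * n) k * x ^ k))"
    unfolding qbinomial_theorem[OF P1] by (rule sum_distrib_left)
  also have "\<dots> = (\<Sum>k\<in>{n..2 * n}. P ^ tri (Suc n) / (- z) ^ n * (P ^ tri k * qbin P (2 * n) k * x ^ k))
     + (\<Sum>k<n. P ^ tri (Suc n) / (- z) ^ n * (P ^ tri k * qbin P (2 * n) k * x ^ k))"
  proof -
    have "{..2 * n} = {n..2 * n} \<union> {..<n}" by auto
    then show ?thesis by (simp only:) (rule sum.union_disjoint, auto)
  qed
  also have "(\<Sum>k\<in>{n..2 * n}. P ^ tri (Suc n) / (- z) ^ n * (P ^ tri k * qbin P (2 * n) k * x ^ k))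
     = (\<Sum>k\<le>n. P ^ tri k * qbin P (2 * n) (n + k) * (- z) ^ k)"
  proof (rule sum.reindex_bij_witness[of _ "\<lambda>k. n + k" "\<lambda>k. k - n"])
    fix k assume k: "k \<in> {n..2 * n}"
    define h where "h = k - n"
    have kh: "k = n + h" using k by (simp add: h_def)
    have "tri (Suc n) + tri (n + h) = n * (n + h) + tri h"
      using tri_square[of n] by (simp add: tri_add algebra_simps)
    then have "P ^ tri (Suc n) * P ^ tri (n + h) = P ^ (n * (n + h)) * P ^ tri h"
      by (simp only: power_add[symmetric])
    moreover have "x ^ (n + h) = (- z) ^ n * (- z) ^ h / P ^ (n * (n + h))"
      by (simp only: x_def power_divide power_add power_mult) simp
    ultimately show "P ^ tri (k - n) * qbin P (2 * n) (n + (k - n)) * (- z) ^ (k - n)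
       = P ^ tri (Suc n) / (- z) ^ n * (P ^ tri k * qbin P (2 * n) k * x ^ k)"
      using P0 z unfolding kh by (simp add: field_simps)
  qed auto
  also have "(\<Sum>k<n. P ^ tri (Suc n) / (- z) ^ n * (P ^ tri k * qbin P (2 * n) k * x ^ k))
    = (\<Sum>k<n. P ^ tri (Suc k) * qbin P (2 * n) (n + Suc k) * (- (P / z)) ^ Suc k)"
  proof (subst sum.nat_diff_reindex[symmetric], rule sum.cong[OF refl])
    fix k assume "k \<in> {..<n}"
    then have k: "Suc k \<le> n" by simp
    define d where "d = n - Suc k"
    have n: "n = d + Suc k" using k by (simp add: d_def)
    have "tri (Suc n) + tri d = n * d + (tri (Suc k) + Suc k)"
    proof -
      have "tri (Suc n) + tri d + tri (Suc k) + d * Suc k = n * n"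
        using tri_square[of n] tri_add[of d "Suc k"] by (simp only: n)
      moreover have "n * n = n * d + d * Suc k + Suc k * Suc k" by (simp add: n algebra_simps)
      moreover have "Suc k * Suc k = tri (Suc k) + Suc k + tri (Suc k)"
        using tri_square[of "Suc k"] by simp
      ultimately show ?thesis by linarith
    qed
    then have e: "P ^ tri (Suc n) * P ^ tri d = P ^ (n * d) * (P ^ tri (Suc k) * P ^ Suc k)"
      by (simp only: power_add[symmetric])
    have qb: "qbin P (2 * n) d = qbin P (2 * n) (n + Suc k)"
    proof -
      have "2 * n - d = n + Suc k" "2 * n - (n + Suc k) = d" by (simp_all add: n)
      then show ?thesis by (simp add: qbin_def mult_ac del: add_Suc_right)
    qed
    have x: "x ^ d = (- z) ^ d / P ^ (n * d)"
      by (simp only: x_def power_divide power_mult)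
    have zn: "(- z) ^ n = (- z) ^ d * (- z) ^ Suc k"
      by (simp only: n power_add)
    have "P ^ tri (Suc n) / (- z) ^ n * (P ^ tri d * qbin P (2 * n) d * x ^ d)
       = (P ^ tri (Suc n) * P ^ tri d) * qbin P (2 * n) d * x ^ d / (- z) ^ n" by simp
    also have "\<dots> = P ^ tri (Suc k) * qbin P (2 * n) (n + Suc k) * (P ^ Suc k / (- z) ^ Suc k)"
      unfolding e qb x zn using P0 z by (simp add: divide_simps del: power_Suc tri_Suc)
    also have "P ^ Suc k / (- z) ^ Suc k = (- (P / z)) ^ Suc k"
      by (simp only: power_divide[symmetric]) simp
    finally show "P ^ tri (Suc n) / (- z) ^ n * (P ^ tri (n - Suc k) * qbin P (2 * n) (n - Suc k) * x ^ (n - Suc k))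
      = P ^ tri (Suc k) * qbin P (2 * n) (n + Suc k) * (- (P / z)) ^ Suc k"
      by (simp only: d_def)
  qed
  finally show ?thesis .
qed

lemma summable_tri:
  fixes p r :: real
  assumes "0 < p" "p < 1" "0 \<le> r"
  shows "summable (\<lambda>k. p ^ tri k * r ^ k)"
proof -
  have "(\<lambda>n. p ^ n * r) \<longlonglongrightarrow> 0 * r"
    by (intro tendsto_intros LIMSEQ_realpow_zero) (use assms in auto)
  then have "\<forall>\<^sub>F n in sequentially. p ^ n * r < 1 / 2"
    by (rule order_tendstoD) simp
  then obtain N where N: "\<And>n. n \<ge> N \<Longrightarrow> p ^ n * r < 1 / 2"
    by (auto simp: eventually_sequentially)
  show ?thesis
  proof (rule summable_ratio_test[of "1 / 2" N])
    fix n assume n: "n \<ge> N"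
    have "norm (p ^ tri (Suc n) * r ^ Suc n) = (p ^ n * r) * norm (p ^ tri n * r ^ n)"
      using assms by (simp add: power_add abs_mult mult_ac)
    also have "\<dots> \<le> 1 / 2 * norm (p ^ tri n * r ^ n)"
      by (rule mult_right_mono) (use N[OF n] in simp_all)
    finally show "norm (p ^ tri (Suc n) * r ^ Suc n) \<le> 1 / 2 * norm (p ^ tri n * r ^ n)" .
  qed simp
qed

text \<open>One half of the bilateral theta series, a power series with infinite radius of convergence.\<close>
definition ptheta :: "real \<Rightarrow> complex \<Rightarrow> complex" where
  "ptheta p w = (\<Sum>k. of_real p ^ tri k * w ^ k)"

context
  fixes p :: real
  assumes p: "0 < p" "p < 1"
begin

lemma summable_ptheta: "summable (\<lambda>k. norm (complex_of_real p ^ tri k * w ^ k))"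
  using summable_tri[OF p, of "norm w"] p by (simp add: norm_mult norm_power)

definition qlim :: real where "qlim = (\<Prod>i. 1 - p ^ Suc i)"

lemma pow_Suc_less: "p ^ Suc i < 1"
  using power_Suc_less_one[of p i] p by simp

lemma conv_q: "convergent_prod (\<lambda>i. 1 - p ^ Suc i)"
proof -
  have "summable (\<lambda>i. norm ((1 - p ^ Suc i) - 1))"
    using p by (simp add: abs_mult power_abs summable_mult summable_geometric)
  then show ?thesis
    by (intro abs_convergent_prod_imp_convergent_prod summable_imp_abs_convergent_prod)
qed

lemma qfact_tendsto: "qfact p \<longlonglongrightarrow> qlim"
proof -
  have "(\<lambda>n. \<Prod>i\<le>n. 1 - p ^ Suc i) \<longlonglongrightarrow> qlim"
    unfolding qlim_def by (rule convergent_prod_LIMSEQ[OF conv_q])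
  then have "(\<lambda>n. \<Prod>i<n. 1 - p ^ Suc i) \<longlonglongrightarrow> qlim"
    by (simp only: LIMSEQ_lessThan_iff_atMost)
  then show ?thesis by (simp only: qfact_def[abs_def])
qed

lemma qlim_le: "qlim \<le> qfact p n"
  unfolding qlim_def qfact_def
  by (rule prod_ge_prodinf[OF convergent_prod_has_prod[OF conv_q]])
     (use pow_Suc_less p in \<open>auto intro: less_imp_le simp del: power_Suc\<close>)

lemma qfact_pos: "qfact p n > 0"
  unfolding qfact_def by (rule prod_pos) (use pow_Suc_less in \<open>auto simp del: power_Suc\<close>)

lemma qlim_pos: "qlim > 0"
proof -
  have "qlim \<noteq> 0" unfolding qlim_def
    by (rule prodinf_nonzero[OF conv_q]) (use pow_Suc_less in \<open>auto simp del: power_Suc simp: less_le\<close>)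
  moreover have "qlim \<ge> 0"
    by (rule LIMSEQ_le_const[OF qfact_tendsto]) (use qfact_pos in \<open>auto intro: less_imp_le\<close>)
  ultimately show ?thesis by simp
qed

lemma qfact_le_1: "qfact p n \<le> 1"
  unfolding qfact_def by (rule prod_le_1) (use pow_Suc_less p in \<open>auto intro: less_imp_le simp del: power_Suc\<close>)

lemma qfact_of_real: "qfact (complex_of_real p) n = of_real (qfact p n)"
  by (simp add: qfact_def)

lemma qbin_of_real: "qbin (complex_of_real p) m k = of_real (qbin p m k)"
  by (simp add: qbin_def qfact_of_real)

lemma qbin_bound: "norm (qbin (complex_of_real p) m k) \<le> 1 / (qlim * qlim)"
proof -
  have "qbin p m k \<le> 1 / (qlim * qlim)" unfolding qbin_def
    by (intro frac_le mult_mono qlim_le qfact_le_1 mult_pos_pos qlim_pos)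
       (use qfact_pos qlim_pos in \<open>auto intro: less_imp_le\<close>)
  moreover have "qbin p m k \<ge> 0"
    using qfact_pos by (simp add: qbin_def less_imp_le)
  ultimately show ?thesis by (simp add: qbin_of_real)
qed

lemma qbin_tendsto: "(\<lambda>n. qbin (complex_of_real p) (2 * n) (n + k)) \<longlonglongrightarrow> of_real (1 / qlim)"
proof -
  have 1: "(\<lambda>n. qfact p (2 * n)) \<longlonglongrightarrow> qlim"
    by (rule filterlim_compose[OF qfact_tendsto]) (auto intro!: filterlim_subseq simp: strict_mono_def)
  have 2: "(\<lambda>n. qfact p (n + k)) \<longlonglongrightarrow> qlim"
    using qfact_tendsto by (rule LIMSEQ_ignore_initial_segment)
  have 3: "(\<lambda>n. qfact p (n - k)) \<longlonglongrightarrow> qlim"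
    by (rule LIMSEQ_offset[of _ k]) (simp add: qfact_tendsto)
  have "(\<lambda>n. qfact p (2 * n) / (qfact p (n + k) * qfact p (n - k))) \<longlonglongrightarrow> qlim / (qlim * qlim)"
    by (intro tendsto_intros 1 2 3) (use qlim_pos in simp)
  moreover have "qbin p (2 * n) (n + k) = qfact p (2 * n) / (qfact p (n + k) * qfact p (n - k))" for n
  proof -
    have "2 * n - (n + k) = n - k" by simp
    then show ?thesis by (simp only: qbin_def)
  qed
  ultimately show ?thesis unfolding qbin_of_real
    using qlim_pos by (intro tendsto_of_real) simp
qed

text \<open>Tannery's theorem: the Gaussian binomial coefficients are uniformly bounded and converge to
  \<open>1 / (p; p)\<^sub>\<infinity>\<close> for fixed distance from the middle.\<close>
lemma truncated_tendsto:
  "(\<lambda>n. \<Sum>k\<le>n. complex_of_real p ^ tri k * qbin (complex_of_real p) (2 * n) (n + k) * w ^ k)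
     \<longlonglongrightarrow> ptheta p w / of_real qlim"
proof -
  define P where "P = complex_of_real p"
  define a where "a = (\<lambda>k n. if k \<le> n then P ^ tri k * qbin P (2 * n) (n + k) * w ^ k else 0)"
  define b where "b = (\<lambda>k. (P ^ tri k * w ^ k) / of_real qlim)"
  define B where "B = (\<lambda>k. norm (P ^ tri k * w ^ k) * (1 / (qlim * qlim)))"
  have "(\<lambda>n. suminf (\<lambda>k. a k n)) \<longlonglongrightarrow> suminf b"
  proof -
    have lim: "(\<lambda>n. a k n) \<longlonglongrightarrow> b k" for k
    proof -
      have "(\<lambda>n. P ^ tri k * qbin P (2 * n) (n + k) * w ^ k) \<longlonglongrightarrow> P ^ tri k * of_real (1 / qlim) * w ^ k"
        unfolding P_def by (intro tendsto_intros qbin_tendsto)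
      moreover have "\<forall>\<^sub>F n in sequentially. a k n = P ^ tri k * qbin P (2 * n) (n + k) * w ^ k"
        using eventually_ge_at_top[of k] by eventually_elim (simp add: a_def)
      ultimately show ?thesis
        by (subst tendsto_cong) (auto simp: b_def)
    qed
    have "norm (a k n) \<le> B k" for k n
    proof (cases "k \<le> n")
      case True
      have "norm (a k n) = norm (P ^ tri k * w ^ k) * norm (qbin P (2 * n) (n + k))"
        using True by (simp add: a_def norm_mult)
      also have "\<dots> \<le> B k" unfolding B_def P_def
        by (rule mult_left_mono[OF qbin_bound]) simp
      finally show ?thesis .
    next
      case False
      then show ?thesis using qlim_pos by (simp add: a_def B_def)
    qed
    then have bound: "\<forall>\<^sub>F (k, n) in at_top \<times>\<^sub>F sequentially. norm (a k n) \<le> B k"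
      by (intro always_eventually) auto
    have "summable B" unfolding B_def P_def by (rule summable_mult2[OF summable_ptheta])
    from tannerys_theorem[OF lim bound this] show ?thesis by simp
  qed
  moreover have "suminf (\<lambda>k. a k n) = (\<Sum>k\<le>n. P ^ tri k * qbin P (2 * n) (n + k) * w ^ k)" for n
    by (subst suminf_finite[of "{..n}"]) (auto simp: a_def)
  moreover have "suminf b = ptheta p w / of_real qlim"
    unfolding b_def ptheta_def P_def
    by (rule suminf_divide) (rule summable_norm_cancel[OF summable_ptheta])
  ultimately show ?thesis by (simp add: P_def)
qed

lemma conv_etheta:
  "convergent_prod (\<lambda>j. (1 - z * complex_of_real p ^ j) * (1 - of_real p ^ (j + 1) / z))"
proof -
  have c: "convergent_prod (\<lambda>j. 1 - u * complex_of_real p ^ j)" for u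
  proof -
    have "summable (\<lambda>j. norm ((1 - u * complex_of_real p ^ j) - 1))"
      using p by (simp add: norm_mult norm_power summable_mult summable_geometric)
    then show ?thesis
      by (intro abs_convergent_prod_imp_convergent_prod summable_imp_abs_convergent_prod)
  qed
  from convergent_prod_mult[OF c[of z] c[of "of_real p / z"]] show ?thesis
    by simp
qed

lemma tprod_tendsto: "(\<lambda>n. tprod p n z) \<longlonglongrightarrow> etheta p z"
proof -
  have "(\<lambda>n. \<Prod>j\<le>n. (1 - z * complex_of_real p ^ j) * (1 - of_real p ^ (j + 1) / z)) \<longlonglongrightarrow> etheta p z"
    unfolding etheta_def by (rule convergent_prod_LIMSEQ[OF conv_etheta])
  then have "(\<lambda>n. \<Prod>j<n. (1 - z * complex_of_real p ^ j) * (1 - of_real p ^ (j + 1) / z)) \<longlonglongrightarrow> etheta p z"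
    by (simp only: LIMSEQ_lessThan_iff_atMost)
  then show ?thesis by (simp only: tprod_def)
qed

theorem triple_product:
  assumes z: "z \<noteq> 0"
  shows "etheta p z = (ptheta p (- z) + ptheta p (- (of_real p / z)) - 1) / of_real qlim"
proof -
  define P where "P = complex_of_real p"
  define S where "S = (\<lambda>w n. \<Sum>k\<le>n. P ^ tri k * qbin P (2 * n) (n + k) * w ^ k)"
  have "tprod p n z = S (- z) n + (S (- (P / z)) n - qbin P (2 * n) (n + 0))" for n
    unfolding finite_triple_product[OF p z] S_def P_def sum.atMost_shift[of "\<lambda>k. _ ^ tri k * _ k * (- (_ / z)) ^ k"]
    by simp
  moreover have "(\<lambda>n. S (- z) n + (S (- (P / z)) n - qbin P (2 * n) (n + 0)))
     \<longlonglongrightarrow> ptheta p (- z) / of_real qlim + (ptheta p (- (P / z)) / of_real qlim - of_real (1 / qlim))"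
    unfolding S_def P_def by (intro tendsto_intros truncated_tendsto qbin_tendsto)
  ultimately have "etheta p z = ptheta p (- z) / of_real qlim
      + (ptheta p (- (P / z)) / of_real qlim - of_real (1 / qlim))"
    using tprod_tendsto[of z] by (intro LIMSEQ_unique[of "\<lambda>n. tprod p n z"]) simp_all
  then show ?thesis by (simp add: P_def diff_divide_distrib add_divide_distrib)
qed

lemma isCont_ptheta: "isCont (ptheta p) w"
  unfolding ptheta_def[abs_def]
proof (rule isCont_powser)
  show "summable (\<lambda>n. complex_of_real p ^ tri n * of_real (norm w + 1) ^ n)"
    by (rule summable_norm_cancel[OF summable_ptheta])
  show "norm w < norm (complex_of_real (norm w + 1))" by (simp only: norm_of_real)
qed

lemma isCont_etheta:
  assumes "z \<noteq> 0" shows "isCont (etheta p) z"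
proof -
  have "isCont (\<lambda>z. (ptheta p (- z) + ptheta p (- (of_real p / z)) - 1) / of_real qlim) z"
    by (intro continuous_intros isCont_o2[OF _ isCont_ptheta]) (use assms qlim_pos in auto)
  moreover have "\<forall>\<^sub>F z in nhds z. etheta p z = (ptheta p (- z) + ptheta p (- (of_real p / z)) - 1) / of_real qlim"
    using t1_space_nhds[OF assms] by eventually_elim (rule triple_product)
  ultimately show ?thesis by (subst isCont_cong)
qed

lemma etheta_zero_iff:
  assumes "z \<noteq> 0"
  shows "etheta p z = 0 \<longleftrightarrow> (\<exists>j. z * of_real p ^ j = 1 \<or> z = of_real p ^ Suc j)"
proof -
  have "etheta p z = 0 \<longleftrightarrow> (\<exists>j. (1 - z * complex_of_real p ^ j) * (1 - of_real p ^ (j + 1) / z) = 0)"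
    unfolding etheta_def
    using convergent_prod_to_zero_iff[OF conv_etheta[of z]] convergent_prod_LIMSEQ[OF conv_etheta[of z]]
      LIMSEQ_unique[OF convergent_prod_LIMSEQ[OF conv_etheta[of z]], of 0] by auto
  moreover have "(1 - z * complex_of_real p ^ j) * (1 - of_real p ^ (j + 1) / z) = 0 \<longleftrightarrow>
      z * of_real p ^ j = 1 \<or> z = of_real p ^ Suc j" for j
    unfolding mult_eq_0_iff using assms by (auto simp: field_simps)
  ultimately show ?thesis by (simp only:)
qed

text \<open>The partial products at \<open>z\<close> and \<open>1 / z\<close> differ in four boundary factors only, two of which
  tend to 1.\<close>
lemma etheta_inverse:
  assumes "z \<noteq> 0" shows "etheta p (1 / z) = - etheta p z / z"
proof -
  have "tprod p n (1 / z) * ((1 - z) * (1 - of_real p ^ n / z)) =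
    (1 - 1 / z) * (1 - z * of_real p ^ n) * tprod p n z" for n
  proof (induction n)
    case (Suc n)
    have "tprod p (Suc n) (1 / z) * ((1 - z) * (1 - of_real p ^ Suc n / z))
      = (tprod p n (1 / z) * ((1 - z) * (1 - of_real p ^ n / z))) * (1 - of_real p ^ Suc n * z) * (1 - of_real p ^ Suc n / z)"
      using assms by (simp add: tprod_def mult_ac)
    also have "\<dots> = (1 - 1 / z) * (1 - z * of_real p ^ Suc n) * tprod p (Suc n) z"
      unfolding Suc.IH by (simp add: tprod_def mult_ac)
    finally show ?case .
  qed (simp add: tprod_def mult.commute)
  moreover have pn: "(\<lambda>n. complex_of_real p ^ n) \<longlonglongrightarrow> 0"
    by (rule LIMSEQ_power_zero) (use p in simp)
  have "(\<lambda>n. tprod p n (1 / z) * ((1 - z) * (1 - of_real p ^ n / z))) \<longlonglongrightarrow> etheta p (1 / z) * ((1 - z) * (1 - 0 / z))"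
    by (intro tendsto_intros tprod_tendsto pn) (use assms in simp)
  moreover have "(\<lambda>n. (1 - 1 / z) * (1 - z * of_real p ^ n) * tprod p n z) \<longlonglongrightarrow> (1 - 1 / z) * (1 - z * 0) * etheta p z"
    by (intro tendsto_intros tprod_tendsto pn)
  ultimately have eq: "etheta p (1 / z) * ((1 - z) * (1 - 0 / z)) = (1 - 1 / z) * (1 - z * 0) * etheta p z"
    by (simp add: LIMSEQ_unique)
  show ?thesis
  proof (cases "z = 1")
    case True
    have "etheta p 1 = 0" by (subst etheta_zero_iff) (auto intro: exI[of _ 0])
    then show ?thesis using True by simp
  next
    case False
    have "(1 - z) * (etheta p (1 / z) * z) = (1 - z) * (- etheta p z)"
      using eq assms by (simp add: field_simps)
    then have "etheta p (1 / z) * z = - etheta p z"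
      using False by (simp only: mult_left_cancel right_minus_eq)
    then show ?thesis using assms by (simp add: field_simps)
  qed
qed

end

section \<open>Theta products as determinants\<close>

lemma has_sum_int:
  fixes f :: "int \<Rightarrow> 'a::banach"
  assumes "summable (\<lambda>k. norm (f (int k)))" "summable (\<lambda>k. norm (f (- int (Suc k))))"
  shows "(f has_sum ((\<Sum>k. f (int k)) + (\<Sum>k. f (- int (Suc k))))) UNIV"
proof -
  have "((\<lambda>k. f (int k)) has_sum (\<Sum>k. f (int k))) UNIV"
    by (rule norm_summable_imp_has_sum[OF assms(1)]) (rule summable_sums[OF summable_norm_cancel[OF assms(1)]])
  moreover have "bij_betw int UNIV {0..}"
    by (rule bij_betw_byWitness[of _ nat]) auto
  ultimately have 1: "(f has_sum (\<Sum>k. f (int k))) {0..}"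
    by (simp add: has_sum_reindex_bij_betw)
  have "((\<lambda>k. f (- int (Suc k))) has_sum (\<Sum>k. f (- int (Suc k)))) UNIV"
    by (rule norm_summable_imp_has_sum[OF assms(2)]) (rule summable_sums[OF summable_norm_cancel[OF assms(2)]])
  moreover have "bij_betw (\<lambda>k. - int (Suc k)) UNIV {..<0}"
    by (rule bij_betw_byWitness[of _ "\<lambda>n. nat (- n - 1)"]) auto
  ultimately have 2: "(f has_sum (\<Sum>k. f (- int (Suc k)))) {..<0}"
    by (simp only: has_sum_reindex_bij_betw[of "\<lambda>k. - int (Suc k)" UNIV "{..<0}" f])
  have "{0::int..} \<union> {..<0} = UNIV" "{0::int..} \<inter> {..<0} = {}" by auto
  with has_sum_Un_disjoint[OF 1 2] show ?thesis by simp
qed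

lemma abs_summable_int:
  fixes f :: "int \<Rightarrow> 'a::banach"
  assumes "summable (\<lambda>k. norm (f (int k)))" "summable (\<lambda>k. norm (f (- int (Suc k))))"
  shows "(\<lambda>x. norm (f x)) summable_on UNIV"
  using has_sum_int[of "\<lambda>n. norm (f n)"] assms by (auto simp: summable_on_def)

text \<open>The Cauchy product over the full rectangle, without diagonal summation.\<close>
lemma infsum_times:
  fixes f :: "'a \<Rightarrow> complex" and g :: "'b \<Rightarrow> complex"
  assumes "(\<lambda>x. norm (f x)) summable_on UNIV" "(\<lambda>x. norm (g x)) summable_on UNIV"
  shows "(\<lambda>(x, y). f x * g y) summable_on UNIV" (is ?A)
    and "infsum f UNIV * infsum g UNIV = infsum (\<lambda>(x, y). f x * g y) UNIV" (is ?B)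
proof -
  have "(\<lambda>xy. norm (case xy of (x, y) \<Rightarrow> f x * g y)) summable_on Sigma UNIV (\<lambda>_. UNIV)"
    unfolding Infinite_Sum.abs_summable_on_Sigma_iff
    using assms by (auto simp: norm_mult infsum_cmult_right' abs_mult infsum_nonneg intro!: summable_on_cmult_right summable_on_cmult_left)
  then have s: "(\<lambda>(x, y). f x * g y) summable_on Sigma UNIV (\<lambda>_. UNIV)"
    by (rule Infinite_Sum.abs_summable_summable)
  then show ?A by simp
  show ?B
    using infsum_Sigma'_banach[OF s] by (simp add: infsum_cmult_right' infsum_cmult_left')
qed

lemma int_tri: "2 * int (tri k) = int k * (int k - 1)"
  by (induction k) (simp_all add: algebra_simps)

lemma tri_int_div: "int k * (int k - 1) div 2 = int (tri k)"
  using int_tri[of k] by linarith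

lemma tri_int_div': "- int k * (- int k - 1) div 2 = int (tri k + k)"
  using int_tri[of k] by (simp add: algebra_simps)

text \<open>The general term of the bilateral series \<open>\<Sum>\<^sub>n (-1)\<^sup>n p\<^bsup>n(n - 1)/2\<^esup> z\<^sup>n\<close>, in integer powers so that the
  reindexing below is linear in the exponents.\<close>
definition tterm :: "real \<Rightarrow> complex \<Rightarrow> int \<Rightarrow> complex" where
  "tterm p z n = (- 1) powi n * of_real p powi (n * (n - 1) div 2) * z powi n"

context
  fixes p :: real
  assumes p: "0 < p" "p < 1"
begin

lemma tterm_nat: "tterm p z (int k) = of_real p ^ tri k * (- z) ^ k"
  unfolding tterm_def tri_int_div by (simp add: power_minus[of z] mult_ac)

lemma tterm_neg:
  assumes "z \<noteq> 0"
  shows "tterm p z (- int k) = of_real p ^ tri k * (- (of_real p / z)) ^ k"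
  unfolding tterm_def tri_int_div'
  using assms by (simp only: power_int_minus power_int_of_nat) (simp add: power_add power_minus[of "_ / _"] power_divide field_simps)

lemma tterm_sums:
  assumes "z \<noteq> 0"
  shows "(\<lambda>j. norm (tterm p z j)) summable_on UNIV" "infsum (tterm p z) UNIV = of_real (qlim p) * etheta p z"
proof -
  have s1: "summable (\<lambda>k. norm (tterm p z (int k)))"
    unfolding tterm_nat by (rule summable_ptheta[OF p])
  have s: "summable (\<lambda>k. norm (complex_of_real p ^ tri k * (- (of_real p / z)) ^ k))"
    by (rule summable_ptheta[OF p])
  have s2: "summable (\<lambda>k. norm (tterm p z (- int (Suc k))))"
    unfolding tterm_neg[OF assms] using s by (subst (asm) summable_Suc_iff[symmetric])
  show "(\<lambda>j. norm (tterm p z j)) summable_on UNIV" by (rule abs_summable_int[OF s1 s2])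
  have "(\<Sum>k. tterm p z (- int (Suc k))) = ptheta p (- (of_real p / z)) - 1"
    unfolding tterm_neg[OF assms] ptheta_def
    using suminf_split_head[OF summable_norm_cancel[OF s]] by simp
  moreover have "(\<Sum>k. tterm p z (int k)) = ptheta p (- z)"
    by (simp add: tterm_nat ptheta_def)
  ultimately show "infsum (tterm p z) UNIV = of_real (qlim p) * etheta p z"
    using infsumI[OF has_sum_int[OF s1 s2]] triple_product[OF p assms] qlim_pos[OF p] by simp
qed

end

context
  fixes p :: real
  assumes p: "0 < p" "p < 1"
begin

text \<open>Summed over all integers, they are theta series with nome \<open>p\<^sup>2\<close>, even respectively odd
  in \<open>x\<close>.\<close>
definition thalf0 :: "complex \<Rightarrow> int \<Rightarrow> complex" where
  "thalf0 x j = of_real p powi (j * j) * x powi (2 * j)"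

definition thalf1 :: "complex \<Rightarrow> int \<Rightarrow> complex" where
  "thalf1 x j = of_real p powi (j * j + j) * x powi (2 * j + 1)"

text \<open>Up to sign and a factor \<open>x\<close>, the terms are those of the bilateral theta series with nome \<open>p\<^sup>2\<close>
  at \<open>p x\<^sup>2\<close> and \<open>p\<^sup>2 x\<^sup>2\<close>.\<close>
lemma thalf_summable:
  assumes "x \<noteq> 0"
  shows "(\<lambda>j. norm (thalf0 x j)) summable_on UNIV" "(\<lambda>j. norm (thalf1 x j)) summable_on UNIV"
proof -
  have p2: "0 < p\<^sup>2" "p\<^sup>2 < 1" using p by (simp_all add: power_less_one_iff abs_square_less_1)
  have e: "norm (thalf0 x j) = norm (tterm (p\<^sup>2) (of_real p * x\<^sup>2) j)"
    "norm (thalf1 x j) = norm x * norm (tterm (p\<^sup>2) (of_real (p\<^sup>2) * x\<^sup>2) j)" for j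
  proof -
    have d: "2 * (j * (j - 1) div 2) = j * (j - 1)" by simp
    have P: "(complex_of_real p)\<^sup>2 powi (j * (j - 1) div 2) = of_real p powi (j * (j - 1))"
      using d by (simp flip: power_int_mult power_int_numeral)
    have 0: "complex_of_real p \<noteq> 0" using p by simp
    have f1: "(complex_of_real p) powi (j * j) = of_real p powi (j * (j - 1)) * of_real p powi j"
      using 0 by (simp add: algebra_simps flip: power_int_add)
    have f2: "(complex_of_real p) powi (j * j + j) = of_real p powi (j * j) * of_real p powi j"
      using 0 by (simp add: power_int_add)
    have f3: "(x\<^sup>2) powi j = x powi (2 * j)"
      by (simp flip: power_int_mult power_int_numeral)
    have f4: "x powi (2 * j + 1) = x * x powi (2 * j)"
      using assms by (simp add: power_int_add mult.commute)
    have f5: "norm ((- 1 :: complex) powi j) = 1" by (simp add: norm_power_int)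
    have f6: "((complex_of_real p)\<^sup>2) powi j = of_real p powi j * of_real p powi j"
      by (simp add: power2_eq_square power_int_mult_distrib)
    have "tterm (p\<^sup>2) (of_real p * x\<^sup>2) j = (- 1) powi j * thalf0 x j"
      "x * tterm (p\<^sup>2) (of_real (p\<^sup>2) * x\<^sup>2) j = (- 1) powi j * thalf1 x j"
      unfolding thalf0_def thalf1_def tterm_def of_real_power P power_int_mult_distrib f2 f1 f3 f4 f6
      by (simp_all only: mult_ac)
    from this[THEN arg_cong[where f = norm]]
    show "norm (thalf0 x j) = norm (tterm (p\<^sup>2) (of_real p * x\<^sup>2) j)"
      "norm (thalf1 x j) = norm x * norm (tterm (p\<^sup>2) (of_real (p\<^sup>2) * x\<^sup>2) j)"
      unfolding norm_mult f5 by simp_all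
  qed
  have nz: "of_real p * x\<^sup>2 \<noteq> 0" "of_real (p\<^sup>2) * x\<^sup>2 \<noteq> 0" using assms p by simp_all
  show "(\<lambda>j. norm (thalf0 x j)) summable_on UNIV"
    unfolding e by (rule tterm_sums(1)[OF p2 nz(1)])
  show "(\<lambda>j. norm (thalf1 x j)) summable_on UNIV"
    unfolding e by (rule summable_on_cmult_right) (rule tterm_sums(1)[OF p2 nz(2)])
qed

lemma sums_split_parity:
  fixes G :: "int \<times> int \<Rightarrow> complex"
  assumes "G summable_on UNIV"
  shows "infsum G UNIV = infsum (\<lambda>(i, j). G (i + j, i - j)) UNIV + infsum (\<lambda>(i, j). G (i + j + 1, i - j)) UNIV"
proof -
  have ev: "(m + n) div 2 + (m - n) div 2 = m" "(m + n) div 2 - (m - n) div 2 = n"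
    if "even (m + n)" for m n :: int using that by presburger+
  have od: "(m + n - 1) div 2 + (m - n - 1) div 2 + 1 = m" "(m + n - 1) div 2 - (m - n - 1) div 2 = n"
    if "odd (m + n)" for m n :: int using that by presburger+
  define E where "E = {mn::int \<times> int. even (fst mn + snd mn)}"
  have "E \<union> - E = UNIV" "E \<inter> - E = {}" by auto
  then have "infsum G UNIV = infsum G E + infsum G (- E)"
    using infsum_Un_disjoint[of G E "- E"] summable_on_subset_banach[OF assms] by auto
  also have "infsum G E = infsum (\<lambda>(i, j). G (i + j, i - j)) UNIV"
    by (rule infsum_reindex_bij_witness[of _ "\<lambda>(i, j). (i + j, i - j)"
          "\<lambda>(m, n). ((m + n) div 2, (m - n) div 2)"])
       (clarsimp simp: E_def ev simp del: even_add | presburger)+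
  also have "infsum G (- E) = infsum (\<lambda>(i, j). G (i + j + 1, i - j)) UNIV"
    by (rule infsum_reindex_bij_witness[of _ "\<lambda>(i, j). (i + j + 1, i - j)"
          "\<lambda>(m, n). ((m + n - 1) div 2, (m - n - 1) div 2)"])
       (clarsimp simp: E_def od simp del: even_add | presburger)+
  finally show ?thesis .
qed

text \<open>In the double series for \<open>\<theta>(x y) \<theta>(x / y)\<close> the variable \<open>x\<close> carries the sum of the two summation
  indices and \<open>y\<close> their difference. Both have the same parity, and on each parity class the quadratic
  exponent of \<open>p\<close> separates.\<close>
theorem etheta_determinant:
  assumes x: "x \<noteq> 0" and y: "y \<noteq> 0"
  shows "(of_real (qlim p))\<^sup>2 * (etheta p (x * y) * etheta p (x / y)) =
    x * (infsum (thalf1 x) UNIV * infsum (thalf0 y) UNIV - infsum (thalf0 x) UNIV * infsum (thalf1 y) UNIV)"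
proof -
  have p0: "complex_of_real p \<noteq> 0" using p by simp
  have pa: "complex_of_real p powi m * of_real p powi n = of_real p powi (m + n)" for m n
    using p0 by (simp add: power_int_add)
  have nz: "x * y \<noteq> 0" "x / y \<noteq> 0" using x y by simp_all
  define G where "G = (\<lambda>(m, n). tterm p (x * y) m * tterm p (x / y) n)"
  have sG: "G summable_on UNIV"
    unfolding G_def by (rule infsum_times(1)[OF tterm_sums(1)[OF p nz(1)] tterm_sums(1)[OF p nz(2)]])
  have "(of_real (qlim p))\<^sup>2 * (etheta p (x * y) * etheta p (x / y))
      = infsum (tterm p (x * y)) UNIV * infsum (tterm p (x / y)) UNIV"
    unfolding tterm_sums(2)[OF p nz(1)] tterm_sums(2)[OF p nz(2)] by (simp add: power2_eq_square)
  also have "\<dots> = infsum G UNIV"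
    unfolding G_def by (rule infsum_times(2)[OF tterm_sums(1)[OF p nz(1)] tterm_sums(1)[OF p nz(2)]])
  also have "\<dots> = infsum (\<lambda>(i, j). G (i + j, i - j)) UNIV + infsum (\<lambda>(i, j). G (i + j + 1, i - j)) UNIV"
    by (rule sums_split_parity[OF sG])
  also have "infsum (\<lambda>(i, j). G (i + j, i - j)) UNIV = infsum (\<lambda>(i, j). x * (thalf1 x (i - 1) * thalf0 y j)) UNIV"
  proof (rule infsum_cong)
    fix ij :: "int \<times> int"
    obtain i j where ij: "ij = (i, j)" by force
    have e: "(i + j) * (i + j - 1) div 2 + (i - j) * (i - j - 1) div 2 = (i - 1) * (i - 1) + (i - 1) + j * j"
    proof -
      have "even ((i + j) * (i + j - 1))" "even ((i - j) * (i - j - 1))" by auto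
      then have "2 * ((i + j) * (i + j - 1) div 2 + (i - j) * (i - j - 1) div 2)
          = (i + j) * (i + j - 1) + (i - j) * (i - j - 1)" by simp
      also have "\<dots> = 2 * ((i - 1) * (i - 1) + (i - 1) + j * j)" by (simp add: algebra_simps)
      finally show ?thesis by simp
    qed
    have m1: "(- 1 :: complex) powi (i + j) * (- 1) powi (i - j) = 1"
    proof -
      have "(- 1 :: complex) powi (i + j) * (- 1) powi (i - j) = (- 1) powi (2 * i)"
        by (simp flip: power_int_add)
      then show ?thesis by (simp add: power_int_mult)
    qed
    have xx: "x powi (i + j) * x powi (i - j) = x * x powi (2 * (i - 1) + 1)"
    proof -
      have "x * x powi (2 * (i - 1) + 1) = x powi (1 + (2 * (i - 1) + 1))"
        using x by (subst power_int_add) simp_all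
      also have "1 + (2 * (i - 1) + 1) = (i + j) + (i - j)" by simp
      also have "x powi ((i + j) + (i - j)) = x powi (i + j) * x powi (i - j)"
        using x by (subst power_int_add) simp_all
      finally show ?thesis ..
    qed
    have yy: "y powi (i + j) / y powi (i - j) = y powi (2 * j)"
      using y by (simp flip: power_int_diff)
    have "G (i + j, i - j) = ((- 1) powi (i + j) * (- 1) powi (i - j))
       * (of_real p powi ((i + j) * (i + j - 1) div 2) * of_real p powi ((i - j) * (i - j - 1) div 2))
       * (x powi (i + j) * x powi (i - j)) * (y powi (i + j) / y powi (i - j))"
      by (simp add: G_def tterm_def power_int_mult_distrib power_int_divide_distrib)
    also have "of_real p powi ((i + j) * (i + j - 1) div 2) * of_real p powi ((i - j) * (i - j - 1) div 2)
       = (of_real p powi ((i - 1) * (i - 1) + (i - 1)) * of_real p powi (j * j) :: complex)"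
      by (simp only: pa e)
    finally show "(case ij of (i, j) \<Rightarrow> G (i + j, i - j)) = (case ij of (i, j) \<Rightarrow> x * (thalf1 x (i - 1) * thalf0 y j))"
      unfolding ij m1 xx yy by (simp add: thalf1_def thalf0_def)
  qed
  also have "\<dots> = x * (infsum (thalf1 x) UNIV * infsum (thalf0 y) UNIV)"
  proof -
    have "infsum (\<lambda>(i, j). x * (thalf1 x (i - 1) * thalf0 y j)) UNIV
       = infsum (\<lambda>(i, j). x * (thalf1 x i * thalf0 y j)) UNIV"
      by (rule infsum_reindex_bij_witness[of _ "\<lambda>(i, j). (i + 1, j)" "\<lambda>(i, j). (i - 1, j)"]) auto
    also have "\<dots> = x * infsum (\<lambda>(i, j). thalf1 x i * thalf0 y j) UNIV"
      by (simp add: case_prod_unfold infsum_cmult_right')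
    finally show ?thesis
      using infsum_times(2)[OF thalf_summable(2)[OF x] thalf_summable(1)[OF y]] by simp
  qed
  also have "infsum (\<lambda>(i, j). G (i + j + 1, i - j)) UNIV = infsum (\<lambda>(i, j). (- x) * (thalf0 x i * thalf1 y j)) UNIV"
  proof (rule infsum_cong)
    fix ij :: "int \<times> int"
    obtain i j where ij: "ij = (i, j)" by force
    have e: "(i + j + 1) * (i + j + 1 - 1) div 2 + (i - j) * (i - j - 1) div 2 = i * i + (j * j + j)"
    proof -
      have "even ((i + j + 1) * (i + j + 1 - 1))" "even ((i - j) * (i - j - 1))" by auto
      then have "2 * ((i + j + 1) * (i + j + 1 - 1) div 2 + (i - j) * (i - j - 1) div 2)
          = (i + j + 1) * (i + j + 1 - 1) + (i - j) * (i - j - 1)" by simp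
      also have "\<dots> = 2 * (i * i + (j * j + j))" by (simp add: algebra_simps)
      finally show ?thesis by simp
    qed
    have m1: "(- 1 :: complex) powi (i + j + 1) * (- 1) powi (i - j) = - 1"
    proof -
      have "(- 1 :: complex) powi (i + j + 1) * (- 1) powi (i - j) = (- 1) powi (2 * i + 1)"
        by (simp flip: power_int_add)
      then show ?thesis by (simp add: power_int_add power_int_mult)
    qed
    have xx: "x powi (i + j + 1) * x powi (i - j) = x * x powi (2 * i)"
    proof -
      have "x * x powi (2 * i) = x powi (1 + 2 * i)"
        using x by (subst power_int_add) simp_all
      also have "1 + 2 * i = (i + j + 1) + (i - j)" by simp
      also have "x powi ((i + j + 1) + (i - j)) = x powi (i + j + 1) * x powi (i - j)"
        using x by (subst power_int_add) simp_all
      finally show ?thesis ..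
    qed
    have yy: "y powi (i + j + 1) / y powi (i - j) = y powi (2 * j + 1)"
      using y by (simp flip: power_int_diff)
    have "G (i + j + 1, i - j) = ((- 1) powi (i + j + 1) * (- 1) powi (i - j))
       * (of_real p powi ((i + j + 1) * (i + j + 1 - 1) div 2) * of_real p powi ((i - j) * (i - j - 1) div 2))
       * (x powi (i + j + 1) * x powi (i - j)) * (y powi (i + j + 1) / y powi (i - j))"
      by (simp add: G_def tterm_def power_int_mult_distrib power_int_divide_distrib)
    also have "of_real p powi ((i + j + 1) * (i + j + 1 - 1) div 2) * of_real p powi ((i - j) * (i - j - 1) div 2)
       = (of_real p powi (i * i) * of_real p powi (j * j + j) :: complex)"
      by (simp only: pa e)
    finally show "(case ij of (i, j) \<Rightarrow> G (i + j + 1, i - j)) = (case ij of (i, j) \<Rightarrow> (- x) * (thalf0 x i * thalf1 y j))"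
      unfolding ij m1 xx yy by (simp add: thalf1_def thalf0_def)
  qed
  also have "\<dots> = - x * (infsum (thalf0 x) UNIV * infsum (thalf1 y) UNIV)"
    unfolding infsum_times(2)[OF thalf_summable(1)[OF x] thalf_summable(2)[OF y]]
    by (simp only: case_prod_unfold infsum_cmult_right')
  finally show ?thesis by (simp add: algebra_simps)
qed

end

section \<open>Shifted factorials and the Frenkel-Turaev sum\<close>

text \<open>The abstract setting of the summation formulas. The variables are additive: \<open>sg x\<close> stands for a
  theta function at \<open>q\<^bsup>2x\<^esup>\<close>, normalized to be odd.\<close>
locale sigma_function =
  fixes sg :: "complex \<Rightarrow> complex"
  assumes sg_minus: "sg (- x) = - sg x"
    and three_term: "sg (x + y) * sg (x - y) * sg (u + v) * sg (u - v) =
      sg (x + u) * sg (x - u) * sg (y + v) * sg (y - v)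
      + sg (x + v) * sg (x - v) * sg (u + y) * sg (u - y)"
    and sg_nat_nz: "n > 0 \<Longrightarrow> sg (of_nat n) \<noteq> 0"
begin

definition sf :: "complex \<Rightarrow> nat \<Rightarrow> complex" where
  "sf x n = (\<Prod>i<n. sg (x + of_nat i))"

lemma sg_0 [simp]: "sg 0 = 0"
  using sg_minus[of 0] by simp

lemma sg_minus_diff: "sg (x - y) = - sg (y - x)"
  using sg_minus[of "y - x"] by simp

lemma sf_0 [simp]: "sf x 0 = 1" by (simp add: sf_def)

lemma sf_Suc: "sf x (Suc n) = sf x n * sg (x + of_nat n)" by (simp add: sf_def)

lemma sf_rec: "sf x (Suc n) = sg x * sf (x + 1) n"
  unfolding sf_def by (subst prod.lessThan_Suc_shift) (simp add: algebra_simps)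

lemma sf_add: "sf x (m + n) = sf x m * sf (x + of_nat m) n"
  by (induction n) (simp_all add: sf_Suc algebra_simps)

lemma sf_split: "m \<le> n \<Longrightarrow> sf x n = sf x m * sf (x + of_nat m) (n - m)"
  using sf_add[of x m "n - m"] by simp

lemma sf_reflect: "sf x n = (- 1) ^ n * sf (1 - x - of_nat n) n"
proof (induction n arbitrary: x)
  case (Suc n)
  have "sf x (Suc n) = sg x * sf (x + 1) n" by (rule sf_rec)
  also have "\<dots> = sg x * ((- 1) ^ n * sf (1 - (x + 1) - of_nat n) n)"
    using Suc[of "x + 1"] by simp
  also have "1 - (x + 1) - of_nat n = 1 - x - of_nat (Suc n)" by simp
  also have "sg x * ((- 1) ^ n * sf (1 - x - of_nat (Suc n)) n)
      = (- 1) ^ Suc n * (sf (1 - x - of_nat (Suc n)) n * sg (- x))"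
    by (simp add: sg_minus)
  also have "- x = 1 - x - of_nat (Suc n) + of_nat n" by simp
  finally show ?case by (simp only: sf_Suc)
qed simp

lemma sf_nz_iff: "sf x n \<noteq> 0 \<longleftrightarrow> (\<forall>i<n. sg (x + of_nat i) \<noteq> 0)"
  by (auto simp: sf_def)

lemma sf_nz: "(\<And>i. i < n \<Longrightarrow> sg (x + of_nat i) \<noteq> 0) \<Longrightarrow> sf x n \<noteq> 0"
  by (auto simp: sf_def)

lemma sf_1_nz [simp]: "sf 1 n \<noteq> 0"
proof (rule sf_nz)
  fix i :: nat
  have "(1 :: complex) + of_nat i = of_nat (Suc i)" by simp
  then show "sg (1 + of_nat i) \<noteq> 0" using sg_nat_nz[of "Suc i"] by simp
qed

lemma sf_neg_zero: "j < n \<Longrightarrow> sf (- of_nat j) n = 0"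
  by (auto simp: sf_def intro!: bexI[of _ j])

text \<open>The very-well-poised part \<open>[a + 2s] / ([a + s] \<dots> [a + s + n])\<close> of the \<open>s\<close>-th term of a series
  terminating at \<open>n\<close>. For \<open>s = 0\<close> the factor \<open>[a]\<close> is cancelled, so that \<open>[a] = 0\<close> is harmless.\<close>
definition vwp :: "complex \<Rightarrow> nat \<Rightarrow> nat \<Rightarrow> complex" where
  "vwp a n s = (if s = 0 then 1 / sf (a + 1) n else sg (a + 2 * of_nat s) / sf (a + of_nat s) (n + 1))"

definition vcoef :: "complex \<Rightarrow> nat \<Rightarrow> nat \<Rightarrow> complex" where
  "vcoef a n s = (- 1) ^ s * vwp a n s / (sf 1 s * sf 1 (n - s))"

text \<open>The well-poised pair \<open>(x)\<^sub>s / (a + 1 - x)\<^sub>s\<close>, multiplied by \<open>(a + 1 - x)\<^sub>n\<close>. A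
  terminating series cleared in this way has no denominators besides those of \<open>vwp\<close>.\<close>
definition wpair :: "complex \<Rightarrow> nat \<Rightarrow> complex \<Rightarrow> nat \<Rightarrow> complex" where
  "wpair a n x s = sf x s * sf (a + 1 - x + of_nat s) (n - s)"

text \<open>The denominators of \<open>vwp a n s\<close> for \<open>s \<le> n\<close> do not vanish.\<close>
definition regular :: "complex \<Rightarrow> nat \<Rightarrow> bool" where
  "regular a n \<longleftrightarrow> (\<forall>i. 1 \<le> i \<and> i \<le> 2 * n \<longrightarrow> sg (a + of_nat i) \<noteq> 0)"

lemma regularD: "regular a n \<Longrightarrow> 1 \<le> i \<Longrightarrow> i \<le> 2 * n \<Longrightarrow> sg (a + of_nat i) \<noteq> 0"
  by (simp add: regular_def)

lemma vwp_nz: "sg a \<noteq> 0 \<Longrightarrow> vwp a n s = sg (a + 2 * of_nat s) / sf (a + of_nat s) (n + 1)"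
  using sf_rec[of a n] by (simp add: vwp_def)

lemma wpair_Suc: "s \<le> n \<Longrightarrow> wpair a (Suc n) x s = wpair a n x s * sg (a + 1 - x + of_nat n)"
  by (simp add: wpair_def Suc_diff_le sf_Suc of_nat_diff algebra_simps)

lemma wpair_Suc_Suc: "wpair a (Suc n) x (Suc s) = sg x * wpair (a + 2) n (x + 1) s"
  by (simp add: wpair_def sf_rec algebra_simps)

lemma vcoef_Suc:
  assumes "s \<le> n" and "regular a (Suc n)"
  shows "vcoef a n s = vcoef a (Suc n) s * (sg (of_nat (Suc n) - of_nat s) * sg (a + of_nat s + of_nat (Suc n)))"
proof -
  have 1: "sf 1 (Suc n - s) = sf 1 (n - s) * sg (of_nat (Suc n) - of_nat s)"
    using assms(1) by (simp add: Suc_diff_le sf_Suc algebra_simps of_nat_diff)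
  have nz: "sg (of_nat (Suc n) - of_nat s) \<noteq> 0"
    using sg_nat_nz[of "Suc n - s"] assms(1) by (simp add: of_nat_diff)
  have nz2: "sg (a + of_nat s + of_nat (Suc n)) \<noteq> 0"
    using regularD[OF assms(2), of "s + Suc n"] assms(1) by (simp add: algebra_simps)
  have 2: "vwp a n s = vwp a (Suc n) s * sg (a + of_nat s + of_nat (Suc n))"
  proof (cases "s = 0")
    case True
    then show ?thesis using nz2 by (simp add: vwp_def sf_Suc add_ac)
  next
    case False
    then show ?thesis using nz2 by (simp add: vwp_def sf_Suc[of _ "Suc n"] add_ac)
  qed
  show ?thesis using nz by (simp add: vcoef_def 1 2)
qed

lemma vcoef_Suc_Suc:
  assumes "s \<le> n" and "regular a (Suc n)"
  shows "vcoef (a + 2) n s = - vcoef a (Suc n) (Suc s) * (sg (of_nat (Suc s)) * sg (a + of_nat (Suc s)))"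
proof -
  have 1: "sf 1 (Suc s) = sf 1 s * sg (of_nat (Suc s))"
    by (simp add: sf_Suc)
  have nz: "sg (of_nat (Suc s)) \<noteq> 0"
    using sg_nat_nz[of "Suc s"] by simp
  have nz2: "sg (a + of_nat (Suc s)) \<noteq> 0" "sg (a + 2) \<noteq> 0"
    using regularD[OF assms(2), of "Suc s"] regularD[OF assms(2), of 2] assms(1) by auto
  have "vwp (a + 2) n s = vwp a (Suc n) (Suc s) * sg (a + of_nat (Suc s))"
    using nz2(1) unfolding vwp_nz[OF nz2(2)]
    by (simp add: vwp_def sf_rec[of _ "Suc n"] algebra_simps)
  then show ?thesis using nz by (simp add: vcoef_def 1)
qed

text \<open>The three-term relation in the form needed for the induction: after multiplication by a factor
  independent of \<open>s\<close>, the pair of \<open>y + 1\<close> for \<open>n + 1\<close> is a combination of the pairs for \<open>(a, n)\<close> and, with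
  \<open>s\<close> lowered by one, \<open>(a + 2, n)\<close>. The coefficients are those that \<open>vcoef\<close> acquires in
  \<open>vcoef_Suc\<close> and \<open>vcoef_Suc_Suc\<close>.\<close>
lemma wpair_split:
  assumes "s \<le> n"
  shows "wpair a (Suc n) (y + 1) s * (sg (of_nat (Suc n)) * sg (a + of_nat (Suc n))) =
      sg (of_nat (Suc n) - of_nat s) * sg (a + of_nat s + of_nat (Suc n)) * sg (a - y) * wpair a n y s
    + (if s = 0 then 0 else
        sg (of_nat s) * sg (a + of_nat s) * sg (y + of_nat (Suc n)) * wpair (a + 2) n (y + 1) (s - 1))"
proof (cases s)
  case 0
  have "wpair a (Suc n) (y + 1) 0 = sg (a - y) * wpair a n y 0"
    by (simp add: wpair_def sf_rec algebra_simps)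
  then show ?thesis using 0 by (simp add: algebra_simps)
next
  case (Suc r)
  have eq: "sg (y + of_nat s) * sg (a - y + of_nat s) * sg (of_nat (Suc n)) * sg (a + of_nat (Suc n)) =
      sg (of_nat (Suc n) - of_nat s) * sg (a + of_nat s + of_nat (Suc n)) * sg y * sg (a - y)
    + sg (of_nat s) * sg (a + of_nat s) * sg (y + of_nat (Suc n)) * sg (a - y + of_nat (Suc n))"
  proof -
    define c where "c = a / 2"
    have a: "a = c + c" by (simp add: c_def)
    have "sg (y + of_nat s) * sg (a - y + of_nat s) * sg (a + of_nat (Suc n)) * sg (of_nat (Suc n)) =
      sg (a + of_nat s + of_nat (Suc n)) * sg (of_nat s - of_nat (Suc n)) * sg y * sg (y - a)
    + sg (a + of_nat s) * sg (of_nat s) * sg (y + of_nat (Suc n)) * sg (a - y + of_nat (Suc n))"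
      using three_term[of "of_nat s + c" "y - c" "of_nat (Suc n) + c" c]
      unfolding a by (simp add: algebra_simps)
    moreover have "sg (y - a) = - sg (a - y)"
      and "sg (of_nat s - of_nat (Suc n)) = - sg (of_nat (Suc n) - of_nat s)"
      by (rule sg_minus_diff)+
    ultimately show ?thesis by (simp add: algebra_simps)
  qed
  define m where "m = sf (y + 1) r * sf (a + 1 - y + of_nat s) (n - s)"
  have sn: "Suc n - s = Suc (n - s)" using assms by simp
  have "wpair a (Suc n) (y + 1) s = sg (y + of_nat s) * sg (a - y + of_nat s) * m"
    unfolding wpair_def m_def sn unfolding Suc sf_Suc[of "y + 1"] sf_rec[of "a + 1 - (y + 1) + _"]
    by (simp add: algebra_simps)
  moreover have "wpair a n y s = sg y * m"
    unfolding wpair_def m_def unfolding Suc sf_rec[of y] by (simp add: algebra_simps)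
  moreover have "wpair (a + 2) n (y + 1) (s - 1) = m * sg (a - y + of_nat (Suc n))"
  proof -
    have "n - r = Suc (n - s)" using assms Suc by simp
    moreover have "a + 2 + 1 - (y + 1) + of_nat r = a + 1 - y + of_nat s" using Suc by simp
    moreover have "a + 1 - y + of_nat s + of_nat (n - s) = a - y + of_nat (Suc n)"
      using assms by (simp add: of_nat_diff)
    ultimately show ?thesis
      unfolding wpair_def m_def using Suc by (simp add: sf_Suc algebra_simps)
  qed
  ultimately show ?thesis using Suc eq by (simp add: algebra_simps)
qed

text \<open>Induction on \<open>n\<close>. By \<open>wpair_split\<close>, applied to the last parameter, the sum for \<open>n + 1\<close> is a combination
  of the sums for \<open>(a; b, c, d, e - 1)\<close> and \<open>(a + 2; b + 1, c + 1, d + 1, e)\<close> with \<open>n\<close>, which are both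
  balanced. The two have the same value, because \<open>a + 1 - b - c\<close> and its analogues agree, and the
  coefficients add up by the three-term relation once more.\<close>
theorem frenkel_turaev:
  assumes "b + c + d + e = 2 * a + 1 + of_nat n" and "regular a n"
  shows "(\<Sum>s\<le>n. vcoef a n s * wpair a n b s * wpair a n c s * wpair a n d s * wpair a n e s) =
    (- 1) ^ n * sf (a + 1 - b - c) n * sf (a + 1 - b - d) n * sf (a + 1 - c - d) n / sf 1 n"
  using assms
proof (induction n arbitrary: a b c d e)
  case 0
  show ?case by (simp add: vcoef_def vwp_def wpair_def)
next
  case (Suc n)
  define y where "y = e - 1"
  have e: "e = y + 1" by (simp add: y_def)
  define K where "K = sg (of_nat (Suc n)) * sg (a + of_nat (Suc n))"
  have n1: "sg (of_nat (Suc n)) \<noteq> 0" by (rule sg_nat_nz) simp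
  have n2: "sg (a + of_nat (Suc n)) \<noteq> 0"
    using regularD[OF Suc.prems(2), of "Suc n"] by simp
  have Knz: "K \<noteq> 0" using n1 n2 by (simp add: K_def)
  define C where "C = sg (a + 1 - b + of_nat n) * sg (a + 1 - c + of_nat n) * sg (a + 1 - d + of_nat n)"
  define t where "t = (\<lambda>a n b c d e s. vcoef a n s * wpair a n b s * wpair a n c s * wpair a n d s * wpair a n e s)"
  have low: "t a (Suc n) b c d e s * K = sg (a - y) * C * t a n b c d y s
      + (if s = 0 then 0 else
          - sg (y + of_nat (Suc n)) * sg b * sg c * sg d * t (a + 2) n (b + 1) (c + 1) (d + 1) e (s - 1))"
    if s: "s \<le> n" for s
  proof -
    have "t a (Suc n) b c d e s * K =
      vcoef a (Suc n) s * wpair a (Suc n) b s * wpair a (Suc n) c s * wpair a (Suc n) d s *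
       (wpair a (Suc n) (y + 1) s * (sg (of_nat (Suc n)) * sg (a + of_nat (Suc n))))"
      by (simp add: t_def K_def e)
    also have "\<dots> = sg (a - y) * C * t a n b c d y s
      + (if s = 0 then 0 else
        vcoef a (Suc n) s * wpair a (Suc n) b s * wpair a (Suc n) c s * wpair a (Suc n) d s *
        (sg (of_nat s) * sg (a + of_nat s) * sg (y + of_nat (Suc n)) * wpair (a + 2) n (y + 1) (s - 1)))"
      unfolding wpair_split[OF s] t_def C_def vcoef_Suc[OF s Suc.prems(2)]
      by (simp add: wpair_Suc[OF s] algebra_simps)
    also have "(if s = 0 then 0 else
        vcoef a (Suc n) s * wpair a (Suc n) b s * wpair a (Suc n) c s * wpair a (Suc n) d s *
        (sg (of_nat s) * sg (a + of_nat s) * sg (y + of_nat (Suc n)) * wpair (a + 2) n (y + 1) (s - 1)))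
      = (if s = 0 then 0 else
          - sg (y + of_nat (Suc n)) * sg b * sg c * sg d * t (a + 2) n (b + 1) (c + 1) (d + 1) e (s - 1))"
    proof (cases s)
      case (Suc r)
      then have "r \<le> n" using s by simp
      from vcoef_Suc_Suc[OF this Suc.prems(2)] show ?thesis
        unfolding Suc by (simp add: wpair_Suc_Suc t_def e)
    qed simp
    finally show ?thesis .
  qed
  have top: "t a (Suc n) b c d e (Suc n) * K =
      - sg (y + of_nat (Suc n)) * sg b * sg c * sg d * t (a + 2) n (b + 1) (c + 1) (d + 1) e n"
  proof -
    have "wpair a (Suc n) e (Suc n) = wpair (a + 2) n e n * sg (y + of_nat (Suc n))"
      by (simp add: wpair_def sf_Suc e algebra_simps)
    then show ?thesis
      unfolding t_def K_def vcoef_Suc_Suc[OF order_refl Suc.prems(2)]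
      by (simp add: wpair_Suc_Suc)
  qed
  have "(\<Sum>s\<le>Suc n. t a (Suc n) b c d e s) * K = (\<Sum>s\<le>Suc n. t a (Suc n) b c d e s * K)"
    by (rule sum_distrib_right)
  also have "\<dots> = (\<Sum>s\<le>Suc n. (if s \<le> n then sg (a - y) * C * t a n b c d y s else 0)
      + (if s = 0 then 0 else
          - sg (y + of_nat (Suc n)) * sg b * sg c * sg d * t (a + 2) n (b + 1) (c + 1) (d + 1) e (s - 1)))"
  proof (rule sum.cong[OF refl])
    fix s assume "s \<in> {..Suc n}"
    then consider "s \<le> n" | "s = Suc n" by force
    then show "t a (Suc n) b c d e s * K = (if s \<le> n then sg (a - y) * C * t a n b c d y s else 0)
      + (if s = 0 then 0 else
          - sg (y + of_nat (Suc n)) * sg b * sg c * sg d * t (a + 2) n (b + 1) (c + 1) (d + 1) e (s - 1))"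
      using low top by cases simp_all
  qed
  also have "\<dots> = sg (a - y) * C * (\<Sum>s\<le>n. t a n b c d y s)
      - sg (y + of_nat (Suc n)) * sg b * sg c * sg d
         * (\<Sum>s\<le>n. t (a + 2) n (b + 1) (c + 1) (d + 1) e s)"
    unfolding sum.distrib
    by (subst sum.atMost_Suc, subst sum.atMost_Suc_shift)
       (simp add: sum_distrib_left sum_negf)
  also have "(\<Sum>s\<le>n. t a n b c d y s) =
      (- 1) ^ n * sf (a + 1 - b - c) n * sf (a + 1 - b - d) n * sf (a + 1 - c - d) n / sf 1 n"
    unfolding t_def
    by (rule Suc.IH) (use Suc.prems in \<open>simp_all add: y_def regular_def algebra_simps\<close>)
  also have "(\<Sum>s\<le>n. t (a + 2) n (b + 1) (c + 1) (d + 1) e s) =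
      (- 1) ^ n * sf ((a + 2) + 1 - (b + 1) - (c + 1)) n * sf ((a + 2) + 1 - (b + 1) - (d + 1)) n
        * sf ((a + 2) + 1 - (c + 1) - (d + 1)) n / sf 1 n"
    unfolding t_def
  proof (rule Suc.IH)
    show "b + 1 + (c + 1) + (d + 1) + e = 2 * (a + 2) + 1 + of_nat n"
      using Suc.prems(1) by (simp add: algebra_simps)
    show "regular (a + 2) n" unfolding regular_def
    proof (intro allI impI)
      fix i assume "1 \<le> i \<and> i \<le> 2 * n"
      then show "sg (a + 2 + of_nat i) \<noteq> 0"
        using regularD[OF Suc.prems(2), of "i + 2"] by (simp add: algebra_simps)
    qed
  qed
  also have "sg (a - y) * C *
      ((- 1) ^ n * sf (a + 1 - b - c) n * sf (a + 1 - b - d) n * sf (a + 1 - c - d) n / sf 1 n)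
    - sg (y + of_nat (Suc n)) * sg b * sg c * sg d *
      ((- 1) ^ n * sf ((a + 2) + 1 - (b + 1) - (c + 1)) n * sf ((a + 2) + 1 - (b + 1) - (d + 1)) n
        * sf ((a + 2) + 1 - (c + 1) - (d + 1)) n / sf 1 n)
    = ((- 1) ^ n * sf (a + 1 - b - c) n * sf (a + 1 - b - d) n * sf (a + 1 - c - d) n / sf 1 n) *
      (sg (a - y) * C - sg (y + of_nat (Suc n)) * sg b * sg c * sg d)"
    by (simp add: field_simps)
  also have "sg (a - y) * C - sg (y + of_nat (Suc n)) * sg b * sg c * sg d =
     - (sg (a + of_nat (Suc n)) * sg (a + 1 - b - c + of_nat n) * sg (a + 1 - b - d + of_nat n)
        * sg (a + 1 - c - d + of_nat n))"
  proof -
    define A where "A = a + of_nat (Suc n)"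
    have y: "y = 2 * A - b - c - d - of_nat (Suc n)" and a: "a = A - of_nat (Suc n)"
      using Suc.prems(1) by (simp_all add: A_def y_def algebra_simps)
    have "sg (A - b) * sg (A - c) * sg (b + c + d - A) * sg (A - d) =
      sg A * sg (A - b - c) * sg (c + d - A) * sg (A - b - d)
      + sg d * sg (2 * A - b - c - d) * sg c * sg b"
    proof -
      define h k where "h = b / 2" and "k = c / 2"
      have bc: "b = 2 * h" "c = 2 * k" by (simp_all add: h_def k_def)
      have "A - h - k + (k - h) = A - 2 * h" "A - h - k - (k - h) = A - 2 * k"
        "h + k + (h + k + d - A) = 2 * h + 2 * k + d - A" "h + k - (h + k + d - A) = A - d"
        "A - h - k + (h + k) = A" "A - h - k - (h + k) = A - 2 * h - 2 * k"
        "k - h + (h + k + d - A) = 2 * k + d - A" "k - h - (h + k + d - A) = A - 2 * h - d"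
        "A - h - k + (h + k + d - A) = d" "A - h - k - (h + k + d - A) = 2 * A - 2 * h - 2 * k - d"
        "h + k + (k - h) = 2 * k" "h + k - (k - h) = 2 * h"
        by (simp_all add: algebra_simps)
      from three_term[of "A - h - k" "k - h" "h + k" "h + k + d - A", unfolded this]
      show ?thesis unfolding bc .
    qed
    moreover have "sg (c + d - A) = - sg (A - c - d)"
      using sg_minus_diff[of "c + d" A] by (simp add: algebra_simps)
    ultimately show ?thesis
      unfolding C_def y unfolding a by (simp add: algebra_simps)
  qed
  finally have "(\<Sum>s\<le>Suc n. t a (Suc n) b c d e s) * K =
    ((- 1) ^ n * sf (a + 1 - b - c) n * sf (a + 1 - b - d) n * sf (a + 1 - c - d) n / sf 1 n) *
    - (sg (a + of_nat (Suc n)) * sg (a + 1 - b - c + of_nat n) * sg (a + 1 - b - d + of_nat n)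
        * sg (a + 1 - c - d + of_nat n))" .
  also have "\<dots> = ((- 1) ^ Suc n * sf (a + 1 - b - c) (Suc n) * sf (a + 1 - b - d) (Suc n)
      * sf (a + 1 - c - d) (Suc n) / sf 1 (Suc n)) * K"
    using n1 by (simp add: sf_Suc K_def field_simps)
  finally show ?case using Knz unfolding t_def by (simp only: mult_cancel_right) simp
qed

end

section \<open>The Bailey transformation\<close>

lemma sum_triangle_diag:
  fixes f :: "nat \<Rightarrow> nat \<Rightarrow> 'a::comm_monoid_add"
  shows "(\<Sum>s\<le>n. \<Sum>r\<le>s. f r s) = (\<Sum>r\<le>n. \<Sum>i\<le>n - r. f r (r + i))"
  unfolding sum.Sigma[OF finite_atMost ballI[OF finite_atMost]]
  by (rule sum.reindex_bij_witness[of _ "\<lambda>(r, i). (r + i, r)" "\<lambda>(s, r). (r, s - r)"]) auto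

context sigma_function begin

definition vwp_sum :: "complex \<Rightarrow> complex list \<Rightarrow> nat \<Rightarrow> complex" where
  "vwp_sum a xs n = (\<Sum>s\<le>n. vcoef a n s * (\<Prod>x\<leftarrow>xs. wpair a n x s))"

lemma regular_mono: "regular a n \<Longrightarrow> m \<le> n \<Longrightarrow> regular a m"
  by (auto simp: regular_def)

lemma regular_shift:
  assumes "regular a n" "r \<le> n" shows "regular (a + 2 * of_nat r) (n - r)"
  unfolding regular_def
proof (intro allI impI)
  fix i assume "1 \<le> i \<and> i \<le> 2 * (n - r)"
  then have "1 \<le> 2 * r + i" "2 * r + i \<le> 2 * n" using assms(2) by linarith+
  from regularD[OF assms(1) this] show "sg (a + 2 * of_nat r + of_nat i) \<noteq> 0"
    by (simp add: algebra_simps)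
qed

lemma vwp_extend:
  assumes "regular a n" "s \<le> n" "r \<le> s"
  shows "vwp a s r = vwp a n r * sf (a + of_nat r + of_nat s + 1) (n - s)"
proof -
  have nz: "sf (a + of_nat r + of_nat s + 1) (n - s) \<noteq> 0"
  proof (rule sf_nz)
    fix i assume "i < n - s"
    then show "sg (a + of_nat r + of_nat s + 1 + of_nat i) \<noteq> 0"
      using regularD[OF assms(1), of "r + s + 1 + i"] assms by (simp add: algebra_simps)
  qed
  show ?thesis
  proof (cases "r = 0")
    case True
    then show ?thesis using sf_split[OF assms(2), of "a + 1"] nz
      by (simp add: vwp_def algebra_simps)
  next
    case False
    then show ?thesis using sf_split[of "s + 1" "n + 1" "a + of_nat r"] nz assms
      by (simp add: vwp_def algebra_simps)
  qed
qed

lemma vwp_shift: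
  assumes "regular a n" "r + i \<le> n"
  shows "vwp a n (r + i) * sf (a + of_nat (r + i)) r = vwp (a + 2 * of_nat r) (n - r) i"
proof (cases "r = 0")
  case False
  have nz: "sf (a + of_nat (r + i)) r \<noteq> 0"
  proof (rule sf_nz)
    fix m assume "m < r"
    then show "sg (a + of_nat (r + i) + of_nat m) \<noteq> 0"
      using regularD[OF assms(1), of "r + i + m"] assms by (simp add: algebra_simps)
  qed
  have "sg (a + 2 * of_nat r) \<noteq> 0"
    using regularD[OF assms(1), of "2 * r"] assms False by simp
  then have "vwp (a + 2 * of_nat r) (n - r) i =
      sg (a + 2 * of_nat (r + i)) / sf (a + of_nat (r + i) + of_nat r) (n - r + 1)"
    by (simp add: vwp_nz algebra_simps)
  moreover have "sf (a + of_nat (r + i)) (n + 1) =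
      sf (a + of_nat (r + i)) r * sf (a + of_nat (r + i) + of_nat r) (n - r + 1)"
    using sf_split[of r "n + 1" "a + of_nat (r + i)"] assms by (simp add: Suc_diff_le)
  ultimately show ?thesis using False nz by (simp add: vwp_def)
qed simp

lemma wpair_extend:
  assumes "r \<le> s" "s \<le> n"
  shows "wpair a s x r * sf (a + 1 - x + of_nat s) (n - s) = wpair a n x r"
  using sf_split[of "s - r" "n - r" "a + 1 - x + of_nat r"] assms
  by (simp add: wpair_def of_nat_diff algebra_simps)

lemma wpair_shift:
  "wpair a n x (r + i) = sf x r * wpair (a + 2 * of_nat r) (n - r) (x + of_nat r) i"
  unfolding wpair_def sf_add by (simp add: algebra_simps)

text \<open>The factor of the \<open>s\<close>-th term that involves \<open>b, c, d\<close> is the value of a Frenkel-Turaev sum with first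
  parameter \<open>lam\<close> and length \<open>s\<close>. After insertion of that sum and exchange of the summations, the inner
  sum is again a Frenkel-Turaev sum, with first parameter \<open>a + 2r\<close>. The denominators
  \<open>a + 1 - b = lam + 1 - (lam + b - a)\<close> are the same on both sides, which is why they can be cleared.\<close>
theorem bailey:
  assumes lam: "lam = 2 * a + 1 - b - c - d"
    and bal: "b + c + d + e + f + g = 3 * a + 2 + of_nat n"
    and ra: "regular a n" and rl: "regular lam n"
  shows "vwp_sum a [b, c, d, e, f, g] n
    = vwp_sum lam [lam + b - a, lam + c - a, lam + d - a, e, f, g] n"
proof -
  define B where "B = (\<lambda>r. wpair lam n (lam + b - a) r * wpair lam n (lam + c - a) r * wpair lam n (lam + d - a) r)"
  define H where "H = (\<lambda>r s. vwp a n s / sf 1 (n - s) * vcoef lam s r * wpair lam s (a + of_nat s) r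
    * (wpair a n e s * wpair a n f s * wpair a n g s))"
  have expand: "vcoef a n s * (wpair a n b s * wpair a n c s * wpair a n d s * (wpair a n e s * wpair a n f s * wpair a n g s))
    = (\<Sum>r\<le>s. B r * H r s)" if s: "s \<le> n" for s
  proof -
    have ft: "(\<Sum>r\<le>s. vcoef lam s r * wpair lam s (lam + b - a) r * wpair lam s (lam + c - a) r
        * wpair lam s (lam + d - a) r * wpair lam s (a + of_nat s) r) =
      (- 1) ^ s * sf (lam + 1 - (lam + b - a) - (lam + c - a)) s
        * sf (lam + 1 - (lam + b - a) - (lam + d - a)) s
        * sf (lam + 1 - (lam + c - a) - (lam + d - a)) s / sf 1 s"
      by (rule frenkel_turaev) (use lam regular_mono[OF rl s] in \<open>simp_all add: algebra_simps\<close>)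
    have args: "lam + 1 - (lam + b - a) - (lam + c - a) = d"
        "lam + 1 - (lam + b - a) - (lam + d - a) = c"
        "lam + 1 - (lam + c - a) - (lam + d - a) = b"
      by (simp_all add: lam algebra_simps)
    have wpair_lam: "wpair a n x s = sf x s * sf (lam + 1 - (lam + x - a) + of_nat s) (n - s)" for x
      by (simp add: wpair_def algebra_simps)
    have "vcoef a n s * (wpair a n b s * wpair a n c s * wpair a n d s * (wpair a n e s * wpair a n f s * wpair a n g s))
      = vwp a n s / sf 1 (n - s) * (wpair a n e s * wpair a n f s * wpair a n g s)
        * ((- 1) ^ s * sf d s * sf c s * sf b s / sf 1 s)
        * (sf (lam + 1 - (lam + b - a) + of_nat s) (n - s)
           * sf (lam + 1 - (lam + c - a) + of_nat s) (n - s)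
           * sf (lam + 1 - (lam + d - a) + of_nat s) (n - s))"
      unfolding wpair_lam[of b] wpair_lam[of c] wpair_lam[of d] by (simp only: vcoef_def times_divide_eq_left times_divide_eq_right divide_divide_eq_left mult_ac)
    also have "\<dots> = (\<Sum>r\<le>s. B r * H r s)"
      unfolding ft[unfolded args, symmetric] sum_distrib_left sum_distrib_right
      by (rule sum.cong[OF refl]) (simp only: B_def H_def wpair_extend[OF _ s, symmetric] atMost_iff mult_ac times_divide_eq_left times_divide_eq_right)
    finally show ?thesis .
  qed
  have inner: "(\<Sum>i\<le>n - r. H r (r + i)) = vcoef lam n r * (wpair lam n e r * wpair lam n f r * wpair lam n g r)"
    if r: "r \<le> n" for r
  proof -
    define m where "m = n - r"
    define a' where "a' = a + 2 * of_nat r"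
    have n: "n = r + m" using r by (simp add: m_def)
    have H: "H r (r + i) = (- 1) ^ r / sf 1 r * (sf e r * sf f r * sf g r) * vwp lam n r *
       (vcoef a' m i * wpair a' m (e + of_nat r) i * wpair a' m (f + of_nat r) i * wpair a' m (g + of_nat r) i
         * wpair a' m (a - lam) i)" if i: "i \<le> m" for i
    proof -
      have ri: "r + i \<le> n" using i n by simp
      have 1: "vwp a' m i = vwp a n (r + i) * sf (a + of_nat (r + i)) r"
        using vwp_shift[OF ra ri] by (simp add: a'_def m_def)
      have 2: "vwp lam (r + i) r = vwp lam n r * sf (a' + 1 - (a - lam) + of_nat i) (m - i)"
        using vwp_extend[OF rl ri, of r] by (simp add: m_def a'_def algebra_simps)
      have 3: "sf (lam + 1 - (a + of_nat (r + i)) + of_nat r) (r + i - r) = (- 1) ^ i * sf (a - lam) i"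
        by (subst sf_reflect) (simp add: algebra_simps)
      have 4: "n - (r + i) = m - i" by (simp add: n)
      show ?thesis
        unfolding H_def wpair_shift a'_def[symmetric] m_def[symmetric] vcoef_def 1 2 4 wpair_def[of lam] 3
          wpair_def[of a' m "a - lam"]
        by (simp add: power_add algebra_simps)
    qed
    have ft: "(\<Sum>i\<le>m. vcoef a' m i * wpair a' m (e + of_nat r) i * wpair a' m (f + of_nat r) i
        * wpair a' m (g + of_nat r) i * wpair a' m (a - lam) i) =
      (- 1) ^ m * sf (a' + 1 - (e + of_nat r) - (f + of_nat r)) m
        * sf (a' + 1 - (e + of_nat r) - (g + of_nat r)) m
        * sf (a' + 1 - (f + of_nat r) - (g + of_nat r)) m / sf 1 m"
    proof (rule frenkel_turaev)
      have "lam = e + f + g - a - 1 - of_nat r - of_nat m"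
      proof -
        have "of_nat m = b + c + d + e + f + g - 3 * a - 2 - of_nat r" using bal unfolding n by simp
        then show ?thesis unfolding lam by simp
      qed
      then show "e + of_nat r + (f + of_nat r) + (g + of_nat r) + (a - lam) = 2 * a' + 1 + of_nat m"
        unfolding a'_def by (simp add: algebra_simps)
      show "regular a' m" using regular_shift[OF ra r] by (simp add: a'_def m_def)
    qed
    have refl1: "sf (a' + 1 - (x + of_nat r) - (y + of_nat r)) m = (- 1) ^ m * sf (lam + 1 - w + of_nat r) m"
      if "x + y + w = e + f + g" for x y w
    proof -
      have "of_nat n = b + c + d + e + f + g - 3 * a - 2" using bal by simp
      then have "lam = e + f + g - (a + 1 + of_nat n)" unfolding lam by simp
      then have "1 - (a' + 1 - (x + of_nat r) - (y + of_nat r)) - of_nat m = lam + 1 - w + of_nat r"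
        using that by (simp add: a'_def n algebra_simps)
      then show ?thesis by (subst sf_reflect) (simp only:)
    qed
    have e1: "e + g + f = e + f + g" and e2: "f + g + e = e + f + g" by simp_all
    have sq: "(- 1) ^ m * ((- 1) ^ m * x) = x" for x :: complex
      by (simp flip: mult.assoc power_mult_distrib)
    have "(\<Sum>i\<le>m. H r (r + i)) = (- 1) ^ r / sf 1 r * (sf e r * sf f r * sf g r) * vwp lam n r *
       (\<Sum>i\<le>m. vcoef a' m i * wpair a' m (e + of_nat r) i * wpair a' m (f + of_nat r) i * wpair a' m (g + of_nat r) i
         * wpair a' m (a - lam) i)"
      unfolding sum_distrib_left using H by (intro sum.cong) auto
    also have "\<dots> = (- 1) ^ r / sf 1 r * (sf e r * sf f r * sf g r) * vwp lam n r *
        (sf (lam + 1 - e + of_nat r) m * sf (lam + 1 - f + of_nat r) m * sf (lam + 1 - g + of_nat r) m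
          / sf 1 m)"
      unfolding ft refl1[of e f g, OF refl] refl1[of e g f, OF e1] refl1[of f g e, OF e2]
      by (simp add: sq)
    also have "\<dots> = vcoef lam n r * (wpair lam n e r * wpair lam n f r * wpair lam n g r)"
      by (simp add: vcoef_def wpair_def m_def)
    finally show ?thesis by (simp add: m_def)
  qed
  have "vwp_sum a [b, c, d, e, f, g] n = (\<Sum>s\<le>n. \<Sum>r\<le>s. B r * H r s)"
    unfolding vwp_sum_def
  proof (rule sum.cong[OF refl])
    fix s assume "s \<in> {..n}"
    then have "s \<le> n" by simp
    from expand[OF this]
    show "vcoef a n s * (\<Prod>x\<leftarrow>[b, c, d, e, f, g]. wpair a n x s) = (\<Sum>r\<le>s. B r * H r s)"
      by (simp add: mult.assoc)
  qed
  also have "\<dots> = (\<Sum>r\<le>n. B r * (\<Sum>i\<le>n - r. H r (r + i)))"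
    by (simp add: sum_triangle_diag sum_distrib_left)
  also have "\<dots> = (\<Sum>r\<le>n. B r * (vcoef lam n r * (wpair lam n e r * wpair lam n f r * wpair lam n g r)))"
    using inner by (intro sum.cong) auto
  also have "\<dots> = vwp_sum lam [lam + b - a, lam + c - a, lam + d - a, e, f, g] n"
    by (simp add: vwp_sum_def B_def mult_ac)
  finally show ?thesis .
qed

lemma vwp_sum_perm:
  assumes "mset xs = mset ys" shows "vwp_sum a xs n = vwp_sum a ys n"
proof -
  have "(\<Prod>x\<leftarrow>xs. wpair a n x s) = (\<Prod>x\<leftarrow>ys. wpair a n x s)" for s
    using assms by (metis mset_map prod_mset_prod_list)
  then show ?thesis by (simp add: vwp_sum_def)
qed

text \<open>The first transformation uses \<open>R, x1, x2\<close>, the second the image of \<open>R\<close> together with \<open>x3, x4\<close>. The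
  result is symmetric in \<open>x1, \<dots>, x4\<close>, and its first parameter \<open>p - n - R\<close> does not involve \<open>a\<close>. This is
  what separates the indices below, where \<open>a\<close> depends on both of them.\<close>
theorem bailey_twice:
  assumes bal: "R + p + x1 + x2 + x3 + x4 = 3 * a + 2 + of_nat n"
    and ra: "regular a n" and rl: "regular (2 * a + 1 - R - x1 - x2) n"
    and rm: "regular (p - of_nat n - R) n"
  shows "vwp_sum a [R, p, x1, x2, x3, x4] n = vwp_sum (p - of_nat n - R)
    [p, p - of_nat n - a, a + 1 - R - x1, a + 1 - R - x2, a + 1 - R - x3, a + 1 - R - x4] n"
proof -
  define lam where "lam = 2 * a + 1 - R - x1 - x2"
  define mu where "mu = p - of_nat n - R"
  have "vwp_sum a [R, p, x1, x2, x3, x4] n = vwp_sum a [R, x1, x2, p, x3, x4] n"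
    by (rule vwp_sum_perm) simp
  also have "\<dots> = vwp_sum lam [lam + R - a, lam + x1 - a, lam + x2 - a, p, x3, x4] n"
    by (rule bailey) (use assms in \<open>simp_all add: lam_def algebra_simps\<close>)
  also have "\<dots> = vwp_sum lam [lam + R - a, x3, x4, p, lam + x1 - a, lam + x2 - a] n"
    by (rule vwp_sum_perm) simp
  also have "\<dots> = vwp_sum mu [mu + (lam + R - a) - lam, mu + x3 - lam, mu + x4 - lam, p, lam + x1 - a, lam + x2 - a] n"
    by (rule bailey) (use assms in \<open>simp_all add: lam_def mu_def algebra_simps\<close>)
  also have "\<dots> = vwp_sum mu [p, mu + (lam + R - a) - lam, lam + x2 - a, lam + x1 - a, mu + x4 - lam, mu + x3 - lam] n"
    by (rule vwp_sum_perm) simp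
  also have "[p, mu + (lam + R - a) - lam, lam + x2 - a, lam + x1 - a, mu + x4 - lam, mu + x3 - lam]
    = [p, p - of_nat n - a, a + 1 - R - x1, a + 1 - R - x2, a + 1 - R - x3, a + 1 - R - x4]"
  proof -
    have "of_nat n = R + p + x1 + x2 + x3 + x4 - 3 * a - 2" using bal by simp
    then show ?thesis by (simp add: lam_def mu_def algebra_simps)
  qed
  finally show ?thesis by (simp add: mu_def)
qed

end

section \<open>Biorthogonality for generic parameters\<close>

context sigma_function begin

text \<open>No integer translate of \<open>c\<close> is a zero, so that all shifted factorials with argument in \<open>c + \<int>\<close>
  may be divided by.\<close>
definition nz :: "complex \<Rightarrow> bool" where
  "nz c \<longleftrightarrow> (\<forall>i::int. sg (c + of_int i) \<noteq> 0)"

lemma nzD: "nz c \<Longrightarrow> x - c \<in> \<int> \<Longrightarrow> sg x \<noteq> 0"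
  by (metis nz_def Ints_cases add.commute diff_add_cancel)

lemma nzD': "nz c \<Longrightarrow> x + c \<in> \<int> \<Longrightarrow> sg x \<noteq> 0"
  using nzD[of c "- x"] Ints_minus[of "x + c"] by (simp add: sg_minus)

lemma nz_sf: "nz c \<Longrightarrow> x - c \<in> \<int> \<Longrightarrow> sf x n \<noteq> 0"
proof (rule sf_nz)
  fix i assume "nz c" "x - c \<in> \<int>"
  then show "sg (x + of_nat i) \<noteq> 0"
    using Ints_add[of "x - c" "of_nat i"] by (intro nzD[of c]) (simp_all add: algebra_simps)
qed

lemma nz_sf': "nz c \<Longrightarrow> x + c \<in> \<int> \<Longrightarrow> sf x n \<noteq> 0"
proof (rule sf_nz)
  fix i assume "nz c" "x + c \<in> \<int>"
  then show "sg (x + of_nat i) \<noteq> 0"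
    using Ints_add[of "x + c" "of_nat i"] by (intro nzD'[of c]) (simp_all add: algebra_simps)
qed

lemma nz_regular: "nz c \<Longrightarrow> x - c \<in> \<int> \<Longrightarrow> regular x n"
  unfolding regular_def
proof (intro allI impI)
  fix i assume "nz c" "x - c \<in> \<int>"
  then show "sg (x + of_nat i) \<noteq> 0"
    using Ints_add[of "x - c" "of_nat i"] by (intro nzD[of c]) (simp_all add: algebra_simps)
qed

lemma nz_regular': "nz c \<Longrightarrow> x + c \<in> \<int> \<Longrightarrow> regular x n"
  unfolding regular_def
proof (intro allI impI)
  fix i assume "nz c" "x + c \<in> \<int>"
  then show "sg (x + of_nat i) \<noteq> 0"
    using Ints_add[of "x + c" "of_nat i"] by (intro nzD'[of c]) (simp_all add: algebra_simps)
qed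

lemma vcoef_quotient:
  assumes "sf a (2 * n + 1) \<noteq> 0" "i \<le> n"
  shows "vcoef a n i = sg (a + 2 * of_nat i) * sf a i * sf (- of_nat n) i
    / (sf 1 i * sf (a + of_nat n + 1) i) / (sf a (n + 1) * sf 1 n)"
proof -
  have nza: "sg (a + of_nat m) \<noteq> 0" if "m \<le> 2 * n" for m
    using assms(1) that by (simp add: sf_nz_iff del: sf_Suc)
  have "sg a \<noteq> 0" using nza[of 0] by simp
  moreover have n1: "sf 1 n = sf 1 (n - i) * ((- 1) ^ i * sf (- of_nat n) i)"
  proof -
    have "sf (1 + of_nat (n - i)) i = (- 1) ^ i * sf (- of_nat n) i"
      using assms(2) by (subst sf_reflect) (simp add: of_nat_diff)
    then show ?thesis using sf_split[of "n - i" n 1] assms(2) by simp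
  qed
  moreover have "sf a i * sf (a + of_nat i) (n + 1) = sf a (n + 1) * sf (a + of_nat n + 1) i"
    using sf_add[of a i "n + 1"] sf_add[of a "n + 1" i] by (simp add: add_ac)
  moreover have "sf a i \<noteq> 0" "sf (a + of_nat i) (n + 1) \<noteq> 0" "sf a (n + 1) \<noteq> 0"
      "sf (a + of_nat n + 1) i \<noteq> 0"
    using nza assms(2) nza[of "n + 1 + _"] nza[of "i + _"]
    by (auto intro!: sf_nz simp: add_ac)
  moreover have "sf 1 n \<noteq> 0" by simp
  ultimately show ?thesis
    by (simp add: vcoef_def vwp_nz divide_simps)
qed

lemma wpair_quotient:
  assumes "sf (a + 1 - x) n \<noteq> 0" "i \<le> n"
  shows "wpair a n x i = sf x i / sf (a + 1 - x) i * sf (a + 1 - x) n"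
  using assms sf_split[OF assms(2), of "a + 1 - x"] by (simp add: wpair_def)

text \<open>The classical form of the sum, with the denominators in place.\<close>
theorem frenkel_turaev_quotient:
  assumes "b + c + d + e = 2 * a + 1 + of_nat n" and "sf a (2 * n + 1) \<noteq> 0"
    and "sf (a + 1 - b) n \<noteq> 0" "sf (a + 1 - c) n \<noteq> 0" "sf (a + 1 - d) n \<noteq> 0" "sf (a + 1 - e) n \<noteq> 0"
  shows "(\<Sum>i\<le>n. sg (a + 2 * of_nat i) * sf a i * sf (- of_nat n) i / (sf 1 i * sf (a + of_nat n + 1) i)
      * (sf b i / sf (a + 1 - b) i) * (sf c i / sf (a + 1 - c) i)
      * (sf d i / sf (a + 1 - d) i) * (sf e i / sf (a + 1 - e) i)) =
    (- 1) ^ n * sf a (n + 1) * sf (a + 1 - b - c) n * sf (a + 1 - b - d) n * sf (a + 1 - c - d) n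
     / (sf (a + 1 - b) n * sf (a + 1 - c) n * sf (a + 1 - d) n * sf (a + 1 - e) n)"
    (is "(\<Sum>i\<le>n. ?q i) = _")
proof -
  define C where "C = sf (a + 1 - b) n * sf (a + 1 - c) n * sf (a + 1 - d) n * sf (a + 1 - e) n"
  define A where "A = sf a (n + 1) * sf 1 n"
  have nza: "sg (a + of_nat m) \<noteq> 0" if "m \<le> 2 * n" for m
    using assms(2) that by (simp add: sf_nz_iff)
  have "A \<noteq> 0" unfolding A_def using nza by (auto intro!: sf_nz)
  have "C \<noteq> 0" using assms by (simp add: C_def)
  have "regular a n" using nza by (auto simp: regular_def)
  have "(\<Sum>i\<le>n. ?q i) = (\<Sum>i\<le>n. vcoef a n i * wpair a n b i * wpair a n c i * wpair a n d i * wpair a n e i) * (A / C)"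
    unfolding sum_distrib_right
  proof (rule sum.cong[OF refl])
    fix i assume "i \<in> {..n}"
    then have i: "i \<le> n" by simp
    define v where "v = sg (a + 2 * of_nat i) * sf a i * sf (- of_nat n) i / (sf 1 i * sf (a + of_nat n + 1) i)"
    show "?q i = vcoef a n i * wpair a n b i * wpair a n c i * wpair a n d i * wpair a n e i * (A / C)"
      unfolding vcoef_quotient[OF assms(2) i] wpair_quotient[OF assms(3) i] wpair_quotient[OF assms(4) i]
        wpair_quotient[OF assms(5) i] wpair_quotient[OF assms(6) i] v_def[symmetric] A_def[symmetric]
      using \<open>A \<noteq> 0\<close> \<open>C \<noteq> 0\<close> by (simp add: C_def mult.assoc)
  qed
  also have "\<dots> = (- 1) ^ n * sf (a + 1 - b - c) n * sf (a + 1 - b - d) n * sf (a + 1 - c - d) n / sf 1 n * (A / C)"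
    unfolding frenkel_turaev[OF assms(1) \<open>regular a n\<close>] ..
  also have "\<dots> = (- 1) ^ n * sf a (n + 1) * sf (a + 1 - b - c) n * sf (a + 1 - b - d) n * sf (a + 1 - c - d) n / C"
    by (simp add: A_def)
  finally show ?thesis by (simp add: C_def)
qed

end

lemmas mult_div_ac = times_divide_eq_left times_divide_eq_right divide_divide_eq_left
  divide_divide_eq_right mult_ac

lemma neg_one_power_cancel: "(- 1) ^ n * ((- 1) ^ n * x) = (x :: complex)"
  by (simp flip: mult.assoc power_mult_distrib)

lemma quotient_signI:
  assumes "e * u = (- 1) ^ n * x" "e \<noteq> (0::complex)"
  shows "x / e = (- 1) ^ n * u"
  using assms neg_one_power_cancel[of n x] by (metis mult.left_commute nonzero_mult_div_cancel_left)

lemma quotient_signI2: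
  assumes "e * u = (- 1) ^ n * v * x" "e \<noteq> (0::complex)" "v \<noteq> 0"
  shows "x / e = (- 1) ^ n * u / v"
proof -
  have "v * x / e = (- 1) ^ n * u"
    by (rule quotient_signI) (use assms in \<open>simp_all add: mult.assoc\<close>)
  then show ?thesis using assms by (simp add: field_simps)
qed

context sigma_function begin

lemma sf_exchange:
  "sf x (m + i) * sf (x + of_nat (m + i)) k = sf x (m + k) * sf (x + of_nat m + of_nat k) i"
  using sf_add[of x "m + i" k] sf_add[of x "m + k" i] by (simp add: add_ac)

text \<open>As a function of \<open>m\<close>, the quotient \<open>(1 - y - m)\<^sub>r / (y)\<^sub>m\<close> is a multiple of \<open>1 / (y - r)\<^sub>m\<close>: the
  factor that runs backwards lowers the parameter.\<close>
lemma sf_reflect_exchange: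
  "sf (1 - y - of_nat m) r * sf (y - of_nat r) m = (- 1) ^ r * sf (y - of_nat r) r * sf y m"
proof -
  have "sf (1 - y - of_nat m) r = (- 1) ^ r * sf (y - of_nat r + of_nat m) r"
    by (subst sf_reflect) (simp add: algebra_simps)
  moreover have "sf (y - of_nat r) m * sf (y - of_nat r + of_nat m) r = sf (y - of_nat r) r * sf y m"
    using sf_add[of "y - of_nat r" m r] sf_add[of "y - of_nat r" r m] by (simp add: add.commute)
  ultimately show ?thesis by (simp add: mult_ac)
qed

lemma sf_reflect_absorb:
  "sf (1 - y - of_nat (s + i)) s * sf y i = (- 1) ^ s * sf y (s + i)"
proof -
  have "sf (1 - y - of_nat (s + i)) s = (- 1) ^ s * sf (y + of_nat i) s"
    by (subst sf_reflect) (simp add: algebra_simps)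
  then show ?thesis using sf_add[of y i s] by (simp add: add.commute mult_ac)
qed

context
  fixes N :: nat and L M w t :: complex
begin

text \<open>The directions in which factors occur anywhere below; for generic parameters all divisions
  are allowed. The parameters are \<open>L = \<Lambda>\<close>, \<open>M\<close>, \<open>w = \<omega>\<close> and \<open>t\<close> with \<open>z = q\<^bsup>2t + \<omega> + 1\<^esup>\<close>.\<close>
definition generic :: bool where
  "generic \<longleftrightarrow> (\<forall>c\<in>{L, M, M - w, L + M, L + M - w, L + 2 * M - w, M + t, t + w - M, L + M + t,
    t + w - L - M, t, t + w, L + 2 * M + t}. nz c)"

text \<open>The part of \<open>h\<^sub>j\<close> that does not depend on \<open>j\<close>.\<close>
definition jnorm :: complex where
  "jnorm = sf (w - L - 2 * M - 1) N * sf (- L) N * sf (t + w) N * sf (t - 1) N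
    / (sf (- L - M - 1) N * sf (w - L - M) N * sf (t + M) N * sf (t + w - M - 1) N)"

text \<open>\<open>1 / h\<^sub>j\<close> without its power of \<open>q\<close>: a very-well-poised term with first parameter \<open>- L - 1\<close> and five
  balanced numerator parameters, one of them \<open>- N\<close>.\<close>
definition jweight :: "nat \<Rightarrow> complex" where
  "jweight j = sg (- L - 1 + 2 * of_nat j) / sg (- L - 1) *
     (sf (- L - 1) j * sf (M + 1) j * sf (- of_nat N) j * sf (M - w) j * sf (- L - M - t) j
       * sf (t + w + of_nat N - 2 - L - M) j)
   / (sf 1 j * sf (- L - M - 1) j * sf (of_nat N - L) j * sf (w - L - M) j * sf (M + t) j
       * sf (M + 2 - of_nat N - w - t) j) / jnorm"

text \<open>In \<open>jweight\<close>, \<open>phi s\<close> removes the first \<open>s\<close> terms, that is, it replaces \<open>a = - L - 1\<close> by \<open>a + 2s\<close>, and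
  keeps the parameter \<open>t + w + N - 2 - L - M\<close> from being shifted by \<open>s\<close>.\<close>
definition phi :: "nat \<Rightarrow> nat \<Rightarrow> complex" where
  "phi s j = sf (- of_nat j) s * sf (of_nat j - 1 - L) s
     / (sf (M + 2 - of_nat N - w - t + of_nat j) s * sf (L + M + 3 - of_nat N - w - t - of_nat j) s)"

text \<open>In \<open>jweight\<close>, \<open>chi r\<close> raises the parameter \<open>M + 1\<close> by \<open>r\<close> and lowers \<open>- L - M - t\<close> by \<open>r\<close>, which
  leaves the series balanced.\<close>
definition chi :: "nat \<Rightarrow> nat \<Rightarrow> complex" where
  "chi r j = sf (L + M + 2 - of_nat j) r * sf (M + 1 + of_nat j) r
     / (sf (M + t + of_nat j) r * sf (L + M + 1 + t - of_nat j) r)"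

definition gram :: "nat \<Rightarrow> nat \<Rightarrow> complex" where
  "gram s r = (- 1) ^ (N - s) * (- 1) ^ r * sf (M + 1) (s + r) * sf (- of_nat N) s * sf (M - w) s
      * sf (- L - M - t) s * sf (L + M + 2 - of_nat N) r * sf (t - 1) (N - s)
      * sf (w - L - 2 * M - 1 - of_nat r) (N - s) * sf (t + w + of_nat r) (N - s) * sf (t + w - M - 1) N
     / (sf (- L - M - t - of_nat r + of_nat s) r * sf (M + t + of_nat N) r
        * sf (M + 2 - of_nat N - w - t) (N + s) * sf (w - L - 2 * M - 1) N * sf (t + w) N * sf (t - 1) N)"

lemma genericD:
  assumes generic
  shows "nz L" "nz M" "nz (M - w)" "nz (L + M)" "nz (L + M - w)" "nz (L + 2 * M - w)" "nz (M + t)"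
    "nz (t + w - M)" "nz (L + M + t)" "nz (t + w - L - M)" "nz t" "nz (t + w)" "nz (L + 2 * M + t)"
  using assms by (simp_all add: generic_def)

text \<open>By the description of \<open>phi\<close> and \<open>chi\<close>, the terms with \<open>j = s + i\<close> are those of a Frenkel-Turaev
  series in \<open>i\<close> of length \<open>N - s\<close>.\<close>
lemma sum_jweight_phi_chi:
  assumes g: generic and s: "s \<le> N"
  shows "(\<Sum>j\<le>N. jweight j * phi s j * chi r j) = gram s r"
proof -
  note nzs = genericD[OF g]
  define n where "n = N - s"
  have Nn: "N = s + n" using s by (simp add: n_def)
  have ofN: "of_nat N = (of_nat s + of_nat n :: complex)" by (simp add: Nn)
  define a where "a = 2 * of_nat s - 1 - L"
  define x1 where "x1 = M + 1 + of_nat r + of_nat s"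
  define x2 where "x2 = M - w + of_nat s"
  define x3 where "x3 = - L - M - t - of_nat r + of_nat s"
  define x4 where "x4 = t + w + of_nat N - 2 - L - M"
  define c where "c = M + 2 - of_nat N - w - t"
  define y where "y = - L - M - 1 - of_nat r"
  define b where "b = - L - M - t"
  define q where "q = (\<lambda>i. sg (a + 2 * of_nat i) * sf a i * sf (- of_nat n) i / (sf 1 i * sf (a + of_nat n + 1) i)
      * (sf x1 i / sf (a + 1 - x1) i) * (sf x2 i / sf (a + 1 - x2) i)
      * (sf x3 i / sf (a + 1 - x3) i) * (sf x4 i / sf (a + 1 - x4) i))"
  define K where "K = 1 / (sg (- L - 1) * jnorm) * sf (- L - 1) (2 * s) * sf (M + 1) (s + r) * sf (- of_nat N) s
      * sf (M - w) s * sf y r / sf y s * sf (b - of_nat r) s / sf (b - of_nat r) r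
      / (sf (of_nat N - L) s * sf (w - L - M) s * sf (M + t) (s + r) * sf c (2 * s))"
  have summand: "jweight (s + i) * phi s (s + i) * chi r (s + i) = K * q i" for i
  proof -
    \<comment> \<open>Each factor of the weight is combined with the factors of \<open>phi\<close> and \<open>chi\<close> that change its
      parameter, and becomes a constant times one factor of \<open>q i\<close>.\<close>
    have g1: "sf (- L - 1) (s + i) * sf (of_nat (s + i) - 1 - L) s = sf (- L - 1) (2 * s) * sf a i"
      using sf_exchange[of "- L - 1" s i s] by (simp add: a_def algebra_simps flip: mult_2_right)
    have g2: "sf (- of_nat (s + i)) s / sf 1 (s + i) = (- 1) ^ s / sf 1 i"
      using sf_reflect_absorb[of 1 s i] by (simp add: field_simps)
    have g3: "sf (M + 1) (s + i) * sf (M + 1 + of_nat (s + i)) r = sf (M + 1) (s + r) * sf x1 i"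
      using sf_exchange[of "M + 1" s i r] by (simp add: x1_def add_ac)
    have g4: "sf (- of_nat N) (s + i) = sf (- of_nat N) s * sf (- of_nat n) i"
      unfolding sf_add by (simp add: ofN)
    have g5: "sf (M - w) (s + i) = sf (M - w) s * sf x2 i"
      unfolding sf_add by (simp add: x2_def)
    have g6: "sf x4 (s + i) / sf (L + M + 3 - of_nat N - w - t - of_nat (s + i)) s = (- 1) ^ s * sf x4 i"
    proof -
      have "sf (L + M + 3 - of_nat N - w - t - of_nat (s + i)) s \<noteq> 0"
        by (rule nz_sf'[OF nzs(10)]) simp
      moreover have "1 - x4 - of_nat (s + i) = L + M + 3 - of_nat N - w - t - of_nat (s + i)"
        by (simp add: x4_def)
      ultimately show ?thesis
        using sf_reflect_absorb[of x4 s i] by (metis quotient_signI)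
    qed
    have g7: "sf (L + M + 2 - of_nat (s + i)) r / sf (- L - M - 1) (s + i)
        = (- 1) ^ r * sf y r / (sf y s * sf (a + 1 - x1) i)"
    proof -
      have "sf y (s + i) = sf y s * sf (a + 1 - x1) i"
        unfolding sf_add by (simp add: y_def a_def x1_def algebra_simps)
      moreover have "sf y (s + i) \<noteq> 0" "sf (- L - M - 1) (s + i) \<noteq> 0"
        by (rule nz_sf'[OF nzs(4)]; simp add: y_def)+
      moreover have "sf (L + M + 2 - of_nat (s + i)) r * sf y (s + i)
          = (- 1) ^ r * sf y r * sf (- L - M - 1) (s + i)"
        using sf_reflect_exchange[of "- L - M - 1" "s + i" r] by (simp add: y_def algebra_simps)
      ultimately show ?thesis by (simp add: divide_simps)
    qed
    have g8: "sf b (s + i) / sf (L + M + 1 + t - of_nat (s + i)) r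
        = (- 1) ^ r * sf (b - of_nat r) s * sf x3 i / sf (b - of_nat r) r"
    proof -
      have "sf (b - of_nat r) (s + i) = sf (b - of_nat r) s * sf x3 i"
        unfolding sf_add by (simp add: b_def x3_def)
      moreover have "sf (b - of_nat r) r \<noteq> 0"
        by (rule nz_sf'[OF nzs(9)]) (simp add: b_def)
      moreover have "sf (L + M + 1 + t - of_nat (s + i)) r \<noteq> 0"
        by (rule nz_sf[OF nzs(9)]) simp
      moreover have "sf (L + M + 1 + t - of_nat (s + i)) r * sf (b - of_nat r) (s + i)
          = (- 1) ^ r * sf (b - of_nat r) r * sf b (s + i)"
        using sf_reflect_exchange[of b "s + i" r] by (simp add: b_def algebra_simps)
      ultimately show ?thesis
        using quotient_signI2[of "sf (L + M + 1 + t - of_nat (s + i)) r" "sf (b - of_nat r) s * sf x3 i" r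
          "sf (b - of_nat r) r" "sf b (s + i)"] by (simp only: mult.assoc simp_thms)
    qed
    have g9: "sf (of_nat N - L) (s + i) = sf (of_nat N - L) s * sf (a + of_nat n + 1) i"
      unfolding sf_add by (simp add: a_def ofN algebra_simps)
    have g10: "sf (w - L - M) (s + i) = sf (w - L - M) s * sf (a + 1 - x2) i"
      unfolding sf_add by (simp add: a_def x2_def algebra_simps)
    have g11: "sf (M + t) (s + i) * sf (M + t + of_nat (s + i)) r = sf (M + t) (s + r) * sf (a + 1 - x3) i"
      using sf_exchange[of "M + t" s i r] by (simp add: a_def x3_def algebra_simps)
    have g12: "sf c (s + i) * sf (c + of_nat (s + i)) s = sf c (2 * s) * sf (a + 1 - x4) i"
      using sf_exchange[of c s i s] by (simp add: a_def x4_def c_def algebra_simps flip: mult_2_right)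
    have g0: "sg (- L - 1 + 2 * of_nat (s + i)) = sg (a + 2 * of_nat i)"
      by (simp add: a_def algebra_simps)
    have sgn: "((- 1) ^ s * (- 1) ^ s :: complex) = 1" "((- 1) ^ r * (- 1) ^ r :: complex) = 1"
      by (simp_all flip: power_mult_distrib)
    have "jweight (s + i) * phi s (s + i) * chi r (s + i) = 1 / (sg (- L - 1) * jnorm)
       * sg (- L - 1 + 2 * of_nat (s + i))
       * (sf (- L - 1) (s + i) * sf (of_nat (s + i) - 1 - L) s)
       * (sf (- of_nat (s + i)) s / sf 1 (s + i))
       * (sf (M + 1) (s + i) * sf (M + 1 + of_nat (s + i)) r)
       * sf (- of_nat N) (s + i) * sf (M - w) (s + i)
       * (sf x4 (s + i) / sf (L + M + 3 - of_nat N - w - t - of_nat (s + i)) s)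
       * (sf (L + M + 2 - of_nat (s + i)) r / sf (- L - M - 1) (s + i))
       * (sf b (s + i) / sf (L + M + 1 + t - of_nat (s + i)) r)
       / (sf (of_nat N - L) (s + i) * sf (w - L - M) (s + i)
          * (sf (M + t) (s + i) * sf (M + t + of_nat (s + i)) r)
          * (sf c (s + i) * sf (c + of_nat (s + i)) s))"
      unfolding jweight_def phi_def chi_def x4_def b_def c_def
      by (simp only: mult_div_ac mult_1_left mult_1_right)
    also have "\<dots> = (((- 1) ^ s * (- 1) ^ s) * ((- 1) ^ r * (- 1) ^ r)) * (K * q i)"
      unfolding g0 g1 g2 g3 g4 g5 g6 g7 g8 g9 g10 g11 g12 K_def q_def
      by (simp only: mult_div_ac mult_1_left mult_1_right)
    finally show ?thesis unfolding sgn by simp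
  qed
  have ft: "(\<Sum>i\<le>n. q i) = (- 1) ^ n * sf a (n + 1) * sf (t - 1) n
     * sf (w - L - 2 * M - 1 - of_nat r) n * sf (t + w + of_nat r) n
     / (sf (a + 1 - x1) n * sf (a + 1 - x3) n * sf (a + 1 - x2) n * sf (a + 1 - x4) n)"
  proof -
    have "(\<Sum>i\<le>n. sg (a + 2 * of_nat i) * sf a i * sf (- of_nat n) i / (sf 1 i * sf (a + of_nat n + 1) i)
      * (sf x1 i / sf (a + 1 - x1) i) * (sf x3 i / sf (a + 1 - x3) i)
      * (sf x2 i / sf (a + 1 - x2) i) * (sf x4 i / sf (a + 1 - x4) i)) =
      (- 1) ^ n * sf a (n + 1) * sf (a + 1 - x1 - x3) n * sf (a + 1 - x1 - x2) n * sf (a + 1 - x3 - x2) n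
     / (sf (a + 1 - x1) n * sf (a + 1 - x3) n * sf (a + 1 - x2) n * sf (a + 1 - x4) n)"
    proof (rule frenkel_turaev_quotient)
      show "x1 + x3 + x2 + x4 = 2 * a + 1 + of_nat n"
        by (simp add: x1_def x2_def x3_def x4_def a_def ofN)
      show "sf a (2 * n + 1) \<noteq> 0" by (rule nz_sf'[OF nzs(1)]) (simp add: a_def)
      show "sf (a + 1 - x1) n \<noteq> 0" by (rule nz_sf'[OF nzs(4)]) (simp add: a_def x1_def)
      show "sf (a + 1 - x3) n \<noteq> 0" by (rule nz_sf[OF nzs(7)]) (simp add: a_def x3_def)
      show "sf (a + 1 - x2) n \<noteq> 0" by (rule nz_sf'[OF nzs(5)]) (simp add: a_def x2_def)
      show "sf (a + 1 - x4) n \<noteq> 0" by (rule nz_sf'[OF nzs(8)]) (simp add: a_def x4_def)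
    qed
    moreover have "a + 1 - x1 - x3 = t - 1" "a + 1 - x1 - x2 = w - L - 2 * M - 1 - of_nat r"
      "a + 1 - x3 - x2 = t + w + of_nat r"
      by (simp_all add: a_def x1_def x2_def x3_def)
    ultimately show ?thesis unfolding q_def by (simp only: mult_ac)
  qed
  have "(\<Sum>j\<le>N. jweight j * phi s j * chi r j) = (\<Sum>j\<in>{s..N}. jweight j * phi s j * chi r j)"
    by (rule sum.mono_neutral_right) (auto simp: phi_def sf_neg_zero)
  also have "\<dots> = (\<Sum>i\<le>n. jweight (s + i) * phi s (s + i) * chi r (s + i))"
    by (rule sum.reindex_bij_witness[of _ "\<lambda>i. s + i" "\<lambda>j. j - s"]) (auto simp: Nn)
  also have "\<dots> = K * (\<Sum>i\<le>n. q i)"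
    by (simp add: summand sum_distrib_left)
  also have "\<dots> = gram s r"
  proof -
    have L1: "sg (- L - 1) \<noteq> 0" by (rule nzD'[OF nzs(1)]) simp
    have L2: "sf (- L) N \<noteq> 0" by (rule nz_sf'[OF nzs(1)]) simp
    have L3: "sf (of_nat N - L) s \<noteq> 0" by (rule nz_sf'[OF nzs(1)]) simp
    have yN: "sf y N \<noteq> 0" "sf (- L - M - 1) N \<noteq> 0" by (rule nz_sf'[OF nzs(4)]; simp add: y_def)+
    have b1: "sf (b - of_nat r) r \<noteq> 0" "sf (b - of_nat r + of_nat s) r \<noteq> 0"
      by (rule nz_sf'[OF nzs(9)]; simp add: b_def)+
    have o1: "sf (w - L - M) N \<noteq> 0" by (rule nz_sf'[OF nzs(5)]) simp
    have o2: "sf (t + M) N \<noteq> 0" by (rule nz_sf[OF nzs(7)]) simp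
    have o3: "sf (t + w - M - 1) N \<noteq> 0" by (rule nz_sf[OF nzs(8)]) simp
    have m1: "sf (- L - 1) (2 * s) * sf a (n + 1) = sg (- L - 1) * (sf (- L) N * sf (of_nat N - L) s)"
    proof -
      have "sf (- L - 1) (2 * s) * sf a (n + 1) = sf (- L - 1) (Suc (N + s))"
        using sf_add[of "- L - 1" "2 * s" "n + 1"] by (simp add: a_def Nn algebra_simps flip: mult_2_right)
      also have "\<dots> = sg (- L - 1) * sf (- L) (N + s)" by (simp add: sf_rec)
      finally show ?thesis unfolding sf_add by (simp add: algebra_simps)
    qed
    have m2: "sf y r / (sf y s * sf (a + 1 - x1) n)
        = (- 1) ^ r * sf (L + M + 2 - of_nat N) r / sf (- L - M - 1) N"
    proof -
      have "sf y s * sf (a + 1 - x1) n = sf y N"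
        unfolding Nn sf_add by (simp add: y_def a_def x1_def algebra_simps)
      moreover have "sf (L + M + 2 - of_nat N) r * sf y N = (- 1) ^ r * sf y r * sf (- L - M - 1) N"
        using sf_reflect_exchange[of "- L - M - 1" N r] by (simp add: y_def algebra_simps)
      moreover have "(- 1) ^ r * ((- 1) ^ r * z) = z" for z :: complex
        by (simp flip: mult.assoc power_mult_distrib)
      ultimately show ?thesis using yN by (simp add: divide_simps mult.assoc)
    qed
    have m3: "sf (w - L - M) s * sf (a + 1 - x2) n = sf (w - L - M) N"
      unfolding Nn sf_add by (simp add: a_def x2_def algebra_simps)
    have m4: "sf (M + t) (s + r) * sf (a + 1 - x3) n = sf (t + M) N * sf (M + t + of_nat N) r"
      using sf_exchange[of "M + t" s n r] by (simp add: Nn a_def x3_def algebra_simps)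
    have m5: "sf c (2 * s) * sf (a + 1 - x4) n = sf c (N + s)"
      using sf_add[of c "2 * s" n] by (simp add: Nn a_def x4_def c_def algebra_simps flip: mult_2_right)
    have m6: "sf (b - of_nat r) s / sf (b - of_nat r) r = sf b s / sf (b - of_nat r + of_nat s) r"
      using sf_add[of "b - of_nat r" s r] sf_add[of "b - of_nat r" r s] b1
      by (simp add: divide_simps add.commute mult.commute)
    have "K * (\<Sum>i\<le>n. q i) = 1 / (sg (- L - 1) * jnorm) * (sf (- L - 1) (2 * s) * sf a (n + 1))
       * sf (M + 1) (s + r) * sf (- of_nat N) s * sf (M - w) s
       * (sf y r / (sf y s * sf (a + 1 - x1) n)) * (sf (b - of_nat r) s / sf (b - of_nat r) r)
       * (- 1) ^ n * sf (t - 1) n * sf (w - L - 2 * M - 1 - of_nat r) n * sf (t + w + of_nat r) n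
      / (sf (of_nat N - L) s * (sf (w - L - M) s * sf (a + 1 - x2) n)
         * (sf (M + t) (s + r) * sf (a + 1 - x3) n) * (sf c (2 * s) * sf (a + 1 - x4) n))"
      unfolding K_def ft by (simp only: mult_div_ac mult_1_left mult_1_right)
    also have "\<dots> = gram s r"
      unfolding m1 m2 m3 m4 m5 m6 jnorm_def gram_def n_def[symmetric] c_def[symmetric] b_def[symmetric]
      using L1 L2 L3 yN o1 o2 o3 by (simp add: mult_div_ac)
    finally show ?thesis .
  qed
  finally show ?thesis .
qed

end
end

context sigma_function begin

context
  fixes N :: nat and L M w t :: complex
begin

text \<open>The part of \<open>w\<^sub>1(l, j)\<close> that does not depend on \<open>j\<close>, without its power of \<open>q\<close>.\<close>
definition weight1 :: "nat \<Rightarrow> complex" where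
  "weight1 l = sg (L + 2 * M + 1 - of_nat N - w + 2 * of_nat l) / sg (L + 2 * M + 1 - of_nat N - w)
    * sf (L + 2 * M + 1 - of_nat N - w) l / (sf (L - w + 2 * M + 2) l * sf 1 l * sf (L - of_nat N + M + 2) l
      * sf (M + 1) l * sf (- of_nat N) l * sf (M - w) l * sf (L - of_nat N - w + M + 1) l)"

definition alpha :: "nat \<Rightarrow> nat \<Rightarrow> complex" where
  "alpha l s = (let a = M + 1 - of_nat N - w - t in
     (- 1) ^ l * sf 1 l * weight1 l * vcoef a l s * wpair a l (L + 2 * M + 1 - of_nat N - w + of_nat l) s
     * wpair a l (M + 2 - t - w) s * wpair a l (2 - of_nat N - t) s * wpair a l (1 - of_nat N - t - w) s)"

definition beta :: "nat \<Rightarrow> nat \<Rightarrow> complex" where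
  "beta k r = (let a = L + 2 * M + 1 + t in
     (- 1) ^ k * sf 1 k * vcoef a k r * wpair a k (M + of_nat N + t) r * wpair a k (t + w) r
     * wpair a k (L + M + t + 1) r * wpair a k (L + 2 * M + 1 - of_nat N - w + of_nat k) r)"

text \<open>The value of \<open>\<Sum>\<^sub>r beta k r * gram s r\<close>. It contains the factor \<open>(1 + s - k)\<^sub>k\<close> and so vanishes
  for \<open>s < k\<close>.\<close>
definition gram2 :: "nat \<Rightarrow> nat \<Rightarrow> complex" where
  "gram2 s k = (- 1) ^ k * sf (1 + of_nat s - of_nat k) k * sf (M + 1 - of_nat N - w - t + of_nat s) k
      * sf (L + M + 1 - w - of_nat N) k * sf (L + M + 2 - of_nat N) k
      * sf (M + 1) s * sf (- of_nat N) s * sf (M - w) s * sf (- L - M - t) s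
      * sf (t - 1) (N - s) * sf (t + w) (N - s)
      * sf (L + 2 * M + 2 - of_nat N - w + of_nat s + of_nat k) (N - s) * sf (t + w - M - 1) N
     / (sf (M + 2 - of_nat N - w - t) (N + s) * sf (w - L - 2 * M - 1) N * sf (t + w) N * sf (t - 1) N
        * sf (L + M + 1 + t - of_nat s) k)"

text \<open>All factors of \<open>gram s r\<close> that depend on \<open>r\<close> either cancel against those of \<open>beta k r\<close> or replace one of
  its parameters by an \<open>s\<close>-dependent one; four parameters remain and are balanced.\<close>
lemma sum_beta_gram:
  assumes g: "generic L M w t" and s: "s \<le> N" and k: "k \<le> N"
  shows "(\<Sum>r\<le>k. beta k r * gram N L M w t s r) = gram2 s k"
proof -
  note nzs = genericD[OF g]
  define n where "n = N - s"
  have Nn: "N = s + n" using s by (simp add: n_def)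
  have ofN: "of_nat N = (of_nat s + of_nat n :: complex)" by (simp add: Nn)
  define a where "a = L + 2 * M + 1 + t"
  define D where "D = L + 2 * M + 1 - of_nat N - w"
  define x1 where "x1 = D + of_nat k"
  define x2 where "x2 = t + w + of_nat n"
  define x3 where "x3 = M + 1 + of_nat s"
  define x4 where "x4 = L + M + t + 1"
  define c where "c = M + 2 - of_nat N - w - t"
  define b where "b = - L - M - t"
  define d where "d = L + M + 1 + t - of_nat s"
  define C where "C = sf 1 k * sf (M + 1) s * sf (- of_nat N) s * sf (M - w) s * sf b s
     * sf (L + M + 2 - of_nat N) k * sf (t - 1) n * sf (t + w) n * sf (D + 1 + of_nat s + of_nat k) n
     * sf (t + w - M - 1) N
     / (sf d k * sf c (N + s) * sf (w - L - 2 * M - 1) N * sf (t + w) N * sf (t - 1) N)"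
  have dk: "sf d j \<noteq> 0" for j by (rule nz_sf[OF nzs(9)]) (simp add: d_def)
  have summand: "beta k r * gram N L M w t s r
     = (- 1) ^ k * C * (vcoef a k r * wpair a k x1 r * wpair a k x2 r * wpair a k x3 r * wpair a k x4 r)" if r: "r \<le> k" for r
  proof -
    have g1: "sf (M + 1) (s + r) = sf (M + 1) s * sf x3 r"
      unfolding sf_add by (simp add: x3_def)
    have g2: "wpair a k (M + of_nat N + t) r * sf (L + M + 2 - of_nat N) r / sf (M + t + of_nat N) r
       = sf (L + M + 2 - of_nat N) k"
    proof -
      have "sf (M + t + of_nat N) r \<noteq> 0" by (rule nz_sf[OF nzs(7)]) simp
      then show ?thesis using sf_split[OF r, of "L + M + 2 - of_nat N"]
        by (simp add: wpair_def a_def algebra_simps)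
    qed
    have g3: "sf (b - of_nat r + of_nat s) r = (- 1) ^ r * sf d r"
      by (subst sf_reflect) (simp add: b_def d_def algebra_simps)
    have g4: "sf (w - L - 2 * M - 1 - of_nat r) n = (- 1) ^ n * sf (D + 1 + of_nat s + of_nat r) n"
      by (subst sf_reflect) (simp add: D_def ofN algebra_simps)
    have g5: "wpair a k (t + w) r * sf (t + w + of_nat r) n * sf (D + 1 + of_nat s + of_nat r) n
       = sf (t + w) n * sf (D + 1 + of_nat s + of_nat k) n * wpair a k x2 r"
    proof -
      have 1: "sf (t + w) r * sf (t + w + of_nat r) n = sf (t + w) n * sf x2 r"
        using sf_add[of "t + w" r n] sf_add[of "t + w" n r] by (simp add: x2_def add.commute)
      define u where "u = D + 1 + of_nat s + of_nat r"
      have "sf u n * sf (u + of_nat n) (k - r) = sf u (k - r) * sf (u + of_nat (k - r)) n"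
        using sf_add[of u n "k - r"] sf_add[of u "k - r" n] by (simp add: add.commute)
      moreover have "u + of_nat n = a + 1 - (t + w) + of_nat r"
        by (simp add: u_def a_def D_def ofN)
      moreover have "u + of_nat (k - r) = D + 1 + of_nat s + of_nat k"
        using r by (simp add: u_def of_nat_diff)
      moreover have "u = a + 1 - x2 + of_nat r"
        by (simp add: u_def a_def D_def x2_def ofN)
      ultimately have 2: "sf (D + 1 + of_nat s + of_nat r) n * sf (a + 1 - (t + w) + of_nat r) (k - r)
         = sf (a + 1 - x2 + of_nat r) (k - r) * sf (D + 1 + of_nat s + of_nat k) n"
        using u_def by metis
      have "wpair a k (t + w) r * sf (t + w + of_nat r) n * sf (D + 1 + of_nat s + of_nat r) n
        = (sf (t + w) r * sf (t + w + of_nat r) n)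
          * (sf (D + 1 + of_nat s + of_nat r) n * sf (a + 1 - (t + w) + of_nat r) (k - r))"
        by (simp only: wpair_def mult_ac)
      then show ?thesis unfolding 1 2 by (simp only: wpair_def mult_ac)
    qed
    have g6: "sf x3 r / sf d r = wpair a k x3 r / sf d k"
    proof -
      have "sf d k = sf d r * sf (a + 1 - x3 + of_nat r) (k - r)"
        using sf_split[OF r, of d] by (simp add: d_def a_def x3_def algebra_simps)
      then show ?thesis using dk[of r] dk[of k] by (simp add: wpair_def divide_simps)
    qed
    have "beta k r * gram N L M w t s r = ((- 1) ^ k * sf 1 k * vcoef a k r * wpair a k x4 r * wpair a k x1 r)
       * (wpair a k (M + of_nat N + t) r * sf (L + M + 2 - of_nat N) r / sf (M + t + of_nat N) r)
       * sf (M + 1) (s + r) * ((- 1) ^ r / sf (b - of_nat r + of_nat s) r)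
       * ((- 1) ^ n * sf (w - L - 2 * M - 1 - of_nat r) n) * (wpair a k (t + w) r * sf (t + w + of_nat r) n)
       * sf (- of_nat N) s * sf (M - w) s * sf b s * sf (t - 1) n * sf (t + w - M - 1) N
       / (sf c (N + s) * sf (w - L - 2 * M - 1) N * sf (t + w) N * sf (t - 1) N)"
      unfolding beta_def gram_def Let_def a_def[symmetric] D_def[symmetric] x1_def[symmetric]
        x4_def[symmetric] b_def[symmetric] c_def[symmetric] n_def[symmetric]
      by (simp only: mult_div_ac mult_1_left mult_1_right)
    also have "(- 1) ^ r / sf (b - of_nat r + of_nat s) r = 1 / sf d r"
      unfolding g3 by (simp add: divide_simps)
    also have "(- 1) ^ n * sf (w - L - 2 * M - 1 - of_nat r) n = sf (D + 1 + of_nat s + of_nat r) n"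
      unfolding g4 by (rule neg_one_power_cancel)
    also have "((- 1) ^ k * sf 1 k * vcoef a k r * wpair a k x4 r * wpair a k x1 r)
       * (wpair a k (M + of_nat N + t) r * sf (L + M + 2 - of_nat N) r / sf (M + t + of_nat N) r)
       * sf (M + 1) (s + r) * (1 / sf d r)
       * sf (D + 1 + of_nat s + of_nat r) n * (wpair a k (t + w) r * sf (t + w + of_nat r) n)
       * sf (- of_nat N) s * sf (M - w) s * sf b s * sf (t - 1) n * sf (t + w - M - 1) N
       / (sf c (N + s) * sf (w - L - 2 * M - 1) N * sf (t + w) N * sf (t - 1) N) =
      ((- 1) ^ k * sf 1 k * vcoef a k r * wpair a k x4 r * wpair a k x1 r)
       * (wpair a k (M + of_nat N + t) r * sf (L + M + 2 - of_nat N) r / sf (M + t + of_nat N) r)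
       * sf (M + 1) s * (sf x3 r / sf d r)
       * (wpair a k (t + w) r * sf (t + w + of_nat r) n * sf (D + 1 + of_nat s + of_nat r) n)
       * sf (- of_nat N) s * sf (M - w) s * sf b s * sf (t - 1) n * sf (t + w - M - 1) N
       / (sf c (N + s) * sf (w - L - 2 * M - 1) N * sf (t + w) N * sf (t - 1) N)"
      unfolding g1 by (simp only: mult_div_ac mult_1_left mult_1_right)
    also have "\<dots> = (- 1) ^ k * C * (vcoef a k r * wpair a k x1 r * wpair a k x2 r * wpair a k x3 r * wpair a k x4 r)"
      unfolding g2 g5 g6 C_def by (simp only: mult_div_ac mult_1_left mult_1_right)
    finally show ?thesis .
  qed
  have ft: "(\<Sum>r\<le>k. vcoef a k r * wpair a k x1 r * wpair a k x2 r * wpair a k x3 r * wpair a k x4 r) =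
      (- 1) ^ k * sf (a + 1 - x1 - x2) k * sf (a + 1 - x1 - x3) k * sf (a + 1 - x2 - x3) k / sf 1 k"
  proof (rule frenkel_turaev)
    show "x1 + x2 + x3 + x4 = 2 * a + 1 + of_nat k"
      by (simp add: x1_def x2_def x3_def x4_def a_def D_def ofN)
    show "regular a k" by (rule nz_regular[OF nzs(13)]) (simp add: a_def)
  qed
  have args: "a + 1 - x1 - x2 = 1 + of_nat s - of_nat k" "a + 1 - x2 - x3 = L + M + 1 - w - of_nat N"
    by (simp_all add: a_def x1_def x2_def x3_def D_def ofN)
  have refl13: "sf (a + 1 - x1 - x3) k = (- 1) ^ k * sf (M + 1 - of_nat N - w - t + of_nat s) k"
    by (subst sf_reflect) (simp add: a_def x1_def x3_def D_def algebra_simps)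
  have "(\<Sum>r\<le>k. beta k r * gram N L M w t s r) = (- 1) ^ k * C *
     (\<Sum>r\<le>k. vcoef a k r * wpair a k x1 r * wpair a k x2 r * wpair a k x3 r * wpair a k x4 r)"
    unfolding sum_distrib_left using summand by (intro sum.cong) auto
  also have "\<dots> = ((- 1) ^ k * ((- 1) ^ k * C)) * ((- 1) ^ k * (sf (1 + of_nat s - of_nat k) k
      * sf (M + 1 - of_nat N - w - t + of_nat s) k * sf (L + M + 1 - w - of_nat N) k / sf 1 k))"
    unfolding ft args refl13 by (simp only: mult_div_ac)
  also have "\<dots> = gram2 s k"
  proof -
    have D1: "L + 2 * M + 2 - of_nat N - w + of_nat s + of_nat k = D + 1 + of_nat s + of_nat k"
      by (simp add: D_def)
    have "sf 1 k \<noteq> 0" by simp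
    then show ?thesis
      unfolding neg_one_power_cancel C_def gram2_def D1 n_def[symmetric] b_def[symmetric] c_def[symmetric]
        d_def[symmetric]
      by (simp add: mult_div_ac)
  qed
  finally show ?thesis .
qed

text \<open>The pairs of \<open>a\<close> and \<open>1\<close> multiply to a constant. Adding them as two dummy parameters gives a
  Frenkel-Turaev sum whose value contains \<open>(a + 1 - a - 1)\<^sub>n = 0\<close>.\<close>
lemma orthogonality:
  assumes "b + c = a + of_nat n" "n > 0" "regular a n" "sg a \<noteq> 0"
  shows "(\<Sum>i\<le>n. vcoef a n i * wpair a n b i * wpair a n c i) = 0"
proof -
  have nz1: "sf a n \<noteq> 0"
  proof (rule sf_nz)
    fix i assume "i < n"
    then show "sg (a + of_nat i) \<noteq> 0"
      using assms(4) regularD[OF assms(3), of i] by (cases i) auto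
  qed
  have triv: "wpair a n a i * wpair a n 1 i = sf 1 n * sf a n" if "i \<le> n" for i
    using sf_split[OF that, of 1] sf_split[OF that, of a] by (simp add: wpair_def)
  have "(\<Sum>i\<le>n. vcoef a n i * wpair a n b i * wpair a n c i) * (sf 1 n * sf a n)
    = (\<Sum>i\<le>n. vcoef a n i * wpair a n a i * wpair a n 1 i * wpair a n b i * wpair a n c i)"
    unfolding sum_distrib_right by (rule sum.cong[OF refl]) (simp add: triv[symmetric])
  also have "\<dots> = (- 1) ^ n * sf (a + 1 - a - 1) n * sf (a + 1 - a - b) n * sf (a + 1 - 1 - b) n / sf 1 n"
    by (rule frenkel_turaev) (use assms in \<open>simp_all add: algebra_simps\<close>)
  also have "sf (a + 1 - a - 1) n = 0"
    using assms(2) sf_neg_zero[of 0 n] by simp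
  finally show ?thesis using nz1 by simp
qed

text \<open>Only \<open>k \<le> s \<le> l\<close> contributes, and with \<open>s = k + i\<close> the terms are, up to a constant \<open>C\<close>, those
  of \<open>orthogonality\<close> with length \<open>l - k\<close>. For \<open>k = l\<close> a single term is left, and the definition of
  \<open>weight1\<close> is exactly what makes \<open>C = 1\<close>.\<close>
lemma sum_alpha_gram2:
  assumes g: "generic L M w t" and l: "l \<le> N" and k: "k \<le> N"
  shows "(\<Sum>s\<le>l. alpha l s * gram2 s k) = (if k = l then 1 else 0)"
proof (cases "k \<le> l")
  case False
  have "gram2 s k = 0" if "s \<le> l" for s
  proof -
    have "1 + of_nat s - of_nat k = - (of_nat (k - s - 1) :: complex)"
      using that False by (simp add: of_nat_diff)
    then have "sf (1 + of_nat s - of_nat k) k = 0"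
      using sf_neg_zero[of "k - s - 1" k] that False by simp
    then show ?thesis by (simp add: gram2_def)
  qed
  then show ?thesis using False by simp
next
  case True
  note nzs = genericD[OF g]
  define n where "n = l - k"
  have ln: "l = k + n" using True by (simp add: n_def)
  define a0 where "a0 = M + 1 - of_nat N - w - t"
  define a where "a = a0 + 2 * of_nat k"
  define D where "D = L + 2 * M + 1 - of_nat N - w"
  define b where "b = - L - M - t"
  define e where "e = D + of_nat l + of_nat k"
  define c where "c = M + 2 - of_nat N - w - t"
  have c: "c = a0 + 1" by (simp add: c_def a0_def)
  define C where "C = sf 1 l * weight1 l * sf (D + of_nat l) k * sf (- of_nat N) l * sf (M - w) l * sf (M + 1) l
     * sf (L + M + 1 - w - of_nat N) k * sf (L + M + 2 - of_nat N) k * sf (D + 1 + of_nat k + of_nat l) (N - l)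
     / sf (D + 1) N"
  have ra: "regular a0 l" by (rule nz_regular'[OF nzs(8)]) (simp add: a0_def)
  have summand: "alpha l (k + i) * gram2 (k + i) k
     = (- 1) ^ l * ((- 1) ^ k * C) * (vcoef a n i * wpair a n b i * wpair a n e i)" if i: "i \<le> n" for i
  proof -
    have ki: "k + i \<le> l" "k + i \<le> N" using i l ln by simp_all
    have li: "l - (k + i) = n - i" by (simp add: ln)
    have g1: "vcoef a0 l (k + i) * sf (1 + of_nat (k + i) - of_nat k) k * sf (a0 + of_nat (k + i)) k
       = (- 1) ^ k * vcoef a n i"
    proof -
      have "sf 1 (k + i) = sf 1 i * sf (1 + of_nat (k + i) - of_nat k) k"
        using sf_add[of 1 i k] by (simp add: add.commute)
      moreover from this have "sf (1 + of_nat (k + i) - of_nat k) k \<noteq> 0"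
        using sf_1_nz[of "k + i"] by auto
      moreover have "vwp a n i = vwp a0 l (k + i) * sf (a0 + of_nat (k + i)) k"
        using vwp_shift[OF ra ki(1)] by (simp add: a_def n_def)
      ultimately show ?thesis
        unfolding vcoef_def li by (simp add: power_add)
    qed
    have g2: "wpair a0 l (D + of_nat l) (k + i) = sf (D + of_nat l) k * wpair a n e i"
    proof -
      have "a0 + 1 - (D + of_nat l) + of_nat (k + i) = a + 1 - e + of_nat i"
        by (simp add: a_def e_def)
      moreover have "sf (D + of_nat l) (k + i) = sf (D + of_nat l) k * sf e i"
        unfolding sf_add by (simp add: e_def)
      ultimately show ?thesis unfolding wpair_def li by (simp only: mult_ac)
    qed
    have g3: "sf b (k + i) / sf (L + M + 1 + t - of_nat (k + i)) k = (- 1) ^ k * sf b i"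
    proof -
      have "sf (L + M + 1 + t - of_nat (k + i)) k \<noteq> 0" by (rule nz_sf[OF nzs(9)]) simp
      moreover have "L + M + 1 + t - of_nat (k + i) = 1 - b - of_nat (k + i)" by (simp add: b_def)
      ultimately show ?thesis using sf_reflect_absorb[of b k i] by (metis quotient_signI)
    qed
    have g4: "sf (D + 1 + of_nat (k + i) + of_nat k) (N - (k + i))
        = sf (a + 1 - b + of_nat i) (n - i) * sf (D + 1 + of_nat k + of_nat l) (N - l)"
    proof -
      have "N - (k + i) = (n - i) + (N - l)" using i l ln by simp
      moreover have "D + 1 + of_nat (k + i) + of_nat k = a + 1 - b + of_nat i"
        by (simp add: a_def a0_def b_def D_def)
      moreover have "a + 1 - b + of_nat i + of_nat (n - i) = D + 1 + of_nat k + of_nat l"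
        using i by (simp add: a_def a0_def b_def D_def ln of_nat_diff)
      ultimately show ?thesis by (simp only: sf_add)
    qed
    have g5: "wpair a0 l (M + 2 - t - w) (k + i) * sf (- of_nat N) (k + i) / sf c (N + (k + i))
        = sf (- of_nat N) l / sf c N"
    proof -
      have "sf c (N + (k + i)) = sf c N * sf (M + 2 - t - w) (k + i)"
        unfolding sf_add[of c N] by (simp add: c_def algebra_simps)
      moreover have "sf c (N + (k + i)) \<noteq> 0" by (rule nz_sf'[OF nzs(8)]) (simp add: c_def)
      moreover have "sf (- of_nat N) l = sf (- of_nat N) (k + i)
         * sf (a0 + 1 - (M + 2 - t - w) + of_nat (k + i)) (l - (k + i))"
        using sf_split[OF ki(1), of "- of_nat N"] by (simp add: a0_def algebra_simps)
      ultimately show ?thesis by (simp add: wpair_def)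
    qed
    have g6: "wpair a0 l (2 - of_nat N - t) (k + i) * sf (t - 1) (N - (k + i)) * sf (M - w) (k + i)
       = (- 1) ^ (k + i) * sf (t - 1) N * sf (M - w) l"
    proof -
      have "sf (2 - of_nat N - t) (k + i) = (- 1) ^ (k + i) * sf (t - 1 + of_nat (N - (k + i))) (k + i)"
        using ki by (subst sf_reflect) (simp add: of_nat_diff algebra_simps)
      moreover have "sf (t - 1) N = sf (t - 1) (N - (k + i)) * sf (t - 1 + of_nat (N - (k + i))) (k + i)"
        using sf_split[of "N - (k + i)" N "t - 1"] ki by simp
      moreover have "sf (M - w) l = sf (M - w) (k + i)
         * sf (a0 + 1 - (2 - of_nat N - t) + of_nat (k + i)) (l - (k + i))"
        using sf_split[OF ki(1), of "M - w"] by (simp add: a0_def algebra_simps)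
      ultimately show ?thesis by (simp only: wpair_def mult_ac)
    qed
    have g7: "wpair a0 l (1 - of_nat N - t - w) (k + i) * sf (t + w) (N - (k + i)) * sf (M + 1) (k + i)
       = (- 1) ^ (k + i) * sf (t + w) N * sf (M + 1) l"
    proof -
      have "sf (1 - of_nat N - t - w) (k + i) = (- 1) ^ (k + i) * sf (t + w + of_nat (N - (k + i))) (k + i)"
        using ki by (subst sf_reflect) (simp add: of_nat_diff algebra_simps)
      moreover have "sf (t + w) N = sf (t + w) (N - (k + i)) * sf (t + w + of_nat (N - (k + i))) (k + i)"
        using sf_split[of "N - (k + i)" N "t + w"] ki by simp
      moreover have "sf (M + 1) l = sf (M + 1) (k + i)
         * sf (a0 + 1 - (1 - of_nat N - t - w) + of_nat (k + i)) (l - (k + i))"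
        using sf_split[OF ki(1), of "M + 1"] by (simp add: a0_def algebra_simps)
      ultimately show ?thesis by (simp only: wpair_def mult_ac)
    qed
    have g8: "sf (t + w - M - 1) N / sf c N / sf (w - L - 2 * M - 1) N = 1 / sf (D + 1) N"
    proof -
      have "sf c N = (- 1) ^ N * sf (t + w - M - 1) N"
        by (subst sf_reflect) (simp add: c_def algebra_simps)
      moreover have "sf (w - L - 2 * M - 1) N = (- 1) ^ N * sf (D + 1) N"
        by (subst sf_reflect) (simp add: D_def algebra_simps)
      moreover have "sf (t + w - M - 1) N \<noteq> 0" by (rule nz_sf[OF nzs(8)]) simp
      ultimately show ?thesis by (simp add: neg_one_power_cancel mult_ac)
    qed
    have tn: "sf (t - 1) N \<noteq> 0" by (rule nz_sf[OF nzs(11)]) simp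
    have tw: "sf (t + w) N \<noteq> 0" by (rule nz_sf[OF nzs(12)]) simp
    have D1: "L + 2 * M + 2 - of_nat N - w + of_nat (k + i) + of_nat k = D + 1 + of_nat (k + i) + of_nat k"
      by (simp add: D_def)
    have "alpha l (k + i) * gram2 (k + i) k = (- 1) ^ l * sf 1 l * weight1 l * (- 1) ^ k
       * (vcoef a0 l (k + i) * sf (1 + of_nat (k + i) - of_nat k) k * sf (a0 + of_nat (k + i)) k)
       * wpair a0 l (D + of_nat l) (k + i) * (sf b (k + i) / sf (L + M + 1 + t - of_nat (k + i)) k)
       * sf (D + 1 + of_nat (k + i) + of_nat k) (N - (k + i))
       * (wpair a0 l (M + 2 - t - w) (k + i) * sf (- of_nat N) (k + i) / sf c (N + (k + i)))
       * (wpair a0 l (2 - of_nat N - t) (k + i) * sf (t - 1) (N - (k + i)) * sf (M - w) (k + i))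
       * (wpair a0 l (1 - of_nat N - t - w) (k + i) * sf (t + w) (N - (k + i)) * sf (M + 1) (k + i))
       * sf (L + M + 1 - w - of_nat N) k * sf (L + M + 2 - of_nat N) k * sf (t + w - M - 1) N
       / (sf (w - L - 2 * M - 1) N * sf (t + w) N * sf (t - 1) N)"
      unfolding alpha_def gram2_def Let_def D1 a0_def[symmetric] D_def[symmetric] b_def[symmetric]
        c_def[symmetric]
      by (simp only: mult_div_ac mult_1_left mult_1_right)
    also have "\<dots> = (- 1) ^ l * ((- 1) ^ k * ((- 1) ^ k * ((- 1) ^ k * ((- 1) ^ (k + i) * ((- 1) ^ (k + i)
       * (sf 1 l * weight1 l * (vcoef a n i * wpair a n b i * wpair a n e i) * sf (D + of_nat l) k * sf (- of_nat N) l
       * sf (M - w) l * sf (M + 1) l * sf (L + M + 1 - w - of_nat N) k * sf (L + M + 2 - of_nat N) k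
       * sf (D + 1 + of_nat k + of_nat l) (N - l) * (sf (t - 1) N / sf (t - 1) N) * (sf (t + w) N / sf (t + w) N)
       * (sf (t + w - M - 1) N / sf c N / sf (w - L - 2 * M - 1) N)))))))"
      unfolding g1 g2 g3 g4 g5 g6 g7 wpair_def[of a n b i]
      by (simp only: mult_div_ac mult_1_left mult_1_right)
    also have "\<dots> = (- 1) ^ l * ((- 1) ^ k * C) * (vcoef a n i * wpair a n b i * wpair a n e i)"
      unfolding neg_one_power_cancel g8 C_def divide_self[OF tn] divide_self[OF tw]
      by (simp only: mult_div_ac mult_1_left mult_1_right)
    finally show ?thesis .
  qed
  have zero: "gram2 s k = 0" if "s < k" for s
  proof -
    have "1 + of_nat s - of_nat k = - (of_nat (k - s - 1) :: complex)"
      using that by (simp add: of_nat_diff)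
    then have "sf (1 + of_nat s - of_nat k) k = 0"
      using sf_neg_zero[of "k - s - 1" k] that by simp
    then show ?thesis by (simp add: gram2_def)
  qed
  have "(\<Sum>s\<le>l. alpha l s * gram2 s k) = (\<Sum>s\<in>{k..l}. alpha l s * gram2 s k)"
    by (rule sum.mono_neutral_right) (auto simp: zero)
  also have "\<dots> = (\<Sum>i\<le>n. alpha l (k + i) * gram2 (k + i) k)"
    by (rule sum.reindex_bij_witness[of _ "\<lambda>i. k + i" "\<lambda>j. j - k"]) (auto simp: ln)
  also have "\<dots> = (- 1) ^ l * ((- 1) ^ k * C) * (\<Sum>i\<le>n. vcoef a n i * wpair a n b i * wpair a n e i)"
    unfolding sum_distrib_left using summand by (intro sum.cong) auto
  also have "\<dots> = (if k = l then 1 else 0)"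
  proof (cases "n = 0")
    case False
    have "(\<Sum>i\<le>n. vcoef a n i * wpair a n b i * wpair a n e i) = 0"
    proof (rule orthogonality)
      show "b + e = a + of_nat n" by (simp add: b_def e_def a_def a0_def D_def ln)
      show "regular a n" by (rule nz_regular'[OF nzs(8)]) (simp add: a_def a0_def)
      show "sg a \<noteq> 0" by (rule nzD'[OF nzs(8)]) (simp add: a_def a0_def)
    qed (use False in simp)
    then show ?thesis using False ln by simp
  next
    case True
    then have kl: "k = l" using ln by simp
    have nN: "sf (- of_nat N) l \<noteq> 0"
    proof (rule sf_nz)
      fix i assume "i < l"
      then have "- of_nat N + of_nat i = - (of_nat (N - i) :: complex)" using l by (simp add: of_nat_diff)
      then show "sg (- of_nat N + of_nat i) \<noteq> 0"
        using sg_nat_nz[of "N - i"] \<open>i < l\<close> l by (simp only: sg_minus) simp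
    qed
    have m1: "sf (M - w) l \<noteq> 0" by (rule nz_sf[OF nzs(3)]) simp
    have m2: "sf (M + 1) l \<noteq> 0" by (rule nz_sf[OF nzs(2)]) simp
    have m3: "sf (L - of_nat N - w + M + 1) l \<noteq> 0" by (rule nz_sf[OF nzs(5)]) simp
    have m4: "sf (L - of_nat N + M + 2) l \<noteq> 0" by (rule nz_sf[OF nzs(4)]) simp
    have m5: "sf D (Suc (N + l)) \<noteq> 0" by (rule nz_sf[OF nzs(6)]) (simp add: D_def)
    have e1: "sf D (Suc (N + l)) = sg D * sf (D + 1) N * sf (L - w + 2 * M + 2) l"
      unfolding sf_rec sf_add by (simp add: D_def algebra_simps)
    have e2: "sf D (Suc (N + l)) = sf D l * sf (D + of_nat l) l * sg (D + 2 * of_nat l)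
       * sf (D + 1 + of_nat l + of_nat l) (N - l)"
    proof -
      have "Suc (N + l) = l + (l + (Suc (N - l)))" using l by simp
      then show ?thesis by (simp only: sf_add sf_rec) (simp add: algebra_simps)
    qed
    have "C * sf D (Suc (N + l)) = sf D (Suc (N + l))"
    proof -
      have "weight1 l = sg (D + 2 * of_nat l) / sg D * sf D l / (sf (L - w + 2 * M + 2) l * sf 1 l * sf (L - of_nat N + M + 2) l
      * sf (M + 1) l * sf (- of_nat N) l * sf (M - w) l * sf (L - of_nat N - w + M + 1) l)"
        by (simp only: weight1_def D_def)
      moreover have args: "L + M + 1 - w - of_nat N = L - of_nat N - w + M + 1"
        "L + M + 2 - of_nat N = L - of_nat N + M + 2" by simp_all
      ultimately have "C = sf D l * sf (D + of_nat l) l * sg (D + 2 * of_nat l)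
         * sf (D + 1 + of_nat l + of_nat l) (N - l) / (sg D * sf (D + 1) N * sf (L - w + 2 * M + 2) l)"
        unfolding C_def kl args using nN m1 m2 m3 m4 by (simp add: mult_div_ac)
      then show ?thesis unfolding e2[symmetric] e1[symmetric] using m5 by simp
    qed
    then have "C = 1" using m5 by simp
    then show ?thesis using True kl
      by (simp add: vcoef_def vwp_def wpair_def neg_one_power_cancel)
  qed
  finally show ?thesis .
qed

text \<open>The two series of the theorem, with all denominators cleared but one. The factorials
  \<open>(L + M + 3 - N - w - t - j)\<^sub>v\<close> respectively \<open>(L + M + 1 + t - j)\<^sub>v\<close> stay in the denominator, since for \<open>j < l\<close>
  the factorial of length \<open>l\<close> that would clear them may vanish.\<close>
definition series1 :: "nat \<Rightarrow> nat \<Rightarrow> complex" where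
  "series1 l j = (let a = L - 2 * of_nat j - of_nat l + 1; x = t + w + of_nat N - of_nat j - of_nat l - 1 - M in
     \<Sum>v\<le>min l j. vcoef a l v * wpair a l (- of_nat j) v * wpair a l (L - of_nat N - of_nat j + 1) v
       * wpair a l (L + M + 1 - of_nat j - w) v * wpair a l (L + M + 2 - of_nat j) v
       * wpair a l (2 - of_nat j - of_nat l - M - t) v * (sf x v / sf (L + M + 3 - of_nat N - w - t - of_nat j) v))"

definition series2 :: "nat \<Rightarrow> nat \<Rightarrow> complex" where
  "series2 k j = (let a = L - 2 * of_nat j - of_nat k + 1; x = 1 - of_nat j - of_nat k - M - t in
     \<Sum>v\<le>min k j. vcoef a k v * wpair a k (- of_nat j) v * wpair a k (L - of_nat N - of_nat j + 1) v
       * wpair a k (L + M + 1 - of_nat j - w) v * wpair a k (L + M + 2 - of_nat j) v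
       * wpair a k (t + w + of_nat N - of_nat j - of_nat k - M) v * (sf x v / sf (L + M + 1 + t - of_nat j) v))"

text \<open>The matrices \<open>w\<^sub>1 R\<^sub>1\<close> and \<open>w\<^sub>2 R\<^sub>2\<close> of the theorem, without their powers of \<open>q\<close>.\<close>
definition entry1 :: "nat \<Rightarrow> nat \<Rightarrow> complex" where
  "entry1 l j = (- 1) ^ l * sf 1 l * weight1 l / sf (M + 2 - of_nat N - w - t + of_nat j) l * series1 l j"

definition entry2 :: "nat \<Rightarrow> nat \<Rightarrow> complex" where
  "entry2 k j = (- 1) ^ k * sf 1 k / sf (M + t + of_nat j) k * series2 k j"

text \<open>Where \<open>(d)\<^sub>l\<close> does not vanish, the last denominator can be cleared as well, and the sum may be extended
  to \<open>v \<le> l\<close> because of the parameter \<open>- j\<close>.\<close>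
lemma cleared_series:
  assumes d: "a + 1 - x = d" and dl: "sf d l \<noteq> 0"
  shows "(\<Sum>v\<le>min l j. vcoef a l v * wpair a l (- of_nat j) v * wpair a l y1 v * wpair a l y2 v * wpair a l y3 v
      * wpair a l y4 v * (sf x v / sf d v)) = vwp_sum a [x, - of_nat j, y1, y2, y3, y4] l / sf d l"
proof -
  have "(\<Sum>v\<le>min l j. vcoef a l v * wpair a l (- of_nat j) v * wpair a l y1 v * wpair a l y2 v * wpair a l y3 v
      * wpair a l y4 v * (sf x v / sf d v))
    = (\<Sum>v\<le>min l j. vcoef a l v * (\<Prod>y\<leftarrow>[x, - of_nat j, y1, y2, y3, y4]. wpair a l y v) / sf d l)"
  proof (rule sum.cong[OF refl])
    fix v assume "v \<in> {..min l j}"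
    then have "wpair a l x v = sf x v / sf d v * sf d l"
      using wpair_quotient[of a x l v] dl by (simp add: d)
    then show "vcoef a l v * wpair a l (- of_nat j) v * wpair a l y1 v * wpair a l y2 v * wpair a l y3 v
        * wpair a l y4 v * (sf x v / sf d v)
      = vcoef a l v * (\<Prod>y\<leftarrow>[x, - of_nat j, y1, y2, y3, y4]. wpair a l y v) / sf d l"
      using dl by simp
  qed
  also have "\<dots> = (\<Sum>v\<le>l. vcoef a l v * (\<Prod>y\<leftarrow>[x, - of_nat j, y1, y2, y3, y4]. wpair a l y v) / sf d l)"
  proof (rule sum.mono_neutral_left)
    have "wpair a l (- of_nat j) v = 0" if "j < v" for v
      using sf_neg_zero[OF that] by (simp add: wpair_def)
    then show "\<forall>v\<in>{..l} - {..min l j}.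
        vcoef a l v * (\<Prod>y\<leftarrow>[x, - of_nat j, y1, y2, y3, y4]. wpair a l y v) / sf d l = 0"
      by auto
  qed auto
  finally show ?thesis by (simp only: vwp_sum_def sum_divide_distrib)
qed

text \<open>In \<open>bailey_twice\<close> the parameter \<open>x\<close> takes the role of \<open>R\<close> and the terminating parameter \<open>- j\<close> that of
  \<open>p\<close>. The new first parameter \<open>M + 1 - N - w - t\<close> depends neither on \<open>l\<close> nor on \<open>j\<close>, and each new parameter
  depends on at most one of them; so the terms factor.\<close>
lemma entry1_expand:
  assumes g: "generic L M w t"
  shows "entry1 l j = (\<Sum>s\<le>l. alpha l s * phi N L M w t s j)"
proof -
  note nzs = genericD[OF g]
  define a where "a = L - 2 * of_nat j - of_nat l + 1"
  define x where "x = t + w + of_nat N - of_nat j - of_nat l - 1 - M"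
  define a0 where "a0 = M + 1 - of_nat N - w - t"
  define d where "d = L + M + 3 - of_nat N - w - t - of_nat j"
  define c where "c = M + 2 - of_nat N - w - t + of_nat j"
  have dl: "sf d m \<noteq> 0" for m by (rule nz_sf'[OF nzs(10)]) (simp add: d_def)
  have cl: "sf c m \<noteq> 0" for m by (rule nz_sf'[OF nzs(8)]) (simp add: c_def)
  have d: "a + 1 - x = d" by (simp add: a_def x_def d_def)
  have "series1 l j = vwp_sum a [x, - of_nat j, L - of_nat N - of_nat j + 1, L + M + 1 - of_nat j - w,
       L + M + 2 - of_nat j, 2 - of_nat j - of_nat l - M - t] l / sf d l"
    unfolding series1_def Let_def a_def[symmetric] x_def[symmetric] d_def[symmetric]
    by (rule cleared_series[OF d dl])
  also have "vwp_sum a [x, - of_nat j, L - of_nat N - of_nat j + 1, L + M + 1 - of_nat j - w,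
       L + M + 2 - of_nat j, 2 - of_nat j - of_nat l - M - t] l
    = vwp_sum a [x, - of_nat j, L - of_nat N - of_nat j + 1,
       2 - of_nat j - of_nat l - M - t, L + M + 1 - of_nat j - w, L + M + 2 - of_nat j] l"
    by (rule vwp_sum_perm) simp
  also have "vwp_sum a [x, - of_nat j, L - of_nat N - of_nat j + 1,
       2 - of_nat j - of_nat l - M - t, L + M + 1 - of_nat j - w, L + M + 2 - of_nat j] l
    = vwp_sum (- of_nat j - of_nat l - x) [- of_nat j, - of_nat j - of_nat l - a,
        a + 1 - x - (L - of_nat N - of_nat j + 1), a + 1 - x - (2 - of_nat j - of_nat l - M - t),
        a + 1 - x - (L + M + 1 - of_nat j - w), a + 1 - x - (L + M + 2 - of_nat j)] l"
  proof (rule bailey_twice)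
    show "x + - of_nat j + (L - of_nat N - of_nat j + 1) + (2 - of_nat j - of_nat l - M - t)
       + (L + M + 1 - of_nat j - w) + (L + M + 2 - of_nat j) = 3 * a + 2 + of_nat l"
      by (simp add: x_def a_def)
    show "regular a l" by (rule nz_regular[OF nzs(1)]) (simp add: a_def)
    show "regular (2 * a + 1 - x - (L - of_nat N - of_nat j + 1) - (2 - of_nat j - of_nat l - M - t)) l"
      by (rule nz_regular[OF nzs(6)]) (simp add: a_def x_def)
    show "regular (- of_nat j - of_nat l - x) l"
      by (rule nz_regular'[OF nzs(8)]) (simp add: x_def)
  qed
  also have "\<dots> = vwp_sum a0 [- of_nat j, of_nat j - 1 - L, M + 2 - t - w,
      L + 2 * M + 1 - of_nat N - w + of_nat l, 2 - of_nat N - t, 1 - of_nat N - t - w] l"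
    by (rule arg_cong2[where f = "\<lambda>u v. vwp_sum u v l"]) (simp_all add: a0_def x_def a_def)
  finally have ser: "series1 l j = \<dots> / sf d l" .
  show ?thesis
    unfolding entry1_def ser vwp_sum_def sum_divide_distrib sum_distrib_left
  proof (rule sum.cong[OF refl])
    fix s assume "s \<in> {..l}"
    then have s: "s \<le> l" by simp
    have 1: "wpair a0 l (- of_nat j) s = sf (- of_nat j) s / sf c s * sf c l"
    proof -
      have "a0 + 1 - - of_nat j = c" by (simp add: a0_def c_def)
      then show ?thesis using wpair_quotient[of a0 "- of_nat j" l s] s cl[of l] by simp
    qed
    have 2: "wpair a0 l (of_nat j - 1 - L) s = sf (of_nat j - 1 - L) s / sf d s * sf d l"
    proof -
      have "a0 + 1 - (of_nat j - 1 - L) = d" by (simp add: a0_def d_def)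
      then show ?thesis using wpair_quotient[of a0 "of_nat j - 1 - L" l s] s dl[of l] by simp
    qed
    show "(- 1) ^ l * sf 1 l * weight1 l / sf (M + 2 - of_nat N - w - t + of_nat j) l
        * (vcoef a0 l s * (\<Prod>y\<leftarrow>[- of_nat j, of_nat j - 1 - L, M + 2 - t - w,
          L + 2 * M + 1 - of_nat N - w + of_nat l, 2 - of_nat N - t, 1 - of_nat N - t - w]. wpair a0 l y s) / sf d l)
      = alpha l s * phi N L M w t s j"
      unfolding alpha_def phi_def Let_def a0_def[symmetric] c_def[symmetric] d_def[symmetric]
      using dl[of l] cl[of l] by (simp add: 1 2 mult_div_ac)
  qed
qed

text \<open>Here \<open>p\<close> is \<open>L + M + 2 - j\<close>. With \<open>p = - j\<close> the new functions of \<open>j\<close> would, like \<open>phi\<close>, cut off an initial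
  part of the series, and their products with \<open>phi\<close> could not be summed in closed form; with this choice
  they only shift parameters of \<open>jweight\<close>.\<close>
lemma entry2_expand:
  assumes g: "generic L M w t"
  shows "entry2 k j = (\<Sum>r\<le>k. beta k r * chi L M t r j)"
proof -
  note nzs = genericD[OF g]
  define a where "a = L - 2 * of_nat j - of_nat k + 1"
  define x where "x = 1 - of_nat j - of_nat k - M - t"
  define a0 where "a0 = L + 2 * M + 1 + t"
  define d where "d = L + M + 1 + t - of_nat j"
  define c where "c = M + t + of_nat j"
  have dl: "sf d m \<noteq> 0" for m by (rule nz_sf[OF nzs(9)]) (simp add: d_def)
  have cl: "sf c m \<noteq> 0" for m by (rule nz_sf[OF nzs(7)]) (simp add: c_def)
  have d: "a + 1 - x = d" by (simp add: a_def x_def d_def)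
  have "series2 k j = vwp_sum a [x, - of_nat j, L - of_nat N - of_nat j + 1, L + M + 1 - of_nat j - w,
       L + M + 2 - of_nat j, t + w + of_nat N - of_nat j - of_nat k - M] k / sf d k"
    unfolding series2_def Let_def a_def[symmetric] x_def[symmetric] d_def[symmetric]
    by (rule cleared_series[OF d dl])
  also have "vwp_sum a [x, - of_nat j, L - of_nat N - of_nat j + 1, L + M + 1 - of_nat j - w,
       L + M + 2 - of_nat j, t + w + of_nat N - of_nat j - of_nat k - M] k
    = vwp_sum a [x, L + M + 2 - of_nat j, L - of_nat N - of_nat j + 1,
       L + M + 1 - of_nat j - w, - of_nat j, t + w + of_nat N - of_nat j - of_nat k - M] k"
    by (rule vwp_sum_perm) simp
  also have "vwp_sum a [x, L + M + 2 - of_nat j, L - of_nat N - of_nat j + 1,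
       L + M + 1 - of_nat j - w, - of_nat j, t + w + of_nat N - of_nat j - of_nat k - M] k
    = vwp_sum (L + M + 2 - of_nat j - of_nat k - x) [L + M + 2 - of_nat j, L + M + 2 - of_nat j - of_nat k - a,
        a + 1 - x - (L - of_nat N - of_nat j + 1), a + 1 - x - (L + M + 1 - of_nat j - w),
        a + 1 - x - (- of_nat j), a + 1 - x - (t + w + of_nat N - of_nat j - of_nat k - M)] k"
  proof (rule bailey_twice)
    show "x + (L + M + 2 - of_nat j) + (L - of_nat N - of_nat j + 1) + (L + M + 1 - of_nat j - w)
       + - of_nat j + (t + w + of_nat N - of_nat j - of_nat k - M) = 3 * a + 2 + of_nat k"
      by (simp add: x_def a_def)
    show "regular a k" by (rule nz_regular[OF nzs(1)]) (simp add: a_def)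
    show "regular (2 * a + 1 - x - (L - of_nat N - of_nat j + 1) - (L + M + 1 - of_nat j - w)) k"
      by (rule nz_regular[OF nzs(12)]) (simp add: a_def x_def)
    show "regular (L + M + 2 - of_nat j - of_nat k - x) k"
      by (rule nz_regular[OF nzs(13)]) (simp add: x_def)
  qed
  also have "\<dots> = vwp_sum a0 [L + M + 2 - of_nat j, M + 1 + of_nat j, M + of_nat N + t, t + w,
      L + M + t + 1, L + 2 * M + 1 - of_nat N - w + of_nat k] k"
    by (rule arg_cong2[where f = "\<lambda>u v. vwp_sum u v k"]) (simp_all add: a0_def x_def a_def)
  finally have ser: "series2 k j = \<dots> / sf d k" .
  show ?thesis
    unfolding entry2_def ser vwp_sum_def sum_divide_distrib sum_distrib_left
  proof (rule sum.cong[OF refl])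
    fix s assume "s \<in> {..k}"
    then have s: "s \<le> k" by simp
    have 1: "wpair a0 k (L + M + 2 - of_nat j) s = sf (L + M + 2 - of_nat j) s / sf c s * sf c k"
    proof -
      have "a0 + 1 - (L + M + 2 - of_nat j) = c" by (simp add: a0_def c_def)
      then show ?thesis using wpair_quotient[of a0 "L + M + 2 - of_nat j" k s] s cl[of k] by simp
    qed
    have 2: "wpair a0 k (M + 1 + of_nat j) s = sf (M + 1 + of_nat j) s / sf d s * sf d k"
    proof -
      have "a0 + 1 - (M + 1 + of_nat j) = d" by (simp add: a0_def d_def)
      then show ?thesis using wpair_quotient[of a0 "M + 1 + of_nat j" k s] s dl[of k] by simp
    qed
    show "(- 1) ^ k * sf 1 k / sf (M + t + of_nat j) k
        * (vcoef a0 k s * (\<Prod>y\<leftarrow>[L + M + 2 - of_nat j, M + 1 + of_nat j, M + of_nat N + t, t + w,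
      L + M + t + 1, L + 2 * M + 1 - of_nat N - w + of_nat k]. wpair a0 k y s) / sf d k)
      = beta k s * chi L M t s j"
      unfolding beta_def chi_def Let_def a0_def[symmetric] c_def[symmetric] d_def[symmetric]
      using dl[of k] cl[of k] by (simp add: 1 2 mult_div_ac)
  qed
qed

theorem generic_biorthogonality:
  assumes g: "generic L M w t" and k: "k \<le> N" and l: "l \<le> N"
  shows "(\<Sum>j\<le>N. entry1 l j * entry2 k j * jweight N L M w t j) = (if k = l then 1 else 0)"
proof -
  have "(\<Sum>j\<le>N. entry1 l j * entry2 k j * jweight N L M w t j)
    = (\<Sum>j\<le>N. \<Sum>s\<le>l. \<Sum>r\<le>k. alpha l s * (beta k r * (jweight N L M w t j * phi N L M w t s j * chi L M t r j)))"
    unfolding entry1_expand[OF g] entry2_expand[OF g] sum_product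
    unfolding sum_distrib_right
    by (intro sum.cong refl) (simp only: mult_ac)
  also have "\<dots> = (\<Sum>s\<le>l. \<Sum>r\<le>k. \<Sum>j\<le>N. alpha l s * (beta k r * (jweight N L M w t j * phi N L M w t s j * chi L M t r j)))"
    by (subst sum.swap) (intro sum.cong refl sum.swap)
  also have "\<dots> = (\<Sum>s\<le>l. alpha l s * (\<Sum>r\<le>k. beta k r * gram N L M w t s r))"
  proof (rule sum.cong[OF refl])
    fix s assume "s \<in> {..l}"
    then have "s \<le> N" using l by simp
    then show "(\<Sum>r\<le>k. \<Sum>j\<le>N. alpha l s * (beta k r * (jweight N L M w t j * phi N L M w t s j * chi L M t r j)))
      = alpha l s * (\<Sum>r\<le>k. beta k r * gram N L M w t s r)"
      by (simp add: sum_jweight_phi_chi[OF g, symmetric] sum_distrib_left)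
  qed
  also have "\<dots> = (\<Sum>s\<le>l. alpha l s * gram2 s k)"
    using sum_beta_gram[OF g _ k] l by (intro sum.cong) auto
  also have "\<dots> = (if k = l then 1 else 0)" by (rule sum_alpha_gram2[OF g l k])
  finally show ?thesis .
qed

end
end

section \<open>Exceptional parameters by continuity\<close>

locale continuous_sigma_function = sigma_function +
  assumes isCont_sg: "isCont sg x"
    and countable_zeros: "countable {x. sg x = 0}"
begin

lemma isCont_sg_o: "isCont f z \<Longrightarrow> isCont (\<lambda>v. sg (f v)) z"
  by (rule isCont_o2[OF _ isCont_sg])

lemma isCont_sf_o: "isCont f z \<Longrightarrow> isCont (\<lambda>v. sf (f v) n) z"
  unfolding sf_def by (intro continuous_prod isCont_sg_o continuous_intros)

lemma countable_not_nz:
  assumes "d \<noteq> 0"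
  shows "countable {e :: real. \<not> nz (c + of_real e * of_real d)}"
proof -
  have "countable {e :: real. sg (c + of_real e * of_real d + of_int i) = 0}" for i
  proof (rule countable_image_inj_on)
    show "inj_on (\<lambda>e :: real. c + of_real e * of_real d + of_int i)
        {e :: real. sg (c + of_real e * of_real d + of_int i) = 0}"
      using assms by (auto simp: inj_on_def)
    show "countable ((\<lambda>e :: real. c + of_real e * of_real d + of_int i) `
        {e :: real. sg (c + of_real e * of_real d + of_int i) = 0})"
      by (rule countable_subset[OF _ countable_zeros]) auto
  qed
  then have "countable (\<Union>i. {e :: real. sg (c + of_real e * of_real d + of_int i) = 0})"
    by (intro countable_UN) auto
  moreover have "{e :: real. \<not> nz (c + of_real e * of_real d)}
      = (\<Union>i. {e :: real. sg (c + of_real e * of_real d + of_int i) = 0})"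
    by (auto simp: nz_def)
  ultimately show ?thesis by simp
qed

text \<open>The linear forms in \<open>generic\<close> take nonzero values at \<open>(1, 10, 100, 1000)\<close>. Hence each of them meets the
  countable set of zeros for countably many points of the line only.\<close>
lemma countable_not_generic:
  "countable {e :: real. \<not> generic (L + of_real e) (M + 10 * of_real e) (w + 100 * of_real e) (t + 1000 * of_real e)}"
proof -
  define B where "B = (\<lambda>c d. {e :: real. \<not> nz (c + of_real e * of_real d)})"
  have *: "generic (L + of_real e) (M + 10 * of_real e) (w + 100 * of_real e) (t + 1000 * of_real e)"
    if "e \<notin> B L 1 \<union> B M 10 \<union> B (M - w) (- 90) \<union> B (L + M) 11 \<union> B (L + M - w) (- 89)
      \<union> B (L + 2 * M - w) (- 79) \<union> B (M + t) 1010 \<union> B (t + w - M) 1090 \<union> B (L + M + t) 1011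
      \<union> B (t + w - L - M) 1089 \<union> B t 1000 \<union> B (t + w) 1100 \<union> B (L + 2 * M + t) 1021" for e
    using that unfolding B_def generic_def by (simp add: algebra_simps)
  have "countable (B L 1 \<union> B M 10 \<union> B (M - w) (- 90) \<union> B (L + M) 11 \<union> B (L + M - w) (- 89)
      \<union> B (L + 2 * M - w) (- 79) \<union> B (M + t) 1010 \<union> B (t + w - M) 1090 \<union> B (L + M + t) 1011
      \<union> B (t + w - L - M) 1089 \<union> B t 1000 \<union> B (t + w) 1100 \<union> B (L + 2 * M + t) 1021)"
    unfolding B_def by (intro countable_Un countable_not_nz) simp_all
  then show ?thesis by (rule countable_subset[rotated]) (use * in blast)
qed

text \<open>The denominators of the original matrices and of \<open>jweight\<close>, as far as they occur in the terms
  \<open>v \<le> min l j\<close> of the series.\<close>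
definition admissible :: "nat \<Rightarrow> complex \<Rightarrow> complex \<Rightarrow> complex \<Rightarrow> complex \<Rightarrow> bool" where
  "admissible N L M w t \<longleftrightarrow>
    sg (- L - 1) \<noteq> 0 \<and> sg (L + 2 * M + 1 - of_nat N - w) \<noteq> 0 \<and>
    sf (w - L - 2 * M - 1) N \<noteq> 0 \<and> sf (- L) N \<noteq> 0 \<and> sf (t + w) N \<noteq> 0 \<and> sf (t - 1) N \<noteq> 0 \<and>
    sf (t + M) N \<noteq> 0 \<and> sf (t + w - M - 1) N \<noteq> 0 \<and>
    (\<forall>n\<le>N. sf (- L - M - 1) n \<noteq> 0 \<and> sf (of_nat N - L) n \<noteq> 0 \<and> sf (w - L - M) n \<noteq> 0 \<and>
      sf (M + t) n \<noteq> 0 \<and> sf (M + 2 - of_nat N - w - t) n \<noteq> 0 \<and>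
      sf (L - w + 2 * M + 2) n \<noteq> 0 \<and> sf (L - of_nat N + M + 2) n \<noteq> 0 \<and> sf (M + 1) n \<noteq> 0 \<and>
      sf (- of_nat N) n \<noteq> 0 \<and> sf (M - w) n \<noteq> 0 \<and> sf (L - of_nat N - w + M + 1) n \<noteq> 0) \<and>
    (\<forall>l\<le>N. \<forall>j\<le>N. sf (M + 2 - of_nat N - w - t + of_nat j) l \<noteq> 0 \<and> sf (M + t + of_nat j) l \<noteq> 0 \<and>
      sf (L - 2 * of_nat j - of_nat l + 1 + 1) l \<noteq> 0 \<and>
      (\<forall>v\<le>min l j. sf (L - 2 * of_nat j - of_nat l + 1 + of_nat l + 1) v \<noteq> 0 \<and>
        sf (L + M + 3 - of_nat N - w - t - of_nat j) v \<noteq> 0 \<and> sf (L + M + 1 + t - of_nat j) v \<noteq> 0))"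

text \<open>The \<open>n + 1\<close> factors starting at \<open>a + v\<close> are among the \<open>n + v\<close> factors starting at \<open>a + 1\<close>.\<close>
lemma vwp_denominator_nz:
  assumes "sf (a + 1) n \<noteq> 0" "sf (a + of_nat n + 1) v \<noteq> 0" "v > 0"
  shows "sf (a + of_nat v) (n + 1) \<noteq> 0"
proof -
  have "sf (a + 1) (n + v) \<noteq> 0"
    unfolding sf_add using assms by (simp add: add_ac)
  moreover have "sf (a + 1) (n + v) = sf (a + 1) (v - 1) * sf (a + of_nat v) (n + 1)"
    using sf_add[of "a + 1" "v - 1" "n + 1"] assms(3) by (simp add: of_nat_diff algebra_simps)
  ultimately show ?thesis by auto
qed

lemma isCont_vwp:
  assumes "isCont f z" "sf (f z + 1) n \<noteq> 0" "sf (f z + of_nat n + 1) s \<noteq> 0"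
  shows "isCont (\<lambda>v. vwp (f v) n s) z"
proof (cases "s = 0")
  case True
  then show ?thesis unfolding vwp_def using assms
    by (simp add: isCont_sf_o continuous_intros)
next
  case False
  then show ?thesis
    unfolding vwp_def using assms vwp_denominator_nz[OF assms(2,3)]
    by (auto intro!: continuous_intros isCont_divide isCont_sf_o isCont_sg_o)
qed

lemma isCont_vcoef:
  assumes "isCont f z" "sf (f z + 1) n \<noteq> 0" "sf (f z + of_nat n + 1) s \<noteq> 0"
  shows "isCont (\<lambda>v. vcoef (f v) n s) z"
  unfolding vcoef_def by (intro continuous_intros isCont_divide isCont_vwp assms) simp_all

lemma isCont_wpair:
  assumes "isCont f z" "isCont g z"
  shows "isCont (\<lambda>v. wpair (f v) n (g v) s) z"
  unfolding wpair_def by (intro continuous_intros isCont_sf_o assms)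

lemmas cont_rules = continuous_intros isCont_divide isCont_sf_o isCont_sg_o isCont_wpair isCont_vcoef

lemma isCont_entry1:
  assumes ad: "admissible N (L z) (M z) (w z) (t z)" and jl: "l \<le> N" "j \<le> N"
    and c: "isCont L z" "isCont M z" "isCont w z" "isCont t z"
  shows "isCont (\<lambda>v. entry1 N (L v) (M v) (w v) (t v) l j) z"
proof -
  have "isCont (\<lambda>v. series1 N (L v) (M v) (w v) (t v) l j) z"
    unfolding series1_def Let_def
    by (intro cont_rules c) (use ad jl in \<open>auto simp: admissible_def\<close>)
  moreover have "isCont (\<lambda>v. weight1 N (L v) (M v) (w v) l) z"
    unfolding weight1_def by (intro cont_rules c) (use ad jl in \<open>auto simp: admissible_def\<close>)
  ultimately show ?thesis unfolding entry1_def
    by (intro cont_rules c) (use ad jl in \<open>auto simp: admissible_def\<close>)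
qed

lemma isCont_entry2:
  assumes ad: "admissible N (L z) (M z) (w z) (t z)" and jl: "l \<le> N" "j \<le> N"
    and c: "isCont L z" "isCont M z" "isCont w z" "isCont t z"
  shows "isCont (\<lambda>v. entry2 N (L v) (M v) (w v) (t v) l j) z"
proof -
  have "isCont (\<lambda>v. series2 N (L v) (M v) (w v) (t v) l j) z"
    unfolding series2_def Let_def
    by (intro cont_rules c) (use ad jl in \<open>auto simp: admissible_def\<close>)
  then show ?thesis unfolding entry2_def
    by (intro cont_rules c) (use ad jl in \<open>auto simp: admissible_def\<close>)
qed

lemma isCont_jweight:
  assumes ad: "admissible N (L z) (M z) (w z) (t z)" and j: "j \<le> N"
    and c: "isCont L z" "isCont M z" "isCont w z" "isCont t z"
  shows "isCont (\<lambda>v. jweight N (L v) (M v) (w v) (t v) j) z"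
  unfolding jweight_def jnorm_def
  by (intro cont_rules c) (use ad j in \<open>auto simp: admissible_def\<close>)

text \<open>On the line through the parameters in direction \<open>(1, 10, 100, 1000)\<close> the sum is continuous at the given
  point and constant on a sequence of generic points converging to it.\<close>
theorem biorthogonality:
  assumes ad: "admissible N L M w t" and k: "k \<le> N" and l: "l \<le> N"
  shows "(\<Sum>j\<le>N. entry1 N L M w t l j * entry2 N L M w t k j * jweight N L M w t j) = (if k = l then 1 else 0)"
proof -
  define F where "F = (\<lambda>v. \<Sum>j\<le>N. entry1 N (L + v) (M + 10 * v) (w + 100 * v) (t + 1000 * v) l j
     * entry2 N (L + v) (M + 10 * v) (w + 100 * v) (t + 1000 * v) k j
     * jweight N (L + v) (M + 10 * v) (w + 100 * v) (t + 1000 * v) j)"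
  have cont: "isCont F 0"
    unfolding F_def
    by (intro continuous_intros isCont_entry1 isCont_entry2 isCont_jweight) (use ad k l in auto)
  have "\<exists>e. 0 < e \<and> e < inverse (real (Suc n)) \<and>
      generic (L + of_real e) (M + 10 * of_real e) (w + 100 * of_real e) (t + 1000 * of_real e)" for n
  proof (rule ccontr)
    assume "\<not> ?thesis"
    then have "{0<..<inverse (real (Suc n))} \<subseteq>
      {e. \<not> generic (L + of_real e) (M + 10 * of_real e) (w + 100 * of_real e) (t + 1000 * of_real e)}"
      by auto
    then have "countable {0<..<inverse (real (Suc n))}"
      using countable_not_generic by (rule countable_subset)
    then show False using uncountable_open_interval[of 0 "inverse (real (Suc n))"] by simp
  qed
  then obtain e where e: "\<And>n. 0 < e n" "\<And>n. e n < inverse (real (Suc n))"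
      "\<And>n. generic (L + of_real (e n)) (M + 10 * of_real (e n)) (w + 100 * of_real (e n)) (t + 1000 * of_real (e n))"
    by metis
  have "e \<longlonglongrightarrow> 0"
    by (rule tendsto_sandwich[of "\<lambda>_. 0" _ _ "\<lambda>n. inverse (real (Suc n))"])
       (use e in \<open>auto intro: less_imp_le always_eventually LIMSEQ_inverse_real_of_nat simp del: of_nat_Suc\<close>)
  then have "(\<lambda>n. complex_of_real (e n)) \<longlonglongrightarrow> 0"
    using tendsto_of_real by fastforce
  then have "(\<lambda>n. F (of_real (e n))) \<longlonglongrightarrow> F 0"
    by (rule isCont_tendsto_compose[OF cont])
  moreover have "F (of_real (e n)) = (if k = l then 1 else 0)" for n
    unfolding F_def by (rule generic_biorthogonality[OF e(3) k l])
  ultimately have "F 0 = (if k = l then 1 else 0)"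
    by (simp add: LIMSEQ_const_iff)
  then show ?thesis by (simp add: F_def)
qed

end

section \<open>The symmetrized theta function\<close>

text \<open>The polynomial \<open>X\<^sup>m - Y\<^sup>n\<close> does not vanish at \<open>(x, y)\<close>. For \<open>x = p\<close>, \<open>y = q\<close> this keeps \<open>q\<^bsup>2n\<^esup>\<close> off the
  zeros of the theta function.\<close>
lemma alg_independent_power_neq:
  assumes "alg_independent2 x y" "m > 0 \<or> n > 0"
  shows "x ^ m \<noteq> y ^ n"
proof
  assume eq: "x ^ m = y ^ n"
  define c where "c = (\<lambda>i j. if i = m \<and> j = 0 then (if m = 0 \<and> n = 0 then 0 else 1) else if i = 0 \<and> j = n then - 1 else (0 :: rat))"
  define d where "d = max m n"
  have "(\<Sum>i\<le>d. \<Sum>j\<le>d. of_rat (c i j) * x ^ i * y ^ j)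
      = (\<Sum>i\<le>d. \<Sum>j\<le>d. (if i = m \<and> j = 0 then x ^ m else 0) - (if i = 0 \<and> j = n then y ^ n else 0))"
    using assms(2) by (intro sum.cong refl) (auto simp: c_def)
  also have "\<dots> = (\<Sum>i\<le>d. if i = m then x ^ m else 0) - (\<Sum>i\<le>d. if i = 0 then y ^ n else 0)"
    unfolding sum_subtractf by (intro arg_cong2[where f = minus] sum.cong refl) (auto simp: d_def)
  also have "\<dots> = 0" by (simp add: eq d_def)
  finally have "\<forall>i\<le>d. \<forall>j\<le>d. c i j = 0"
    using assms(1) unfolding alg_independent2_def by blast
  then have "c m 0 = 0" by (simp add: d_def)
  then show False using assms(2) by (auto simp: c_def split: if_splits)
qed

text \<open>The factor \<open>q\<^bsup>-x\<^esup>\<close> makes the function odd and removes the powers from the three-term relation.\<close>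
definition esigma :: "real \<Rightarrow> real \<Rightarrow> complex \<Rightarrow> complex" where
  "esigma p q x = qpow q (- x) * etheta p (qpow q (2 * x))"

context
  fixes p q :: real
  assumes p: "0 < p" "p < 1" and q: "0 < q" "q < 1"
begin

lemma q_nz [simp]: "q \<noteq> 0"
  using q by simp

lemma qpow_exp: "qpow q x = exp (x * of_real (ln q))"
  using q by (simp add: powr_def Ln_of_real mult.commute)

lemma qpow_nz [simp]: "qpow q x \<noteq> 0"
  using q by (simp add: powr_def)

lemma qpow_add: "qpow q (x + y) = qpow q x * qpow q y"
  by (simp add: powr_add)

lemma qpow_minus: "qpow q (- x) = 1 / qpow q x"
  by (simp add: powr_minus divide_inverse)

lemma qpow_diff: "qpow q (x - y) = qpow q x / qpow q y"
  by (simp add: powr_diff)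

lemma qpow_of_nat: "qpow q (of_nat n) = of_real q ^ n"
  using q by (simp add: powr_nat')

lemma etheta_qpow: "etheta p (qpow q (2 * x)) = qpow q x * esigma p q x"
  by (simp add: esigma_def qpow_minus)

lemma countable_qpow_eq: "countable {x. qpow q (2 * x) = c}"
proof (cases "c = 0")
  case False
  have lq: "complex_of_real (ln q) \<noteq> 0" using q by simp
  have "{x. qpow q (2 * x) = c} \<subseteq> range (\<lambda>n::int. (Ln c + of_int (2 * n) * pi * \<i>) / (2 * of_real (ln q)))"
  proof
    fix x assume "x \<in> {x. qpow q (2 * x) = c}"
    then have "exp (2 * x * of_real (ln q)) = exp (Ln c)" using False by (simp add: qpow_exp)
    then obtain n :: int where "2 * x * of_real (ln q) = Ln c + of_int (2 * n) * pi * \<i>"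
      unfolding exp_eq by (auto simp: mult_ac)
    then have "x = (Ln c + of_int (2 * n) * pi * \<i>) / (2 * of_real (ln q))"
      using lq by (simp add: field_simps)
    then show "x \<in> range (\<lambda>n::int. (Ln c + of_int (2 * n) * pi * \<i>) / (2 * of_real (ln q)))" by blast
  qed
  then show ?thesis by (rule countable_subset) simp
qed simp

lemma countable_esigma_zeros: "countable {x. esigma p q x = 0}"
proof -
  have "{x. esigma p q x = 0} \<subseteq> (\<Union>j. {x. qpow q (2 * x) = 1 / of_real p ^ j}) \<union> (\<Union>j. {x. qpow q (2 * x) = of_real p ^ Suc j})"
  proof
    fix x assume "x \<in> {x. esigma p q x = 0}"
    then have "etheta p (qpow q (2 * x)) = 0" by (simp add: esigma_def)
    then obtain j where "qpow q (2 * x) * of_real p ^ j = 1 \<or> qpow q (2 * x) = of_real p ^ Suc j"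
      using etheta_zero_iff[OF p qpow_nz] by blast
    then show "x \<in> (\<Union>j. {x. qpow q (2 * x) = 1 / of_real p ^ j}) \<union> (\<Union>j. {x. qpow q (2 * x) = of_real p ^ Suc j})"
      using p by (auto simp: field_simps)
  qed
  then show ?thesis
    by (rule countable_subset) (intro countable_Un countable_UN countable_qpow_eq; simp)
qed

lemma isCont_esigma: "isCont (esigma p q) x"
proof -
  have c: "isCont (\<lambda>x. qpow q (a * x)) y" for a y
    unfolding qpow_exp by (intro continuous_intros)
  have "isCont (\<lambda>x. etheta p (qpow q (2 * x))) x"
    by (rule isCont_o2[OF c isCont_etheta[OF p]]) simp
  with c[where a = "- 1" and y = x] show ?thesis
    unfolding esigma_def[abs_def] by (intro continuous_mult) simp_all
qed

lemma esigma_minus: "esigma p q (- x) = - esigma p q x"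
proof -
  have "2 * - x = - (2 * x)" by simp
  then have "etheta p (qpow q (2 * - x)) = - etheta p (qpow q (2 * x)) / qpow q (2 * x)"
    using etheta_inverse[OF p, of "qpow q (2 * x)"] by (simp only: qpow_minus qpow_nz simp_thms)
  then have "esigma p q (- x) = qpow q x * (- etheta p (qpow q (2 * x)) / qpow q (2 * x))"
    by (simp only: esigma_def minus_minus)
  also have "qpow q (2 * x) = qpow q x * qpow q x" by (simp only: mult_2 qpow_add)
  finally show ?thesis unfolding esigma_def qpow_minus mult_2 qpow_add by simp
qed

text \<open>Multiplication by \<open>q\<^bsup>-2x\<^esup>\<close> removes the factor in front of the determinant.\<close>
lemma esigma_determinant:
  obtains u v where "\<And>x y. esigma p q (x + y) * esigma p q (x - y) = u x * v y - v x * u y"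
proof -
  define C where "C = complex_of_real (qlim p)"
  define X where "X = (\<lambda>x. qpow q (2 * x))"
  define u where "u = (\<lambda>x. infsum (thalf1 p (X x)) UNIV / C)"
  define v where "v = (\<lambda>x. infsum (thalf0 p (X x)) UNIV / C)"
  have C: "C \<noteq> 0" using qlim_pos[OF p] by (simp add: C_def)
  have X: "X x \<noteq> 0" for x by (simp add: X_def)
  have "esigma p q (x + y) * esigma p q (x - y) = u x * v y - v x * u y" for x y
  proof -
    have XX: "qpow q (2 * (x + y)) = X x * X y" "qpow q (2 * (x - y)) = X x / X y"
      unfolding X_def distrib_left right_diff_distrib by (rule qpow_add qpow_diff)+
    have "qpow q (- (x + y)) * qpow q (- (x - y)) = qpow q (- (x + y) + - (x - y))"
      by (rule qpow_add[symmetric])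
    also have "- (x + y) + - (x - y) = - (2 * x)" by simp
    finally have qq: "qpow q (- (x + y)) * qpow q (- (x - y)) = 1 / X x"
      by (simp only: qpow_minus X_def)
    define R where "R = infsum (thalf1 p (X x)) UNIV * infsum (thalf0 p (X y)) UNIV
        - infsum (thalf0 p (X x)) UNIV * infsum (thalf1 p (X y)) UNIV"
    have "C\<^sup>2 * (etheta p (X x * X y) * etheta p (X x / X y)) = X x * R"
      unfolding C_def R_def by (rule etheta_determinant[OF p X X])
    then have T: "etheta p (X x * X y) * etheta p (X x / X y) = X x * R / C\<^sup>2"
      using C by (simp add: nonzero_eq_divide_eq mult.commute)
    have "esigma p q (x + y) * esigma p q (x - y) = (qpow q (- (x + y)) * qpow q (- (x - y)))
        * (etheta p (X x * X y) * etheta p (X x / X y))"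
      unfolding esigma_def XX by (simp only: mult_ac)
    also have "\<dots> = R / C\<^sup>2" unfolding qq T using X[of x] by simp
    finally show ?thesis
      by (simp add: R_def u_def v_def power2_eq_square diff_divide_distrib)
  qed
  then show thesis by (rule that)
qed

lemma sigma_function_esigma:
  assumes "alg_independent2 p q"
  shows "sigma_function (esigma p q)"
proof
  show "esigma p q (- x) = - esigma p q x" for x by (rule esigma_minus)
  show "esigma p q (x + y) * esigma p q (x - y) * esigma p q (u + v) * esigma p q (u - v) =
      esigma p q (x + u) * esigma p q (x - u) * esigma p q (y + v) * esigma p q (y - v)
      + esigma p q (x + v) * esigma p q (x - v) * esigma p q (u + y) * esigma p q (u - y)" for x y u v
  proof -
    obtain f g where fg: "\<And>x y. esigma p q (x + y) * esigma p q (x - y) = f x * g y - g x * f y"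
      using esigma_determinant by blast
    have e: "esigma p q (a + b) * esigma p q (a - b) * esigma p q (c + d) * esigma p q (c - d)
        = (f a * g b - g a * f b) * (f c * g d - g c * f d)" for a b c d
      unfolding fg[symmetric] by (simp only: mult.assoc)
    show ?thesis unfolding e by (simp add: algebra_simps)
  qed
  show "esigma p q (of_nat n) \<noteq> 0" if n: "n > 0" for n
  proof
    assume "esigma p q (of_nat n) = 0"
    then have "etheta p (qpow q (2 * of_nat n)) = 0" by (simp add: esigma_def)
    moreover have e: "qpow q (2 * of_nat n) = of_real (q ^ (2 * n))"
      using qpow_of_nat[of "2 * n"] by simp
    ultimately obtain j where "complex_of_real (q ^ (2 * n)) * of_real p ^ j = 1
        \<or> complex_of_real (q ^ (2 * n)) = of_real p ^ Suc j"
      using etheta_zero_iff[OF p, of "qpow q (2 * of_nat n)"] by auto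
    then have "q ^ (2 * n) * p ^ j = 1 \<or> q ^ (2 * n) = p ^ Suc j"
      unfolding of_real_power[symmetric] of_real_mult[symmetric] of_real_eq_1_iff of_real_eq_iff .
    moreover have "q ^ (2 * n) * p ^ j < 1"
    proof -
      have "q ^ (2 * n) < 1" using q n by (simp add: power_less_one_iff)
      moreover have "p ^ j \<le> 1" "0 \<le> p ^ j" "0 \<le> q ^ (2 * n)" using p q by (simp_all add: power_le_one)
      ultimately show ?thesis using mult_right_le_one_le[of "q ^ (2 * n)" "p ^ j"] by linarith
    qed
    ultimately show False
      using alg_independent_power_neq[OF assms, of "Suc j" "2 * n"] by auto
  qed
qed

end

section \<open>Elliptic series in the symmetrized notation\<close>

locale elliptic_base =
  fixes p q :: real
  assumes p: "0 < p" "p < 1" and q: "0 < q" "q < 1" and indep: "alg_independent2 p q"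
begin

sublocale continuous_sigma_function "esigma p q"
proof -
  interpret sigma_function "esigma p q" by (rule sigma_function_esigma[OF p q indep])
  show "continuous_sigma_function (esigma p q)"
    by unfold_locales (rule isCont_esigma[OF p q], rule countable_esigma_zeros[OF p q])
qed

abbreviation "e \<equiv> qpow q"

lemmas e_add = qpow_add[OF p q] and e_diff = qpow_diff[OF p q]

lemma e_pow: "complex_of_real q ^ (2 * n) = e (2 * of_nat n)"
  using qpow_of_nat[OF p q, of "2 * n"] by simp

text \<open>Oriented as rewrite rules, the following two collect all powers of \<open>q\<close> of a product or quotient in front.\<close>
lemma e_mult: "(e u * s) * (e v * r) = e (u + v) * (s * r)"
  by (simp add: e_add)

lemma e_div: "(e u * s) / (e v * r) = e (u - v) * (s / r)"
  by (simp add: e_diff)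

lemma etheta_sigma: "y = 2 * x \<Longrightarrow> etheta p (e y) = e x * esigma p q x"
  using etheta_qpow[OF p q] by simp

lemma efact_sigma: "y = 2 * x \<Longrightarrow> efact p q (e y) n = e (of_nat n * x + of_nat (tri n)) * sf x n"
proof (induction n)
  case 0
  then show ?case by (simp add: efact_def q less_imp_neq[OF q(1), symmetric])
next
  case (Suc n)
  have "e y * of_real q ^ (2 * n) = e (2 * (x + of_nat n))"
    unfolding e_pow Suc.prems e_add[symmetric] by (simp only: distrib_left)
  then have "efact p q (e y) (Suc n) = efact p q (e y) n * (e (x + of_nat n) * esigma p q (x + of_nat n))"
    by (simp only: efact_def prod.lessThan_Suc etheta_sigma[OF refl])
  also have "\<dots> = e (of_nat n * x + of_nat (tri n) + (x + of_nat n)) * (sf x n * esigma p q (x + of_nat n))"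
    unfolding Suc.IH[OF Suc.prems] by (rule e_mult)
  also have "of_nat n * x + of_nat (tri n) + (x + of_nat n) = of_nat (Suc n) * x + of_nat (tri (Suc n))"
    by (simp add: algebra_simps)
  finally show ?case by (simp only: sf_Suc)
qed

lemma q2: "complex_of_real q ^ 2 = e (2 * 1)"
  using e_pow[of 1] by simp

text \<open>By the balancing condition the power of \<open>q\<close> in the \<open>s\<close>-th term does not depend on \<open>s\<close>.\<close>
lemma ew_series_reg_sigma:
  assumes bal: "b + x1 + x2 + x3 + x4 + x5 + x6 = 3 * a + 2" and m: "m \<le> n"
    and A: "A = 2 * a" and B: "B = 2 * b"
    and Y: "y1 = 2 * x1" "y2 = 2 * x2" "y3 = 2 * x3" "y4 = 2 * x4" "y5 = 2 * x5" "y6 = 2 * x6"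
  shows "ew_series_reg p q (e A) (e B) [e y1, e y2, e y3, e y4, e y5, e y6] n m =
    e (of_nat n * (a + 1 - b) + of_nat (tri n)) *
    (\<Sum>s\<le>m. esigma p q (a + 2 * of_nat s) * (sf a s * sf b s * sf x1 s * sf x2 s * sf x3 s * sf x4 s * sf x5 s * sf x6 s)
       * sf (a + 1 - b + of_nat s) (n - s)
     / (esigma p q a * (sf 1 s * sf (a + 1 - x1) s * sf (a + 1 - x2) s * sf (a + 1 - x3) s * sf (a + 1 - x4) s
         * sf (a + 1 - x5) s * sf (a + 1 - x6) s)))"
  unfolding ew_series_reg_def sum_distrib_left
proof (rule sum.cong[OF refl])
  fix s assume "s \<in> {..m}"
  then have s: "s \<le> n" using m by simp
  define d where "d = n - s"
  have n: "n = s + d" using s by (simp add: d_def)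
  have b: "b = 3 * a + 2 - x1 - x2 - x3 - x4 - x5 - x6" using bal by (simp add: algebra_simps)
  have q4: "of_real q ^ (4 * s) = e (2 * (2 * of_nat s))" using e_pow[of "2 * s"] by simp
  have args: "e A * of_real q ^ (4 * s) = e (2 * (a + 2 * of_nat s))"
    "e A * of_real q ^ 2 / e B * of_real q ^ (2 * s) = e (2 * (a + 1 - b + of_nat s))"
    "e A * of_real q ^ 2 / e y1 = e (2 * (a + 1 - x1))" "e A * of_real q ^ 2 / e y2 = e (2 * (a + 1 - x2))"
    "e A * of_real q ^ 2 / e y3 = e (2 * (a + 1 - x3))" "e A * of_real q ^ 2 / e y4 = e (2 * (a + 1 - x4))"
    "e A * of_real q ^ 2 / e y5 = e (2 * (a + 1 - x5))" "e A * of_real q ^ 2 / e y6 = e (2 * (a + 1 - x6))"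
    unfolding A B Y q4 e_pow q2 e_add[symmetric] e_diff[symmetric]
    by (simp_all only: distrib_left right_diff_distrib)
  have qs: "of_real q ^ (2 * s) = e (2 * of_nat s) * 1" by (simp only: e_pow mult_1_right)
  show "etheta p (e A * of_real q ^ (4 * s)) * efacts p q (e A # e B # [e y1, e y2, e y3, e y4, e y5, e y6]) s
      * of_real q ^ (2 * s) * efact p q (e A * (of_real q)\<^sup>2 / e B * of_real q ^ (2 * s)) (n - s)
      / ew_den p q (e A) [e y1, e y2, e y3, e y4, e y5, e y6] s
    = e (of_nat n * (a + 1 - b) + of_nat (tri n)) *
     (esigma p q (a + 2 * of_nat s) * (sf a s * sf b s * sf x1 s * sf x2 s * sf x3 s * sf x4 s * sf x5 s * sf x6 s)
       * sf (a + 1 - b + of_nat s) (n - s)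
     / (esigma p q a * (sf 1 s * sf (a + 1 - x1) s * sf (a + 1 - x2) s * sf (a + 1 - x3) s * sf (a + 1 - x4) s
         * sf (a + 1 - x5) s * sf (a + 1 - x6) s)))"
    unfolding ew_den_def efacts_def list.map prod_list.Cons prod_list.Nil mult_1_right
    unfolding args
    unfolding q2 etheta_sigma[OF refl] efact_sigma[OF refl] etheta_sigma[OF A] efact_sigma[OF A] efact_sigma[OF B]
      efact_sigma[OF Y(1)] efact_sigma[OF Y(2)] efact_sigma[OF Y(3)] efact_sigma[OF Y(4)]
      efact_sigma[OF Y(5)] efact_sigma[OF Y(6)]
    unfolding qs e_mult e_div
    by (rule arg_cong2[where f = "\<lambda>u v. e u * v"])
       (simp add: n b tri_add algebra_simps, simp only: mult_div_ac mult_1_left mult_1_right)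
qed

text \<open>If its denominator does not vanish, the regularized series is the ordinary one multiplied by the
  regularizing factor.\<close>
lemma ew_series_regularize:
  assumes "m \<le> n" and nz: "\<And>s. s \<le> m \<Longrightarrow> efact p q (a1 * of_real q ^ 2 / b) s \<noteq> 0"
  shows "efact p q (a1 * of_real q ^ 2 / b) n * ew_series p q a1 (b # as) m = ew_series_reg p q a1 b as n m"
  unfolding ew_series_def ew_series_reg_def sum_distrib_left
proof (rule sum.cong[OF refl])
  fix s assume "s \<in> {..m}"
  then have s: "s \<le> m" "s \<le> n" using assms(1) by auto
  define c where "c = a1 * of_real q ^ 2 / b"
  have split: "efact p q c n = efact p q c s * efact p q (c * of_real q ^ (2 * s)) (n - s)"
  proof -
    have "efact p q c (s + d) = efact p q c s * efact p q (c * of_real q ^ (2 * s)) d" for d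
      by (induction d) (simp_all add: efact_def power_add mult_ac)
    from this[of "n - s"] show ?thesis using s by simp
  qed
  have "efact p q c s \<noteq> 0" using nz[OF s(1)] by (simp add: c_def)
  then show "efact p q c n * (etheta p (a1 * of_real q ^ (4 * s)) * efacts p q (a1 # b # as) s
        * of_real q ^ (2 * s) / ew_den p q a1 (b # as) s)
     = etheta p (a1 * of_real q ^ (4 * s)) * efacts p q (a1 # b # as) s * of_real q ^ (2 * s)
      * efact p q (c * of_real q ^ (2 * s)) (n - s) / ew_den p q a1 as s"
    unfolding split by (simp add: ew_den_def efacts_def flip: c_def)
qed

end

context sigma_function begin

lemma vwp_quotient:
  assumes "sg a \<noteq> 0" "sf (a + 1) n \<noteq> 0" "v \<le> n"
  shows "sg (a + 2 * of_nat v) * sf a v / (sg a * sf (a + 1 + of_nat n) v) / sf (a + 1) n = vwp a n v"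
proof (cases v)
  case 0
  then show ?thesis using assms by (simp add: vwp_def)
next
  case (Suc u)
  have "sf (a + 1) u \<noteq> 0"
    using assms(2) sf_split[of u n "a + 1"] assms(3) Suc by auto
  moreover have "sf (a + 1) n * sf (a + 1 + of_nat n) v = sf (a + 1) u * sf (a + of_nat v) (n + 1)"
    using sf_add[of "a + 1" n v] sf_add[of "a + 1" u "n + 1"] Suc by (simp add: algebra_simps)
  moreover have "sf a v = sg a * sf (a + 1) u" unfolding Suc by (rule sf_rec)
  moreover have "sg a * x / (sg a * y) = x / y" for x y using assms(1) by simp
  ultimately show ?thesis using assms(1) Suc
    by (simp add: vwp_def divide_divide_eq_left mult.commute mult.left_commute)
qed

lemma sf_reflect_quotient:
  assumes "sf (1 - x - of_nat n) v \<noteq> 0" "v \<le> n"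
  shows "sf x n / sf (1 - x - of_nat n) v = (- 1) ^ n * sf (1 - x - of_nat n + of_nat v) (n - v)"
  using assms(1) sf_split[OF assms(2), of "1 - x - of_nat n"] by (subst sf_reflect) simp

lemma sf_quotient:
  assumes "sf x v \<noteq> 0" "v \<le> n"
  shows "sf x n / sf x v = sf (x + of_nat v) (n - v)"
  using assms(1) sf_split[OF assms(2), of x] by simp

text \<open>The factors that \<open>w\<^sub>1\<close> and \<open>w\<^sub>2\<close> have in common are, by reflection, the ones that clear the denominators of
  the three parameters \<open>- j\<close>, \<open>P4\<close>, \<open>P5\<close> and of the very-well-poised part; \<open>P3\<close> is cleared by the
  regularization. The four signs from the reflections cancel.\<close>
lemma summand_core:
  fixes N j n :: nat and L M w :: complex
  defines "a \<equiv> L - 2 * of_nat j - of_nat n + 1"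
  defines "P3 \<equiv> L - of_nat N - of_nat j + 1" and "P4 \<equiv> L + M + 1 - of_nat j - w" and "P5 \<equiv> L + M + 2 - of_nat j"
  assumes v: "v \<le> n" and nz: "sg a \<noteq> 0" "sf (a + 1) n \<noteq> 0" "sf (a + 1 - - of_nat j) v \<noteq> 0"
     "sf (a + 1 - P4) v \<noteq> 0" "sf (a + 1 - P5) v \<noteq> 0"
  shows "(sf (M + of_nat j + 1) n * sf (of_nat j - L - 1) n * sf (M + of_nat j - w) n / sf (2 * of_nat j - L - 1) n)
     * (sg (a + 2 * of_nat v) * (sf a v * sf P3 v * sf (- of_nat n) v * sf (- of_nat j) v * sf P4 v * sf P5 v)
        * sf (a + 1 - P3 + of_nat v) (n - v)
        / (sg a * (sf 1 v * sf (a + 1 - - of_nat n) v * sf (a + 1 - - of_nat j) v * sf (a + 1 - P4) v * sf (a + 1 - P5) v)))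
     = sf 1 n * (vcoef a n v * wpair a n (- of_nat j) v * wpair a n P3 v * wpair a n P4 v * wpair a n P5 v)"
proof -
  have g1: "sf (M + of_nat j + 1) n / sf (a + 1 - P5) v = (- 1) ^ n * sf (a + 1 - P5 + of_nat v) (n - v)"
  proof -
    have "1 - (M + of_nat j + 1) - of_nat n = a + 1 - P5" by (simp add: a_def P5_def)
    then show ?thesis using sf_reflect_quotient[of "M + of_nat j + 1" n v] nz v by metis
  qed
  have g2: "sf (of_nat j - L - 1) n / sf (a + 1 - - of_nat j) v = (- 1) ^ n * sf (a + 1 - - of_nat j + of_nat v) (n - v)"
  proof -
    have "1 - (of_nat j - L - 1) - of_nat n = a + 1 - - of_nat j" by (simp add: a_def)
    then show ?thesis using sf_reflect_quotient[of "of_nat j - L - 1" n v] nz v by metis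
  qed
  have g3: "sf (M + of_nat j - w) n / sf (a + 1 - P4) v = (- 1) ^ n * sf (a + 1 - P4 + of_nat v) (n - v)"
  proof -
    have "1 - (M + of_nat j - w) - of_nat n = a + 1 - P4" by (simp add: a_def P4_def)
    then show ?thesis using sf_reflect_quotient[of "M + of_nat j - w" n v] nz v by metis
  qed
  have g4: "sf (2 * of_nat j - L - 1) n = (- 1) ^ n * sf (a + 1) n"
    by (subst sf_reflect) (simp add: a_def algebra_simps)
  have g5: "sf (- of_nat n) v / sf 1 v = sf 1 n * ((- 1) ^ v / (sf 1 v * sf 1 (n - v)))"
  proof -
    have "sf (1 + of_nat (n - v)) v = (- 1) ^ v * sf (- of_nat n) v"
      using v by (subst sf_reflect) (simp add: of_nat_diff)
    then have "sf 1 n = sf 1 (n - v) * ((- 1) ^ v * sf (- of_nat n) v)"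
      using sf_split[of "n - v" n 1] v by simp
    then show ?thesis using neg_one_power_cancel[of v "sf (- of_nat n) v"] by (simp add: mult_ac)
  qed
  have a1: "a + 1 - - of_nat n = a + 1 + of_nat n" by simp
  have "(sf (M + of_nat j + 1) n * sf (of_nat j - L - 1) n * sf (M + of_nat j - w) n / sf (2 * of_nat j - L - 1) n)
     * (sg (a + 2 * of_nat v) * (sf a v * sf P3 v * sf (- of_nat n) v * sf (- of_nat j) v * sf P4 v * sf P5 v)
        * sf (a + 1 - P3 + of_nat v) (n - v)
        / (sg a * (sf 1 v * sf (a + 1 - - of_nat n) v * sf (a + 1 - - of_nat j) v * sf (a + 1 - P4) v * sf (a + 1 - P5) v)))
   = (sf (M + of_nat j + 1) n / sf (a + 1 - P5) v) * (sf (of_nat j - L - 1) n / sf (a + 1 - - of_nat j) v)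
     * (sf (M + of_nat j - w) n / sf (a + 1 - P4) v) / (- 1) ^ n
     * (sg (a + 2 * of_nat v) * sf a v / (sg a * sf (a + 1 + of_nat n) v) / sf (a + 1) n)
     * (sf (- of_nat n) v / sf 1 v) * sf P3 v * sf (- of_nat j) v * sf P4 v * sf P5 v
     * sf (a + 1 - P3 + of_nat v) (n - v)"
    unfolding g4 a1 by (simp only: mult_div_ac)
  also have "\<dots> = ((- 1) ^ n * ((- 1) ^ n * ((- 1) ^ n / (- 1) ^ n))) * (sf 1 n * (vcoef a n v * wpair a n (- of_nat j) v * wpair a n P3 v * wpair a n P4 v * wpair a n P5 v))"
    unfolding g1 g2 g3 g5 vwp_quotient[OF nz(1,2) v] vcoef_def wpair_def by (simp only: mult_div_ac)
  finally show ?thesis by (simp add: neg_one_power_cancel)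
qed

end

context elliptic_base begin

context
  fixes N :: nat and L M w t z :: complex
  assumes z: "z = e (2 * t + w + 1)"
begin

lemma ser_pars1_sigma: "ser_pars1 q N L M w z l j =
   [e (2 * - of_nat l), e (2 * - of_nat j), e (2 * (L + M + 1 - of_nat j - w)), e (2 * (L + M + 2 - of_nat j)),
    e (2 * (2 - of_nat j - of_nat l - M - t)), e (2 * (t + w + of_nat N - of_nat j - of_nat l - 1 - M))]"
  unfolding ser_pars1_def z e_add[symmetric] e_diff[symmetric] list.inject
  by (intro conjI arg_cong[where f = e] refl) (simp_all add: algebra_simps)

lemma ser_pars2_sigma: "ser_pars2 q N L M w z l j =
   [e (2 * - of_nat l), e (2 * - of_nat j), e (2 * (L + M + 1 - of_nat j - w)), e (2 * (L + M + 2 - of_nat j)),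
    e (2 * (1 - of_nat j - of_nat l - M - t)), e (2 * (t + w + of_nat N - of_nat j - of_nat l - M))]"
  unfolding ser_pars2_def z e_add[symmetric] e_diff[symmetric] list.inject
  by (intro conjI arg_cong[where f = e] refl) (simp_all add: algebra_simps)

lemma ew_den_nzD:
  assumes "ew_den p q (e (2 * a)) [e (2 * x1), e (2 * x2), e (2 * x3), e (2 * x4), e (2 * x5), e (2 * x6)] s \<noteq> 0"
  shows "esigma p q a \<noteq> 0" "sf (a + 1 - x1) s \<noteq> 0" "sf (a + 1 - x2) s \<noteq> 0" "sf (a + 1 - x3) s \<noteq> 0"
    "sf (a + 1 - x4) s \<noteq> 0" "sf (a + 1 - x5) s \<noteq> 0" "sf (a + 1 - x6) s \<noteq> 0"
proof -
  have args: "e (2 * a) * of_real q ^ 2 / e (2 * x) = e (2 * (a + 1 - x))" for x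
    unfolding q2 e_add[symmetric] e_diff[symmetric] by (simp only: distrib_left right_diff_distrib)
  show "esigma p q a \<noteq> 0" "sf (a + 1 - x1) s \<noteq> 0" "sf (a + 1 - x2) s \<noteq> 0" "sf (a + 1 - x3) s \<noteq> 0"
    "sf (a + 1 - x4) s \<noteq> 0" "sf (a + 1 - x5) s \<noteq> 0" "sf (a + 1 - x6) s \<noteq> 0"
    using assms unfolding ew_den_def efacts_def list.map args etheta_sigma[OF refl] efact_sigma[OF refl]
    by simp_all
qed

text \<open>Both cases in the definitions of \<open>w1R1\<close> and \<open>w2R2\<close> agree: for \<open>l + j \<le> N\<close> the denominator of \<open>ser_b\<close> is
  a product of values of \<open>\<sigma>\<close> at positive integers, hence nonzero.\<close>
lemma regularized_product:
  "(if l + j \<le> N then efact p q (e (- 2 * (of_nat N - of_nat j))) l * W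
        * ew_series p q (ser_a1 q L l j) (ser_b q N L j # as) (min l j)
     else W * comp_factor q N l j * ew_series_reg p q (ser_a1 q L l j) (ser_b q N L j) as l (min l j))
   = W * comp_factor q N l j * ew_series_reg p q (ser_a1 q L l j) (ser_b q N L j) as l (min l j)"
proof (cases "l + j \<le> N")
  case True
  define c where "c = of_nat N - of_nat j - of_nat l + (1 :: complex)"
  have C: "ser_a1 q L l j * of_real q ^ 2 / ser_b q N L j = e (2 * c)"
    unfolding ser_a1_def ser_b_def q2 e_add[symmetric] e_diff[symmetric]
    by (rule arg_cong[where f = e]) (simp add: c_def algebra_simps)
  have nz: "sf c s \<noteq> 0" for s
  proof (rule sf_nz)
    fix i
    have "c + of_nat i = of_nat (N - j - l + 1 + i)" using True by (simp add: c_def of_nat_diff)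
    then show "esigma p q (c + of_nat i) \<noteq> 0" using sg_nat_nz[of "N - j - l + 1 + i"] by (simp only:) simp
  qed
  have "efact p q (e (- 2 * (of_nat N - of_nat j))) l = comp_factor q N l j * efact p q (e (2 * c)) l"
  proof -
    have "efact p q (e (- 2 * (of_nat N - of_nat j))) l
        = e (of_nat l * (of_nat j - of_nat N) + of_nat (tri l)) * sf (of_nat j - of_nat N) l"
      by (rule efact_sigma) simp
    also have "sf (of_nat j - of_nat N) l = (- 1) ^ l * sf c l"
      by (subst sf_reflect) (simp add: c_def algebra_simps)
    also have "of_nat l * (of_nat j - of_nat N) + of_nat (tri l) = (- 2 * of_nat l * (of_nat N - of_nat j)
         + of_nat l * (of_nat l - 1)) + (of_nat l * c + of_nat (tri l))"
      by (simp add: c_def algebra_simps)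
    finally show ?thesis
      unfolding comp_factor_def efact_sigma[OF refl] e_add by (simp only: mult_ac)
  qed
  moreover have "efact p q (e (2 * c)) l * ew_series p q (ser_a1 q L l j) (ser_b q N L j # as) (min l j)
     = ew_series_reg p q (ser_a1 q L l j) (ser_b q N L j) as l (min l j)"
    using ew_series_regularize[of "min l j" l "ser_a1 q L l j" "ser_b q N L j" as] nz
    by (simp add: C efact_sigma[OF refl] q_nz[OF p q])
  ultimately show ?thesis using True by (simp add: mult_ac)
qed simp

lemma comp_sigma: "comp_factor q N l j = e (- 2 * of_nat l * (of_nat N - of_nat j) + of_nat l * (of_nat l - 1)) * (- 1) ^ l"
  by (simp add: comp_factor_def)

lemma w1_rest_sigma: "w1_rest p q N L M w z l j =
   e (4 * of_nat l + 2 * of_nat j + of_nat l * (2 * t - 2 * M - of_nat j + 2 * w - 7 - L + 3 * of_nat N) - 4 * of_nat (tri l))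
   * (weight1 N L M w l * (sf (L + M + t - of_nat j) l * (sf (M + of_nat j + 1) l * sf (of_nat j - L - 1) l * sf (M + of_nat j - w) l))
     / (sf (M + 2 - of_nat N - w - t + of_nat j) l * sf (2 * of_nat j - L - 1) l))"
proof -
  define D where "D = L + 2 * M + 1 - of_nat N - w"
  \<comment> \<open>The exponents of the factorials, each written as twice an argument of \<open>\<sigma>\<close>. As premises of
    \<open>efact_sigma\<close> they yield rewrite rules, also where both sides look the same.\<close>
  have eqs: "2 * (L - w + 2 * M - of_nat N + 1) = 2 * D"
    "2 * (L - w + 2 * M + 2) = 2 * (L - w + 2 * M + 2)"
    "- 2 * (of_nat N - 2 - M - of_nat j) - w + 1 - (2 * t + w + 1) = 2 * (M + 2 - of_nat N - w - t + of_nat j)"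
    "2 * (L - of_nat N + M + 2) = 2 * (L - of_nat N + M + 2)"
    "2 * (M + 1) = 2 * (M + 1)"
    "- 2 * (L - 2 * of_nat j + 1) = 2 * (2 * of_nat j - L - 1)"
    "- 2 * of_nat N = 2 * (- of_nat N :: complex)"
    "- 2 * (w - M) = 2 * (M - w)"
    "2 * (L - of_nat N - w + M + 1) = 2 * (L - of_nat N - w + M + 1)"
    "2 * (L - w + 2 * M - of_nat N + 1 + 2 * of_nat l) = 2 * (D + 2 * of_nat l)"
    "2 * t + w + 1 + (2 * (L - of_nat j + M) - w - 1) = 2 * (L + M + t - of_nat j)"
    "2 * (M + of_nat j + 1) = 2 * (M + of_nat j + 1)"
    "- 2 * (L - of_nat j + 1) = 2 * (of_nat j - L - 1)"
    "- 2 * (w - M - of_nat j) = 2 * (M + of_nat j - w)"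
    by (simp_all add: D_def algebra_simps)
  have e1: "e (2 * of_nat l + 2 * of_nat j) = e (2 * of_nat l + 2 * of_nat j) * 1" by simp
  show ?thesis
    unfolding w1_rest_def w1_den_def efacts_def list.map prod_list.Cons prod_list.Nil mult_1_right
    unfolding z e_add[symmetric] e_diff[symmetric]
    unfolding eqs[THEN efact_sigma] eqs[THEN etheta_sigma]
    unfolding q2 efact_sigma[OF refl]
    by (subst e1, unfold e_mult e_div weight1_def, fold D_def, rule arg_cong2[where f = "\<lambda>u v. e u * v"],
        simp add: D_def algebra_simps, simp only: mult_div_ac mult_1_left mult_1_right)
qed

lemma w2_rest_sigma: "w2_rest p q N L M w z k j =
   e (of_nat k * (2 * M - of_nat j + 3 - of_nat N - 2 * t - 2 * w + L) + 2 * of_nat (tri k))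
   * (sf (L + M + 2 - of_nat N - of_nat j - t - w) k * (sf (M + of_nat j + 1) k * sf (of_nat j - L - 1) k * sf (M + of_nat j - w) k)
     / (sf (M + t + of_nat j) k * sf (2 * of_nat j - L - 1) k))"
proof -
  have eqs: "2 * (M + of_nat j + 1) = 2 * (M + of_nat j + 1)"
    "- 2 * (L - of_nat j + 1) = 2 * (of_nat j - L - 1)"
    "- 2 * (w - M - of_nat j) = 2 * (M + of_nat j - w)"
    "- 2 * (of_nat N - 3 - L + of_nat j - M) - w - 1 - (2 * t + w + 1) = 2 * (L + M + 2 - of_nat N - of_nat j - t - w)"
    "- 2 * (L - 2 * of_nat j + 1) = 2 * (2 * of_nat j - L - 1)"
    "2 * t + w + 1 + (2 * (M + of_nat j) - w - 1) = 2 * (M + t + of_nat j)"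
    by (simp_all add: algebra_simps)
  show ?thesis
    unfolding w2_rest_def w2_den_def efacts_def list.map prod_list.Cons prod_list.Nil mult_1_right
    unfolding z e_add[symmetric] e_diff[symmetric]
    unfolding eqs[THEN efact_sigma]
    by (unfold e_mult e_div, rule arg_cong2[where f = "\<lambda>u v. e u * v"],
        simp add: algebra_simps, simp only: mult_div_ac mult_1_left mult_1_right)
qed

lemma h_num_sigma: "h_num p q N L M w z n =
   e (of_nat n * (2 - 3 * L) + 6 * of_nat (tri n) + of_nat (2 * n) * (- L - 1) + of_nat (tri (2 * n))
     + of_nat N * (2 * w + 2 * t - 2 * L - 2 * M - 2) + 4 * of_nat (tri N))
   * ((sf 1 n * sf (- L - M - 1) n * sf (w - L - M) n * sf (of_nat N - L) n) * sf (- L - 1) (2 * n)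
     * (sf (t + M) n * sf (M + 2 - of_nat N - w - t) n)
     * (sf (w - L - 2 * M - 1) N * sf (- L) N) * (sf (t + w) N * sf (t - 1) N))"
proof -
  have eqs: "- 2 * (L + M + 1) = 2 * (- L - M - 1)" "- 2 * (L - w + M) = 2 * (w - L - M)"
    "- 2 * (L - of_nat N) = 2 * (of_nat N - L)" "- 2 * (L + 1) = 2 * (- L - 1)"
    "2 * t + w + 1 + (2 * M - w - 1) = 2 * (t + M)"
    "2 * (M - of_nat N) - w + 5 - (2 * t + w + 1) = 2 * (M + 2 - of_nat N - w - t)"
    "- 2 * (L - w + 2 * M + 1) = 2 * (w - L - 2 * M - 1)" "- 2 * L = 2 * - L"
    "2 * t + w + 1 + (w - 1) = 2 * (t + w)" "2 * t + w + 1 + (- w - 3) = 2 * (t - 1)"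
    by (simp_all add: algebra_simps)
  show ?thesis
    unfolding h_num_def efacts_def list.map prod_list.Cons prod_list.Nil mult_1_right
    unfolding z e_add[symmetric] e_diff[symmetric]
    unfolding eqs[THEN efact_sigma]
    unfolding q2 efact_sigma[OF refl]
    by (unfold e_mult, rule arg_cong2[where f = "\<lambda>u v. e u * v"],
        simp add: algebra_simps, simp only: mult_ac)
qed

lemma h_den_sigma: "h_den p q N L M w z n =
   e (of_nat n * (- 3 * L - 2) + 6 * of_nat (tri n) + of_nat (2 * n) * (- L) + of_nat (tri (2 * n))
     + of_nat N * (2 * w + 2 * t - 2 * L - 2 * M - 2) + 4 * of_nat (tri N))
   * ((sf (M + 1) n * sf (- of_nat N) n * sf (M - w) n * sf (- L - 1) n) * sf (- L) (2 * n)
     * (sf (- L - M - t) n * sf (t + w + of_nat N - 2 - L - M) n)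
     * (sf (- L - M - 1) N * sf (w - L - M) N) * (sf (t + M) N * sf (t + w - M - 1) N))"
proof -
  have eqs: "2 * (M + 1) = 2 * (M + 1)" "- 2 * of_nat N = 2 * (- of_nat N :: complex)"
    "- 2 * (w - M) = 2 * (M - w)" "- 2 * (L + 1) = 2 * (- L - 1)" "- 2 * L = 2 * - L"
    "- 2 * (L + M) + w + 1 - (2 * t + w + 1) = 2 * (- L - M - t)"
    "2 * t + w + 1 + (2 * (of_nat N - L - M) + w - 5) = 2 * (t + w + of_nat N - 2 - L - M)"
    "- 2 * (L + M + 1) = 2 * (- L - M - 1)" "- 2 * (L - w + M) = 2 * (w - L - M)"
    "2 * t + w + 1 + (2 * M - w - 1) = 2 * (t + M)"
    "2 * t + w + 1 + (- 2 * M + w - 3) = 2 * (t + w - M - 1)"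
    by (simp_all add: algebra_simps)
  show ?thesis
    unfolding h_den_def efacts_def list.map prod_list.Cons prod_list.Nil mult_1_right
    unfolding z e_add[symmetric] e_diff[symmetric]
    unfolding eqs[THEN efact_sigma]
    by (unfold e_mult, rule arg_cong2[where f = "\<lambda>u v. e u * v"],
        simp add: algebra_simps, simp only: mult_ac)
qed

context
  assumes nv: "nonvanishing_denominators p q N L M w z"
begin

lemma h_num_nz: "n \<le> N \<Longrightarrow> h_num p q N L M w z n \<noteq> 0"
  and h_den_nz: "n \<le> N \<Longrightarrow> h_den p q N L M w z n \<noteq> 0"
  and w1_den_nz: "n \<le> N \<Longrightarrow> j \<le> N \<Longrightarrow> w1_den p q N L M w z n j \<noteq> 0"
  and w2_den_nz: "n \<le> N \<Longrightarrow> j \<le> N \<Longrightarrow> w2_den p q L M w z n j \<noteq> 0"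
  and ew_den1_nz: "n \<le> N \<Longrightarrow> j \<le> N \<Longrightarrow> v \<le> min n j \<Longrightarrow>
     ew_den p q (ser_a1 q L n j) (ser_pars1 q N L M w z n j) v \<noteq> 0"
  and ew_den2_nz: "n \<le> N \<Longrightarrow> j \<le> N \<Longrightarrow> v \<le> min n j \<Longrightarrow>
     ew_den p q (ser_a1 q L n j) (ser_pars2 q N L M w z n j) v \<noteq> 0"
  using nv unfolding nonvanishing_denominators_def by blast+

lemmas ew1_nzD = ew_den1_nz[unfolded ser_pars1_sigma ser_a1_def, THEN ew_den_nzD(1)]
  ew_den1_nz[unfolded ser_pars1_sigma ser_a1_def, THEN ew_den_nzD(2)]
  ew_den1_nz[unfolded ser_pars1_sigma ser_a1_def, THEN ew_den_nzD(3)]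
  ew_den1_nz[unfolded ser_pars1_sigma ser_a1_def, THEN ew_den_nzD(4)]
  ew_den1_nz[unfolded ser_pars1_sigma ser_a1_def, THEN ew_den_nzD(5)]
  ew_den1_nz[unfolded ser_pars1_sigma ser_a1_def, THEN ew_den_nzD(6)]
  ew_den1_nz[unfolded ser_pars1_sigma ser_a1_def, THEN ew_den_nzD(7)]

lemmas ew2_nzD = ew_den2_nz[unfolded ser_pars2_sigma ser_a1_def, THEN ew_den_nzD(6)]
  ew_den2_nz[unfolded ser_pars2_sigma ser_a1_def, THEN ew_den_nzD(7)]

lemma w1_den_nzD:
  assumes "n \<le> N" "j \<le> N"
  shows "esigma p q (L + 2 * M + 1 - of_nat N - w) \<noteq> 0" "sf (L - w + 2 * M + 2) n \<noteq> 0"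
    "sf (M + 2 - of_nat N - w - t + of_nat j) n \<noteq> 0" "sf (L - of_nat N + M + 2) n \<noteq> 0"
    "sf (M + 1) n \<noteq> 0" "sf (2 * of_nat j - L - 1) n \<noteq> 0" "sf (- of_nat N) n \<noteq> 0" "sf (M - w) n \<noteq> 0"
    "sf (L - of_nat N - w + M + 1) n \<noteq> 0"
proof -
  have eqs: "2 * (L - w + 2 * M - of_nat N + 1) = 2 * (L + 2 * M + 1 - of_nat N - w)"
    "2 * (L - w + 2 * M + 2) = 2 * (L - w + 2 * M + 2)"
    "- 2 * (of_nat N - 2 - M - of_nat j) - w + 1 - (2 * t + w + 1) = 2 * (M + 2 - of_nat N - w - t + of_nat j)"
    "2 * (L - of_nat N + M + 2) = 2 * (L - of_nat N + M + 2)"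
    "2 * (M + 1) = 2 * (M + 1)"
    "- 2 * (L - 2 * of_nat j + 1) = 2 * (2 * of_nat j - L - 1)"
    "- 2 * of_nat N = 2 * (- of_nat N :: complex)"
    "- 2 * (w - M) = 2 * (M - w)"
    "2 * (L - of_nat N - w + M + 1) = 2 * (L - of_nat N - w + M + 1)"
    by (simp_all add: algebra_simps)
  show "esigma p q (L + 2 * M + 1 - of_nat N - w) \<noteq> 0" "sf (L - w + 2 * M + 2) n \<noteq> 0"
    "sf (M + 2 - of_nat N - w - t + of_nat j) n \<noteq> 0" "sf (L - of_nat N + M + 2) n \<noteq> 0"
    "sf (M + 1) n \<noteq> 0" "sf (2 * of_nat j - L - 1) n \<noteq> 0" "sf (- of_nat N) n \<noteq> 0" "sf (M - w) n \<noteq> 0"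
    "sf (L - of_nat N - w + M + 1) n \<noteq> 0"
    using w1_den_nz[OF assms]
    unfolding w1_den_def efacts_def list.map prod_list.Cons prod_list.Nil mult_1_right
    unfolding z e_add[symmetric] e_diff[symmetric]
    unfolding eqs[THEN efact_sigma] eqs[THEN etheta_sigma]
    by (simp_all only: mult_eq_0_iff de_Morgan_disj simp_thms)
qed

lemma w2_den_nzD:
  assumes "n \<le> N" "j \<le> N"
  shows "sf (M + t + of_nat j) n \<noteq> 0"
proof -
  have eq: "2 * t + w + 1 + (2 * (M + of_nat j) - w - 1) = 2 * (M + t + of_nat j)"
    by (simp add: algebra_simps)
  have "w2_den p q L M w z n j \<noteq> 0" using w2_den_nz[OF assms] .
  then show ?thesis
    unfolding w2_den_def z e_add[symmetric] e_diff[symmetric] efact_sigma[OF eq]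
    by (simp only: mult_eq_0_iff de_Morgan_disj) blast
qed

text \<open>The denominator \<open>(q\<^bsup>-2(\<Lambda> - 2j + 1)\<^esup>)\<^sub>n\<close> of the weights, reflected.\<close>
lemma sf_a1_nz:
  assumes "n \<le> N" "j \<le> N"
  shows "sf (L - 2 * of_nat j - of_nat n + 1 + 1) n \<noteq> 0"
proof -
  have "sf (2 * of_nat j - L - 1) n = (- 1) ^ n * sf (L - 2 * of_nat j - of_nat n + 1 + 1) n"
    by (subst sf_reflect) (simp add: algebra_simps)
  then show ?thesis using w1_den_nzD(6)[OF assms] by auto
qed

lemma h_nzD:
  assumes "n \<le> N"
  shows "sf (- L - M - 1) n \<noteq> 0" "sf (w - L - M) n \<noteq> 0" "sf (of_nat N - L) n \<noteq> 0" "sf (- L - 1) (2 * n) \<noteq> 0"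
    "sf (t + M) n \<noteq> 0" "sf (M + 2 - of_nat N - w - t) n \<noteq> 0" "sf (w - L - 2 * M - 1) N \<noteq> 0" "sf (- L) N \<noteq> 0"
    "sf (t + w) N \<noteq> 0" "sf (t - 1) N \<noteq> 0" "sf (t + w - M - 1) N \<noteq> 0"
  using h_num_nz[OF assms] h_den_nz[OF assms] unfolding h_num_sigma h_den_sigma
  by (simp_all only: mult_eq_0_iff de_Morgan_disj simp_thms)

text \<open>For \<open>N = 0\<close> none of the denominators of \<open>h\<close> shows this, but the series with \<open>x = j = 0\<close> has the
  denominator \<open>\<theta>(q\<^bsup>2(\<Lambda> + 1)\<^esup>)\<close>.\<close>
lemma L1_nz: "esigma p q (- L - 1) \<noteq> 0"
proof -
  have "esigma p q (L + 1) \<noteq> 0" using ew1_nzD(1)[of 0 0 0] by simp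
  then show ?thesis using sg_minus[of "L + 1"] by simp
qed

lemma admissible_params: "admissible N L M w t"
  unfolding admissible_def
proof (intro conjI allI impI)
  show "esigma p q (- L - 1) \<noteq> 0" by (rule L1_nz)
next
  fix l j v assume "l \<le> N" "j \<le> N" "v \<le> min l j"
  then show "sf (L - 2 * of_nat j - of_nat l + 1 + of_nat l + 1) v \<noteq> 0"
    and "sf (L + M + 3 - of_nat N - w - t - of_nat j) v \<noteq> 0"
    and "sf (L + M + 1 + t - of_nat j) v \<noteq> 0"
    using ew1_nzD(2)[of l j v] ew1_nzD(7)[of l j v] ew2_nzD(1)[of l j v] by (simp_all add: algebra_simps)
next
  fix n assume "n \<le> N"
  then show "sf (M + t) n \<noteq> 0" using h_nzD(5) by (simp add: add.commute)
qed (rule h_nzD w1_den_nzD w2_den_nzD sf_a1_nz, (assumption | rule order_refl)+)+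

text \<open>The quotient of the two factorials of length \<open>2n\<close> in \<open>h\<^sub>n\<close> is the very-well-poised factor.\<close>
lemma jweight_sigma:
  assumes n: "n \<le> N"
  shows "1 / h_norm p q N L M w z n = e (- 2 * of_nat n) * jweight N L M w t n"
proof -
  note nzs = h_nzD[OF n]
  have r: "sf (- L) (2 * n) / sf (- L - 1) (2 * n) = esigma p q (- L - 1 + 2 * of_nat n) / esigma p q (- L - 1)"
  proof -
    have "esigma p q (- L - 1) * sf (- L) (2 * n) = sf (- L - 1) (2 * n) * esigma p q (- L - 1 + 2 * of_nat n)"
      using sf_rec[of "- L - 1" "2 * n"] sf_Suc[of "- L - 1" "2 * n"] by simp
    then show ?thesis using nzs(4) L1_nz by (simp add: divide_simps mult.commute)
  qed
  have "1 / h_norm p q N L M w z n = h_den p q N L M w z n / h_num p q N L M w z n"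
    by (simp add: h_norm_def)
  also have "\<dots> = e (- 2 * of_nat n) * (((sf (M + 1) n * sf (- of_nat N) n * sf (M - w) n * sf (- L - 1) n) * sf (- L) (2 * n)
     * (sf (- L - M - t) n * sf (t + w + of_nat N - 2 - L - M) n)
     * (sf (- L - M - 1) N * sf (w - L - M) N) * (sf (t + M) N * sf (t + w - M - 1) N))
    / ((sf 1 n * sf (- L - M - 1) n * sf (w - L - M) n * sf (of_nat N - L) n) * sf (- L - 1) (2 * n)
     * (sf (t + M) n * sf (M + 2 - of_nat N - w - t) n)
     * (sf (w - L - 2 * M - 1) N * sf (- L) N) * (sf (t + w) N * sf (t - 1) N)))"
    unfolding h_den_sigma h_num_sigma e_div
    by (rule arg_cong2[where f = "\<lambda>u v. e u * v"]) (simp_all add: algebra_simps)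
  also have "\<dots> = e (- 2 * of_nat n) * ((sf (- L) (2 * n) / sf (- L - 1) (2 * n))
     * ((sf (M + 1) n * sf (- of_nat N) n * sf (M - w) n * sf (- L - 1) n)
     * (sf (- L - M - t) n * sf (t + w + of_nat N - 2 - L - M) n)
     * (sf (- L - M - 1) N * sf (w - L - M) N) * (sf (t + M) N * sf (t + w - M - 1) N))
    / ((sf 1 n * sf (- L - M - 1) n * sf (w - L - M) n * sf (of_nat N - L) n)
     * (sf (t + M) n * sf (M + 2 - of_nat N - w - t) n)
     * (sf (w - L - 2 * M - 1) N * sf (- L) N) * (sf (t + w) N * sf (t - 1) N)))"
    by (simp only: mult_div_ac)
  also have "\<dots> = e (- 2 * of_nat n) * jweight N L M w t n"
    unfolding r jweight_def jnorm_def add.commute[of M t] by (simp only: mult_div_ac)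
  finally show ?thesis .
qed

text \<open>The part of the computation common to \<open>w\<^sub>1 R\<^sub>1\<close> and \<open>w\<^sub>2 R\<^sub>2\<close>, which differ in the last two parameters only.
  Their sum is fixed by the balancing condition.\<close>
lemma weighted_series:
  fixes l j :: nat and y6 y7 :: complex
  defines "a \<equiv> L - 2 * of_nat j - of_nat l + 1"
  defines "R \<equiv> sf (M + of_nat j + 1) l * sf (of_nat j - L - 1) l * sf (M + of_nat j - w) l / sf (2 * of_nat j - L - 1) l"
  assumes l: "l \<le> N" and j: "j \<le> N" and y: "y6 + y7 = 1 + w + of_nat N - 2 * of_nat j - 2 * of_nat l - 2 * M"
  shows "R * ew_series_reg p q (ser_a1 q L l j) (ser_b q N L j)
      [e (2 * - of_nat l), e (2 * - of_nat j), e (2 * (L + M + 1 - of_nat j - w)), e (2 * (L + M + 2 - of_nat j)),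
       e (2 * y6), e (2 * y7)] l (min l j)
    = e (of_nat l * (of_nat N - of_nat j - of_nat l + 1) + of_nat (tri l)) * (sf 1 l *
      (\<Sum>v\<le>min l j. vcoef a l v * wpair a l (- of_nat j) v * wpair a l (L - of_nat N - of_nat j + 1) v
         * wpair a l (L + M + 1 - of_nat j - w) v * wpair a l (L + M + 2 - of_nat j) v
         * (sf y6 v / sf (a + 1 - y6) v) * (sf y7 v / sf (a + 1 - y7) v)))"
proof -
  define P3 where "P3 = L - of_nat N - of_nat j + 1"
  define P4 where "P4 = L + M + 1 - of_nat j - w"
  define P5 where "P5 = L + M + 2 - of_nat j"
  define T where "T = (\<lambda>v. esigma p q (a + 2 * of_nat v) * (sf a v * sf P3 v * sf (- of_nat l) v * sf (- of_nat j) v * sf P4 v * sf P5 v)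
        * sf (a + 1 - P3 + of_nat v) (l - v)
        / (esigma p q a * (sf 1 v * sf (a + 1 - - of_nat l) v * sf (a + 1 - - of_nat j) v * sf (a + 1 - P4) v * sf (a + 1 - P5) v)))"
  have core: "R * T v = sf 1 l * (vcoef a l v * wpair a l (- of_nat j) v * wpair a l P3 v * wpair a l P4 v * wpair a l P5 v)"
    if "v \<le> min l j" for v
    using summand_core[of v l L j M w N] ew1_nzD(1,3,4,5)[OF l j that] sf_a1_nz[OF l j] that
    unfolding T_def R_def a_def P3_def P4_def P5_def by simp
  have "ew_series_reg p q (ser_a1 q L l j) (ser_b q N L j)
      [e (2 * - of_nat l), e (2 * - of_nat j), e (2 * P4), e (2 * P5), e (2 * y6), e (2 * y7)] l (min l j)
    = e (of_nat l * (a + 1 - P3) + of_nat (tri l)) * (\<Sum>v\<le>min l j.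
       esigma p q (a + 2 * of_nat v) * (sf a v * sf P3 v * sf (- of_nat l) v * sf (- of_nat j) v * sf P4 v * sf P5 v * sf y6 v * sf y7 v)
       * sf (a + 1 - P3 + of_nat v) (l - v)
     / (esigma p q a * (sf 1 v * sf (a + 1 - - of_nat l) v * sf (a + 1 - - of_nat j) v * sf (a + 1 - P4) v * sf (a + 1 - P5) v
         * sf (a + 1 - y6) v * sf (a + 1 - y7) v)))"
    unfolding ser_a1_def ser_b_def
  proof (rule ew_series_reg_sigma)
    have "y6 = 1 + w + of_nat N - 2 * of_nat j - 2 * of_nat l - 2 * M - y7" using y by (simp add: algebra_simps)
    then show "P3 + - of_nat l + - of_nat j + P4 + P5 + y6 + y7 = 3 * a + 2"
      by (simp add: a_def P3_def P4_def P5_def)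
  qed (simp_all add: a_def P3_def)
  also have "\<dots> = e (of_nat l * (a + 1 - P3) + of_nat (tri l)) * (\<Sum>v\<le>min l j.
      T v * (sf y6 v / sf (a + 1 - y6) v) * (sf y7 v / sf (a + 1 - y7) v))"
    unfolding T_def by (simp only: mult_div_ac)
  finally have "R * ew_series_reg p q (ser_a1 q L l j) (ser_b q N L j)
      [e (2 * - of_nat l), e (2 * - of_nat j), e (2 * P4), e (2 * P5), e (2 * y6), e (2 * y7)] l (min l j)
    = e (of_nat l * (a + 1 - P3) + of_nat (tri l)) * (\<Sum>v\<le>min l j.
      R * T v * (sf y6 v / sf (a + 1 - y6) v) * (sf y7 v / sf (a + 1 - y7) v))"
    by (simp add: sum_distrib_left mult_ac)
  also have "(\<Sum>v\<le>min l j. R * T v * (sf y6 v / sf (a + 1 - y6) v) * (sf y7 v / sf (a + 1 - y7) v))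
    = sf 1 l * (\<Sum>v\<le>min l j. vcoef a l v * wpair a l (- of_nat j) v * wpair a l P3 v * wpair a l P4 v * wpair a l P5 v
         * (sf y6 v / sf (a + 1 - y6) v) * (sf y7 v / sf (a + 1 - y7) v))"
    unfolding sum_distrib_left by (rule sum.cong[OF refl]) (simp add: core mult.assoc)
  also have "a + 1 - P3 = of_nat N - of_nat j - of_nat l + 1" by (simp add: a_def P3_def)
  finally show ?thesis unfolding P3_def P4_def P5_def .
qed

text \<open>The factor \<open>(L + M + t - j)\<^sub>l\<close> of \<open>w\<^sub>1\<close> clears the denominator of \<open>y6\<close>. The power of \<open>q\<close> depends on \<open>j\<close>
  only through \<open>q\<^bsup>2j\<^esup>\<close>.\<close>
lemma w1R1_sigma:
  assumes l: "l \<le> N" and j: "j \<le> N"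
  shows "w1R1 p q N L M w z l j = e (2 * of_nat j +
     (of_nat l * (2 * t - 2 * M + 2 * w - 3 - L + 2 * of_nat N) - 3 * of_nat (tri l))) * entry1 N L M w t l j"
proof -
  define a where "a = L - 2 * of_nat j - of_nat l + 1"
  define y6 where "y6 = 2 - of_nat j - of_nat l - M - t"
  define y7 where "y7 = t + w + of_nat N - of_nat j - of_nat l - 1 - M"
  define c where "c = M + 2 - of_nat N - w - t + of_nat j"
  define u where "u = L + M + t - of_nat j"
  define T where "T = (\<lambda>v. vcoef a l v * wpair a l (- of_nat j) v * wpair a l (L - of_nat N - of_nat j + 1) v
         * wpair a l (L + M + 1 - of_nat j - w) v * wpair a l (L + M + 2 - of_nat j) v)"
  define R where "R = sf (M + of_nat j + 1) l * sf (of_nat j - L - 1) l * sf (M + of_nat j - w) l / sf (2 * of_nat j - L - 1) l"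
  define X where "X = e (4 * of_nat l + 2 * of_nat j + of_nat l * (2 * t - 2 * M - of_nat j + 2 * w - 7 - L + 3 * of_nat N) - 4 * of_nat (tri l)
       + (- 2 * of_nat l * (of_nat N - of_nat j) + of_nat l * (of_nat l - 1)))"
  have y: "y6 + y7 = 1 + w + of_nat N - 2 * of_nat j - 2 * of_nat l - 2 * M" by (simp add: y6_def y7_def)
  have u: "a + 1 - y6 = u" by (simp add: a_def y6_def u_def)
  have d: "a + 1 - y7 = L + M + 3 - of_nat N - w - t - of_nat j" by (simp add: a_def y7_def)
  have clear: "sf u l * (T v * (sf y6 v / sf (a + 1 - y6) v) * (sf y7 v / sf (a + 1 - y7) v))
      = T v * wpair a l y6 v * (sf y7 v / sf (a + 1 - y7) v)" if v: "v \<le> min l j" for v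
  proof -
    have "sf (a + 1 - y6) v \<noteq> 0" using ew1_nzD(6)[OF l j v] unfolding a_def y6_def .
    then have "sf u l / sf (a + 1 - y6) v = sf (a + 1 - y6 + of_nat v) (l - v)"
      unfolding u by (rule sf_quotient) (use v in simp)
    moreover have "sf u l * (T v * (sf y6 v / sf (a + 1 - y6) v) * (sf y7 v / sf (a + 1 - y7) v))
        = T v * (sf y6 v * (sf u l / sf (a + 1 - y6) v)) * (sf y7 v / sf (a + 1 - y7) v)"
      by (simp only: mult_div_ac)
    ultimately show ?thesis by (simp only: wpair_def)
  qed
  have "w1R1 p q N L M w z l j = w1_rest p q N L M w z l j * comp_factor q N l j
     * ew_series_reg p q (ser_a1 q L l j) (ser_b q N L j) (ser_pars1 q N L M w z l j) l (min l j)"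
    unfolding w1R1_def w1_def by (rule regularized_product)
  also have "\<dots> = X * ((weight1 N L M w l * sf u l / sf c l * (- 1) ^ l) * (R *
      ew_series_reg p q (ser_a1 q L l j) (ser_b q N L j) (ser_pars1 q N L M w z l j) l (min l j)))"
    unfolding w1_rest_sigma comp_sigma e_mult u_def[symmetric] c_def[symmetric] R_def X_def by (simp only: mult_div_ac)
  also have "R * ew_series_reg p q (ser_a1 q L l j) (ser_b q N L j) (ser_pars1 q N L M w z l j) l (min l j)
    = e (of_nat l * (of_nat N - of_nat j - of_nat l + 1) + of_nat (tri l)) * (sf 1 l *
      (\<Sum>v\<le>min l j. T v * (sf y6 v / sf (a + 1 - y6) v) * (sf y7 v / sf (a + 1 - y7) v)))"
    unfolding ser_pars1_sigma R_def T_def a_def y6_def[symmetric] y7_def[symmetric] by (rule weighted_series[OF l j y])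
  also have "X * ((weight1 N L M w l * sf u l / sf c l * (- 1) ^ l) * (e (of_nat l * (of_nat N - of_nat j - of_nat l + 1) + of_nat (tri l)) * (sf 1 l *
      (\<Sum>v\<le>min l j. T v * (sf y6 v / sf (a + 1 - y6) v) * (sf y7 v / sf (a + 1 - y7) v)))))
    = X * e (of_nat l * (of_nat N - of_nat j - of_nat l + 1) + of_nat (tri l)) * ((- 1) ^ l * sf 1 l * weight1 N L M w l / sf c l *
      (\<Sum>v\<le>min l j. sf u l * (T v * (sf y6 v / sf (a + 1 - y6) v) * (sf y7 v / sf (a + 1 - y7) v))))"
    unfolding sum_distrib_left[symmetric] by (simp only: mult_div_ac)
  also have "(\<Sum>v\<le>min l j. sf u l * (T v * (sf y6 v / sf (a + 1 - y6) v) * (sf y7 v / sf (a + 1 - y7) v)))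
      = series1 N L M w t l j"
    unfolding series1_def Let_def a_def[symmetric] y6_def[symmetric] y7_def[symmetric] d[symmetric]
    by (rule sum.cong[OF refl], subst clear, simp, simp only: T_def)
  also have "(- 1) ^ l * sf 1 l * weight1 N L M w l / sf c l * series1 N L M w t l j = entry1 N L M w t l j"
    unfolding entry1_def c_def by (simp only: mult_div_ac)
  also have "X * e (of_nat l * (of_nat N - of_nat j - of_nat l + 1) + of_nat (tri l)) = e (2 * of_nat j +
     (of_nat l * (2 * t - 2 * M + 2 * w - 3 - L + 2 * of_nat N) - 3 * of_nat (tri l)))"
    unfolding X_def e_add[symmetric] by (rule arg_cong[where f = e]) (simp add: algebra_simps)
  finally show ?thesis .
qed

text \<open>Here \<open>y7\<close> is cleared by the weight. The power of \<open>q\<close> is inverse to the \<open>l\<close>-dependent one in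
  \<open>w1R1_sigma\<close>.\<close>
lemma w2R2_sigma:
  assumes l: "l \<le> N" and j: "j \<le> N"
  shows "w2R2 p q N L M w z l j = e (
     - (of_nat l * (2 * t - 2 * M + 2 * w - 3 - L + 2 * of_nat N) - 3 * of_nat (tri l))) * entry2 N L M w t l j"
proof -
  define a where "a = L - 2 * of_nat j - of_nat l + 1"
  define y6 where "y6 = 1 - of_nat j - of_nat l - M - t"
  define y7 where "y7 = t + w + of_nat N - of_nat j - of_nat l - M"
  define c where "c = M + t + of_nat j"
  define u where "u = L + M + 2 - of_nat N - of_nat j - t - w"
  define T where "T = (\<lambda>v. vcoef a l v * wpair a l (- of_nat j) v * wpair a l (L - of_nat N - of_nat j + 1) v
         * wpair a l (L + M + 1 - of_nat j - w) v * wpair a l (L + M + 2 - of_nat j) v)"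
  define R where "R = sf (M + of_nat j + 1) l * sf (of_nat j - L - 1) l * sf (M + of_nat j - w) l / sf (2 * of_nat j - L - 1) l"
  define X where "X = e (of_nat l * (2 * M - of_nat j + 3 - of_nat N - 2 * t - 2 * w + L) + 2 * of_nat (tri l)
       + (- 2 * of_nat l * (of_nat N - of_nat j) + of_nat l * (of_nat l - 1)))"
  have y: "y6 + y7 = 1 + w + of_nat N - 2 * of_nat j - 2 * of_nat l - 2 * M" by (simp add: y6_def y7_def)
  have u: "a + 1 - y7 = u" by (simp add: a_def y7_def u_def)
  have d: "a + 1 - y6 = L + M + 1 + t - of_nat j" by (simp add: a_def y6_def)
  have clear: "sf u l * (T v * (sf y6 v / sf (a + 1 - y6) v) * (sf y7 v / sf (a + 1 - y7) v))
      = T v * wpair a l y7 v * (sf y6 v / sf (a + 1 - y6) v)" if v: "v \<le> min l j" for v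
  proof -
    have "sf (a + 1 - y7) v \<noteq> 0" using ew2_nzD(2)[OF l j v] unfolding a_def y7_def .
    then have "sf u l / sf (a + 1 - y7) v = sf (a + 1 - y7 + of_nat v) (l - v)"
      unfolding u by (rule sf_quotient) (use v in simp)
    moreover have "sf u l * (T v * (sf y6 v / sf (a + 1 - y6) v) * (sf y7 v / sf (a + 1 - y7) v))
        = T v * (sf y7 v * (sf u l / sf (a + 1 - y7) v)) * (sf y6 v / sf (a + 1 - y6) v)"
      by (simp only: mult_div_ac)
    ultimately show ?thesis by (simp only: wpair_def)
  qed
  have "w2R2 p q N L M w z l j = w2_rest p q N L M w z l j * comp_factor q N l j
     * ew_series_reg p q (ser_a1 q L l j) (ser_b q N L j) (ser_pars2 q N L M w z l j) l (min l j)"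
    unfolding w2R2_def w2_def by (rule regularized_product)
  also have "\<dots> = X * ((sf u l / sf c l * (- 1) ^ l) * (R *
      ew_series_reg p q (ser_a1 q L l j) (ser_b q N L j) (ser_pars2 q N L M w z l j) l (min l j)))"
    unfolding w2_rest_sigma comp_sigma e_mult u_def[symmetric] c_def[symmetric] R_def X_def by (simp only: mult_div_ac)
  also have "R * ew_series_reg p q (ser_a1 q L l j) (ser_b q N L j) (ser_pars2 q N L M w z l j) l (min l j)
    = e (of_nat l * (of_nat N - of_nat j - of_nat l + 1) + of_nat (tri l)) * (sf 1 l *
      (\<Sum>v\<le>min l j. T v * (sf y6 v / sf (a + 1 - y6) v) * (sf y7 v / sf (a + 1 - y7) v)))"
    unfolding ser_pars2_sigma R_def T_def a_def y6_def[symmetric] y7_def[symmetric] by (rule weighted_series[OF l j y])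
  also have "X * ((sf u l / sf c l * (- 1) ^ l) * (e (of_nat l * (of_nat N - of_nat j - of_nat l + 1) + of_nat (tri l)) * (sf 1 l *
      (\<Sum>v\<le>min l j. T v * (sf y6 v / sf (a + 1 - y6) v) * (sf y7 v / sf (a + 1 - y7) v)))))
    = X * e (of_nat l * (of_nat N - of_nat j - of_nat l + 1) + of_nat (tri l)) * ((- 1) ^ l * sf 1 l / sf c l *
      (\<Sum>v\<le>min l j. sf u l * (T v * (sf y6 v / sf (a + 1 - y6) v) * (sf y7 v / sf (a + 1 - y7) v))))"
    unfolding sum_distrib_left[symmetric] by (simp only: mult_div_ac)
  also have "(\<Sum>v\<le>min l j. sf u l * (T v * (sf y6 v / sf (a + 1 - y6) v) * (sf y7 v / sf (a + 1 - y7) v)))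
      = series2 N L M w t l j"
    unfolding series2_def Let_def a_def[symmetric] y7_def[symmetric] y6_def[symmetric] d[symmetric]
    by (rule sum.cong[OF refl], subst clear, simp, simp only: T_def)
  also have "(- 1) ^ l * sf 1 l / sf c l * series2 N L M w t l j = entry2 N L M w t l j"
    unfolding entry2_def c_def by (simp only: mult_div_ac)
  also have "X * e (of_nat l * (of_nat N - of_nat j - of_nat l + 1) + of_nat (tri l)) = e (- (of_nat l * (2 * t - 2 * M + 2 * w - 3 - L + 2 * of_nat N) - 3 * of_nat (tri l)))"
    unfolding X_def e_add[symmetric] by (rule arg_cong[where f = e]) (simp add: algebra_simps)
  finally show ?thesis .
qed

text \<open>The powers \<open>q\<^bsup>2j\<^esup>\<close> of \<open>w\<^sub>1\<close> and of \<open>h\<^sub>j\<close> cancel, and the remaining one is \<open>1\<close> for \<open>k = l\<close>.\<close>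
theorem dual_biorthogonality:
  assumes k: "k \<le> N" and l: "l \<le> N"
  shows "(\<Sum>j=0..N. w1R1 p q N L M w z l j * w2R2 p q N L M w z k j / h_norm p q N L M w z j) = (if k = l then 1 else 0)"
proof -
  define g where "g = (\<lambda>l. of_nat l * (2 * t - 2 * M + 2 * w - 3 - L + 2 * of_nat N) - 3 * of_nat (tri l) :: complex)"
  have "(\<Sum>j=0..N. w1R1 p q N L M w z l j * w2R2 p q N L M w z k j / h_norm p q N L M w z j)
    = (\<Sum>j\<le>N. e (g l - g k) * (entry1 N L M w t l j * entry2 N L M w t k j * jweight N L M w t j))"
    unfolding atMost_atLeast0
  proof (rule sum.cong[OF refl])
    fix j assume "j \<in> {0..N}"
    then have j: "j \<le> N" by simp
    have "w1R1 p q N L M w z l j * w2R2 p q N L M w z k j / h_norm p q N L M w z j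
       = w1R1 p q N L M w z l j * w2R2 p q N L M w z k j * (1 / h_norm p q N L M w z j)" by simp
    also have "\<dots> = e (2 * of_nat j + g l + - g k + - 2 * of_nat j) * (entry1 N L M w t l j * entry2 N L M w t k j * jweight N L M w t j)"
      unfolding w1R1_sigma[OF l j] w2R2_sigma[OF k j] jweight_sigma[OF j] e_mult g_def by (rule refl)
    also have "2 * of_nat j + g l + - g k + - 2 * of_nat j = g l - g k" by simp
    finally show "w1R1 p q N L M w z l j * w2R2 p q N L M w z k j / h_norm p q N L M w z j
       = e (g l - g k) * (entry1 N L M w t l j * entry2 N L M w t k j * jweight N L M w t j)" .
  qed
  also have "\<dots> = e (g l - g k) * (if k = l then 1 else 0)"
    unfolding sum_distrib_left[symmetric] biorthogonality[OF admissible_params k l] ..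
  also have "\<dots> = (if k = l then 1 else 0)" by (simp add: q_nz[OF p q])
  finally show ?thesis .
qed

end

end
end

theorem theorem4p7:
  fixes p q :: real and N k l :: nat and \<Lambda> M \<omega> z :: complex
  assumes "0 < p" "p < 1" "0 < q" "q < 1"
    and "alg_independent2 p q"
    and "k \<le> N" "l \<le> N"
    and "z \<noteq> 0"
    and "nonvanishing_denominators p q N \<Lambda> M \<omega> z"
  shows "(if k = l then 1 else 0) =
    (\<Sum>j=0..N. w1R1 p q N \<Lambda> M \<omega> z l j * w2R2 p q N \<Lambda> M \<omega> z k j / h_norm p q N \<Lambda> M \<omega> z j)"
proof -
  interpret elliptic_base p q by unfold_locales (use assms in auto)
  define u where "u = Ln z / of_real (ln q)"
  define t where "t = (u - \<omega> - 1) / 2"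
  have "complex_of_real (ln q) \<noteq> 0" using assms by simp
  then have "z = qpow q u"
    unfolding qpow_exp[OF p q] u_def using assms(8) by (simp add: exp_Ln)
  also have "u = 2 * t + \<omega> + 1" by (simp add: t_def field_simps)
  finally have "z = qpow q (2 * t + \<omega> + 1)" .
  from dual_biorthogonality[OF this assms(9,6,7)] show ?thesis by simp
qed

end
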